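(* Let $d\in\mathbb{N}_+$, $T>0$, and let $f\colon\mathbb{R}^d\times[0,T]\to\mathbb{R}^d$ be continuous in $t$ and such that there exists $L>0$ with $\|f(x,t)-f(y,t)\|\le L\|x-y\|$ for all $x,y\in\mathbb{R}^d$ and all $t\in[0,T]$. Assume moreover that there exists $k>(d+1)/2+2$ with $f\in\mathcal{H}^k_{\mathrm{loc}}(\mathbb{R}^d\times[0,T];\mathbb{R}^d)$. Fix a compact set $K\subseteq\mathbb{R}^d$. Then there is a constant $C_{T,K,f}$, independent of $P$, such that for every $P\in\mathbb{N}_+$ there exist parameters $(W_i,A_i^1,A_i^2,B_i)\in\mathbb{R}^d\times\mathbb{R}^{d\times d}\times\mathbb{R}^d\times\mathbb{R}^d$, $i=1,\dots,P$, with $$\sup_{t\in[0,T]}\int_K\|\mathbf{z}_{z_0}(t)-\mathbf{x}_{z_0}(t)\|^2\,dz_0\le\frac{C_{T,K,f}}{P},$$ where $\mathbf{z}_{z_0}$ is the solution on $[0,T]$ of $\dot{\mathbf{z}}=f(\mathbf{z},t)$, $\mathbf{z}(0)=z_0$, and $\mathbf{x}_{z_0}$ is the solution on $[0,T]$ of $\dot{\mathbf{x}}=\sum_{i=1}^P W_i\circ\boldsymbol{\sigma}(A_i^1\mathbf{x}+A_i^2t+B_i)$, $\mathbf{x}(0)=z_0$.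
   Context: $\|\cdot\|$ is the Euclidean norm; $\circ$ is the Hadamard (componentwise) product; $\sigma(s)=\max\{s,0\}$ is ReLU and $\boldsymbol{\sigma}$ applies it componentwise. $\mathcal{H}^k_{\mathrm{loc}}(\mathbb{R}^d\times[0,T];\mathbb{R}^d)$ is the set of functions whose restriction to every compact set $X\subseteq\mathbb{R}^d\times[0,T]$ belongs to the Sobolev space $\mathcal{H}^k(X)=W^{k,2}(X)$ (componentwise). *)

theory Defs
  imports "HOL-Analysis.Analysis"
begin

definition relu_vec :: "real^'d \<Rightarrow> real^'d" where
  "relu_vec v = (\<chi> j. max (v $ j) 0)"

definition hadamard :: "real^'d \<Rightarrow> real^'d \<Rightarrow> real^'d" where
  "hadamard v w = (\<chi> j. v $ j * w $ j)"

definition dderiv :: "('a::real_normed_vector \<Rightarrow> real) \<Rightarrow> 'a \<Rightarrow> 'a \<Rightarrow> real" where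
  "dderiv \<phi> v = (\<lambda>z. frechet_derivative \<phi> (at z) v)"

fun iter_dderiv :: "('a::real_normed_vector \<Rightarrow> real) \<Rightarrow> 'a list \<Rightarrow> 'a \<Rightarrow> real" where
  "iter_dderiv \<phi> [] = \<phi>"
| "iter_dderiv \<phi> (v # vs) = dderiv (iter_dderiv \<phi> vs) v"

definition tsupp :: "('a::topological_space \<Rightarrow> real) \<Rightarrow> 'a set" where
  "tsupp \<phi> = closure {z. \<phi> z \<noteq> 0}"

definition test_fun :: "'a::euclidean_space set \<Rightarrow> ('a \<Rightarrow> real) \<Rightarrow> bool" where
  "test_fun U \<phi> \<longleftrightarrow>
     (\<forall>vs. \<forall>z. iter_dderiv \<phi> vs differentiable (at z))
     \<and> compact (tsupp \<phi>) \<and> tsupp \<phi> \<subseteq> U"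

definition sq_integrable_on :: "('a::euclidean_space \<Rightarrow> real) \<Rightarrow> 'a set \<Rightarrow> bool" where
  "sq_integrable_on g C \<longleftrightarrow>
     set_borel_measurable lborel C g \<and> set_integrable lborel C (\<lambda>z. (g z)\<^sup>2)"

text \<open>A scalar function u on R^d x [0,T] is in H^k_loc if for every multi-index of order
  at most k (a list of coordinate directions) it has a weak derivative on the interior
  R^d x (0,T) which is square integrable on every compact subset of R^d x [0,T]
  (the case of the empty list gives u itself).\<close>

definition Hk_loc_scalar :: "nat \<Rightarrow> real \<Rightarrow> ((real^'d::finite) \<times> real \<Rightarrow> real) \<Rightarrow> bool" where
  "Hk_loc_scalar k T u \<longleftrightarrow>
     (\<forall>C. compact C \<and> C \<subseteq> UNIV \<times> {0..T} \<longrightarrow> sq_integrable_on u C) \<and>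
     (\<forall>vs \<in> lists Basis. length vs \<le> k \<longrightarrow>
        (\<exists>g. (\<forall>C. compact C \<and> C \<subseteq> UNIV \<times> {0..T} \<longrightarrow> sq_integrable_on g C) \<and>
             (\<forall>\<phi>. test_fun (UNIV \<times> {0<..<T}) \<phi> \<longrightarrow>
                (\<integral>z. u z * iter_dderiv \<phi> vs z \<partial>lborel) =
                (-1) ^ length vs * (\<integral>z. g z * \<phi> z \<partial>lborel))))"

definition Hk_loc :: "nat \<Rightarrow> real \<Rightarrow> (real^'d \<Rightarrow> real \<Rightarrow> real^'d) \<Rightarrow> bool" where
  "Hk_loc k T f \<longleftrightarrow> (\<forall>j. Hk_loc_scalar k T (\<lambda>(x, t). f x t $ j))"

definition solves_ode_on ::
  "real \<Rightarrow> (real^'d \<Rightarrow> real \<Rightarrow> real^'d) \<Rightarrow> real^'d \<Rightarrow> (real \<Rightarrow> real^'d) \<Rightarrow> bool" where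
  "solves_ode_on T F z0 z \<longleftrightarrow>
     z 0 = z0 \<and> (\<forall>t\<in>{0..T}. (z has_vector_derivative F (z t) t) (at t within {0..T}))"

definition relu_field ::
  "nat \<Rightarrow> (nat \<Rightarrow> real^'d) \<Rightarrow> (nat \<Rightarrow> real^'d^'d) \<Rightarrow> (nat \<Rightarrow> real^'d) \<Rightarrow> (nat \<Rightarrow> real^'d)
   \<Rightarrow> real^'d \<Rightarrow> real \<Rightarrow> real^'d" where
  "relu_field P W A1 A2 B = (\<lambda>x t. \<Sum>i\<in>{1..P}. hadamard (W i) (relu_vec (A1 i *v x + t *\<^sub>R A2 i + B i)))"

end

(* By Gronwall, the distance of the two flows is controlled by the mean square of the defect
   f - f_P along the true trajectories, provided that the Lipschitz constant of f_P stays bounded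
   in P. So it suffices to approximate f, in mean square under the law of (z(s), s) with (z0, s)
   uniform on K x [0,T], by averages of P neurons with uniformly bounded weights; the components
   of the network decouple.

   Each component of f is extended across t = 0 and t = T by a higher order reflection and cut
   off; the result lies in H^k of a torus of dimension d + 1. Its Fourier coefficients c_m
   satisfy sum |m|^(2k) |c_m|^2 < oo, hence sum |m|^2 |c_m| < oo as k > (d+1)/2 + 2. A plane wave
   of frequency m is a one-dimensional integral of ReLU ridge functions of total mass O(1 + |m|^2),
   so f lies in a multiple of the closed convex hull of the neurons, and a greedy selection of
   neurons gives squared error O(1/P). *)
theory Submission
  imports Defs
begin

section \<open>Smooth functions\<close>

text \<open>Regularity travels through the proof as chains of weak derivatives in one coordinate
  direction. The weight (1 + |m|)^(2k) is at most a constant times 1 plus the sum of the (m .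
  e)^(2k) over the basis vectors e, and the product rule, reflection in time and cutoff all preserve
  the direction. The obstacle is the time boundary: weak derivatives are tested on the open slab
  only, whereas trajectories start at t = 0. Reflection is therefore transposed onto the test
  functions: for time derivatives the folded test function vanishes at both ends because the
  coefficients sum to 1, and a cutoff argument then admits it. Convex hulls are described dually, by
  integrals against bounded functions. This is exactly what the greedy choice consumes, with the
  residual as the function tested against. Neurons have weights of norm at most 1 and coefficients
  at most M/P, which bounds the Lipschitz constant of f_P by the same number for every P. The defect
  is measured along the true trajectories, which do not depend on P, so one measure and one compact
  set serve for all P.\<close>

definition smooth :: "('a::real_normed_vector \<Rightarrow> real) \<Rightarrow> bool" where
  "smooth \<phi> \<longleftrightarrow> (\<forall>vs z. iter_dderiv \<phi> vs differentiable (at z))"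

text \<open>\<open>iter_dderiv\<close> adds new derivatives on the outside. Here the recursion goes
  into the first derivative instead, so that closure under products, inverses and composition is an
  induction on the order that applies the Leibniz or chain rule once.\<close>

primrec ndiff :: "nat \<Rightarrow> ('a::real_normed_vector \<Rightarrow> real) \<Rightarrow> bool" where
  "ndiff 0 \<phi> \<longleftrightarrow> (\<forall>z. \<phi> differentiable (at z))"
| "ndiff (Suc n) \<phi> \<longleftrightarrow> (\<forall>z. \<phi> differentiable (at z)) \<and> (\<forall>v. ndiff n (dderiv \<phi> v))"

lemma dderiv_eqI: "(\<phi> has_derivative \<phi>') (at z) \<Longrightarrow> dderiv \<phi> v z = \<phi>' v"
  unfolding dderiv_def using frechet_derivative_at by metis

lemma iter_dderiv_append: "iter_dderiv \<phi> (vs @ ws) = iter_dderiv (iter_dderiv \<phi> ws) vs"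
  by (induction vs) auto

text \<open>The two recursions consume the list of directions from opposite ends; the induction
  therefore splits off the last direction, which is the one differentiated first.\<close>

lemma smooth_iff_ndiff: "smooth \<phi> \<longleftrightarrow> (\<forall>n. ndiff n \<phi>)"
proof -
  have *: "ndiff n \<phi> \<longleftrightarrow> (\<forall>vs z. length vs \<le> n \<longrightarrow> iter_dderiv \<phi> vs differentiable (at z))" for n
  proof (induction n arbitrary: \<phi>)
    case (Suc n)
    show ?case
    proof (intro iffI allI impI)
      fix vs :: "'a list" and z assume h: "ndiff (Suc n) \<phi>" and l: "length vs \<le> Suc n"
      show "iter_dderiv \<phi> vs differentiable (at z)"
      proof (cases vs rule: rev_exhaust)
        case (snoc ws v)
        then have "iter_dderiv \<phi> vs = iter_dderiv (dderiv \<phi> v) ws"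
          by (simp add: iter_dderiv_append)
        then show ?thesis using h l snoc Suc by auto
      qed (use h in auto)
    next
      assume h: "\<forall>vs z. length vs \<le> Suc n \<longrightarrow> iter_dderiv \<phi> vs differentiable (at z)"
      have "ndiff n (dderiv \<phi> v)" for v
        unfolding Suc
      proof (intro allI impI)
        fix vs :: "'a list" and z assume "length vs \<le> n"
        then show "iter_dderiv (dderiv \<phi> v) vs differentiable (at z)"
          using h[rule_format, of "vs @ [v]" z] by (simp add: iter_dderiv_append)
      qed
      moreover have "\<phi> differentiable (at z)" for z using h[rule_format, of "[]" z] by simp
      ultimately show "ndiff (Suc n) \<phi>" by simp
    qed
  qed simp
  show ?thesis unfolding smooth_def * by blast
qed

lemma ndiff_differentiable: "ndiff n \<phi> \<Longrightarrow> \<phi> differentiable (at z)"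
  by (cases n) auto

lemma ndiff_pred: "ndiff (Suc n) \<phi> \<Longrightarrow> ndiff n \<phi>"
  by (induction n arbitrary: \<phi>) auto

lemma smooth_differentiable: "smooth \<phi> \<Longrightarrow> \<phi> differentiable (at z)"
  using ndiff_differentiable smooth_iff_ndiff by blast

lemma smooth_has_derivative: "smooth \<phi> \<Longrightarrow> (\<phi> has_derivative (\<lambda>v. dderiv \<phi> v z)) (at z)"
  unfolding dderiv_def using smooth_differentiable frechet_derivative_works by metis

lemma smooth_dderiv: "smooth \<phi> \<Longrightarrow> smooth (dderiv \<phi> v)"
  unfolding smooth_iff_ndiff by (metis ndiff.simps(2))

lemma smooth_continuous_on: "smooth \<phi> \<Longrightarrow> continuous_on S \<phi>"
  by (meson continuous_at_imp_continuous_on differentiable_imp_continuous_within smooth_differentiable)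

lemma ndiff_const: "ndiff n (\<lambda>_. c)"
proof (induction n arbitrary: c)
  case (Suc n)
  have "dderiv (\<lambda>_::'a. c) v = (\<lambda>_. 0)" for v
    by (rule ext, rule dderiv_eqI[OF has_derivative_const, THEN trans]) simp
  then show ?case using Suc by simp
qed simp

lemma ndiff_add: "ndiff n \<phi> \<Longrightarrow> ndiff n \<psi> \<Longrightarrow> ndiff n (\<lambda>z. \<phi> z + \<psi> z)"
proof (induction n arbitrary: \<phi> \<psi>)
  case (Suc n)
  have "dderiv (\<lambda>z. \<phi> z + \<psi> z) v = (\<lambda>z. dderiv \<phi> v z + dderiv \<psi> v z)" for v
  proof
    fix z
    have "(\<phi> has_derivative frechet_derivative \<phi> (at z)) (at z)"
         "(\<psi> has_derivative frechet_derivative \<psi> (at z)) (at z)"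
      using Suc.prems frechet_derivative_works by (metis ndiff.simps(2))+
    from has_derivative_add[OF this]
    show "dderiv (\<lambda>z. \<phi> z + \<psi> z) v z = dderiv \<phi> v z + dderiv \<psi> v z"
      unfolding dderiv_def[of \<phi>] dderiv_def[of \<psi>] by (rule dderiv_eqI)
  qed
  then show ?case using Suc by simp
qed simp

lemma dderiv_mult:
  assumes "\<phi> differentiable (at z)" "\<psi> differentiable (at z)"
  shows "dderiv (\<lambda>z. \<phi> z * \<psi> z) v z = \<phi> z * dderiv \<psi> v z + dderiv \<phi> v z * \<psi> z"
proof -
  have "(\<phi> has_derivative frechet_derivative \<phi> (at z)) (at z)"
       "(\<psi> has_derivative frechet_derivative \<psi> (at z)) (at z)"
    using assms frechet_derivative_works by blast+
  from has_derivative_mult[OF this] show ?thesis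
    unfolding dderiv_def[of \<phi>] dderiv_def[of \<psi>] by (rule dderiv_eqI)
qed

lemma ndiff_mult: "ndiff n \<phi> \<Longrightarrow> ndiff n \<psi> \<Longrightarrow> ndiff n (\<lambda>z. \<phi> z * \<psi> z)"
proof (induction n arbitrary: \<phi> \<psi>)
  case (Suc n)
  have "dderiv (\<lambda>z. \<phi> z * \<psi> z) v = (\<lambda>z. \<phi> z * dderiv \<psi> v z + dderiv \<phi> v z * \<psi> z)" for v
    using Suc.prems by (intro ext dderiv_mult) auto
  then show ?case using Suc ndiff_pred[OF Suc.prems(1)] ndiff_pred[OF Suc.prems(2)]
    by (auto intro!: ndiff_add)
qed simp

text \<open>The derivative of 1/phi is, up to sign, the product of the derivative of phi with two
  copies of 1/phi, and the latter falls under the induction hypothesis at the lower order.\<close>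

lemma ndiff_inverse: "ndiff n \<phi> \<Longrightarrow> (\<And>z. \<phi> z \<noteq> 0) \<Longrightarrow> ndiff n (\<lambda>z. inverse (\<phi> z))"
proof (induction n arbitrary: \<phi>)
  case (Suc n)
  have "dderiv (\<lambda>z. inverse (\<phi> z)) v = (\<lambda>z. -1 * (dderiv \<phi> v z * (inverse (\<phi> z) * inverse (\<phi> z))))" (is "_ = ?d v") for v
  proof
    fix z
    have "(\<phi> has_derivative frechet_derivative \<phi> (at z)) (at z)"
      using Suc.prems frechet_derivative_works by auto
    from Deriv.has_derivative_inverse[OF Suc.prems(2) this]
    show "dderiv (\<lambda>z. inverse (\<phi> z)) v z = -1 * (dderiv \<phi> v z * (inverse (\<phi> z) * inverse (\<phi> z)))"
      by (subst dderiv_eqI, assumption) (simp add: dderiv_def)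
  qed
  moreover have "ndiff n (?d v)" for v
    using Suc ndiff_pred[OF Suc.prems(1)] by (intro ndiff_mult ndiff_const) auto
  moreover have "(\<lambda>z. inverse (\<phi> z)) differentiable (at z)" for z
    using Suc.prems by (intro differentiable_inverse) auto
  ultimately show ?case by (metis ndiff.simps(2))
qed simp

lemma dderiv_compose:
  assumes "h differentiable (at (\<phi> z))" "\<phi> differentiable (at z)"
  shows "dderiv (\<lambda>z. h (\<phi> z)) v z = dderiv h 1 (\<phi> z) * dderiv \<phi> v z"
proof -
  have 1: "(\<phi> has_derivative frechet_derivative \<phi> (at z)) (at z)"
       "(h has_derivative frechet_derivative h (at (\<phi> z))) (at (\<phi> z))"
    using assms frechet_derivative_works by blast+
  have lin: "frechet_derivative h (at (\<phi> z)) x = frechet_derivative h (at (\<phi> z)) 1 * x" for x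
    using linear_cmul[OF has_derivative_linear[OF 1(2)], of x 1] by simp
  have "dderiv (\<lambda>z. h (\<phi> z)) v z = frechet_derivative h (at (\<phi> z)) (frechet_derivative \<phi> (at z) v)"
    using dderiv_eqI[OF has_derivative_compose[OF 1]] .
  also have "\<dots> = dderiv h 1 (\<phi> z) * dderiv \<phi> v z"
    unfolding dderiv_def by (rule lin)
  finally show ?thesis .
qed

lemma ndiff_compose:
  fixes h :: "real \<Rightarrow> real"
  shows "ndiff n h \<Longrightarrow> ndiff n \<phi> \<Longrightarrow> ndiff n (\<lambda>z. h (\<phi> z))"
proof (induction n arbitrary: \<phi> h)
  case 0
  then show ?case using differentiable_chain_at[of \<phi> _ h] by (auto simp: o_def)
next
  case (Suc n)
  have "dderiv (\<lambda>z. h (\<phi> z)) v = (\<lambda>z. dderiv h 1 (\<phi> z) * dderiv \<phi> v z)" for v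
    using Suc.prems by (intro ext dderiv_compose) auto
  moreover have "(\<lambda>z. h (\<phi> z)) differentiable (at z)" for z
    using differentiable_chain_at[of \<phi> _ h] Suc.prems by (auto simp: o_def)
  ultimately show ?case using Suc ndiff_pred[OF Suc.prems(2)]
    by (auto intro!: ndiff_mult)
qed

lemma dderiv_affine:
  assumes "bounded_linear A" "\<phi> differentiable (at (c + A z))"
  shows "dderiv (\<lambda>z. \<phi> (c + A z)) v z = dderiv \<phi> (A v) (c + A z)"
proof -
  have "(\<phi> has_derivative frechet_derivative \<phi> (at (c + A z))) (at (c + A z))"
    using assms frechet_derivative_works by blast
  moreover have "((\<lambda>z. c + A z) has_derivative A) (at z)"
    using bounded_linear_imp_has_derivative[OF assms(1)] by (auto intro!: derivative_eq_intros)
  ultimately have "((\<lambda>z. \<phi> (c + A z)) has_derivative (\<lambda>x. frechet_derivative \<phi> (at (c + A z)) (A x))) (at z)"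
    by (rule has_derivative_compose[rotated])
  then show ?thesis by (simp add: dderiv_eqI) (simp add: dderiv_def)
qed

lemma ndiff_affine:
  assumes "bounded_linear A"
  shows "ndiff n \<phi> \<Longrightarrow> ndiff n (\<lambda>z. \<phi> (c + A z))"
proof -
  have d: "(\<lambda>z. \<phi> (c + A z)) differentiable (at z)" if "\<forall>z. \<phi> differentiable (at z)" for z \<phi>
    using that differentiable_chain_at[of "\<lambda>z. c + A z" z \<phi>] bounded_linear_imp_differentiable[OF assms]
    by (auto simp: o_def intro!: differentiable_add)
  show "ndiff n \<phi> \<Longrightarrow> ndiff n (\<lambda>z. \<phi> (c + A z))"
  proof (induction n arbitrary: \<phi>)
    case (Suc n)
    have "dderiv (\<lambda>z. \<phi> (c + A z)) v = (\<lambda>z. dderiv \<phi> (A v) (c + A z))" for v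
      using Suc.prems by (intro ext dderiv_affine assms) auto
    moreover have "\<forall>z. (\<lambda>z. \<phi> (c + A z)) differentiable (at z)"
      using d Suc.prems by (metis ndiff.simps(2))
    ultimately show ?case using Suc.IH Suc.prems by simp
  next
    case 0
    then show ?case unfolding ndiff.simps using d by blast
  qed
qed

lemma ndiff_linear: assumes "bounded_linear (\<phi> :: 'a::real_normed_vector \<Rightarrow> real)" shows "ndiff n \<phi>"
proof (cases n)
  case (Suc m)
  have "dderiv \<phi> v = (\<lambda>_. \<phi> v)" for v
    using dderiv_eqI[OF bounded_linear_imp_has_derivative[OF assms]] by blast
  then show ?thesis using Suc bounded_linear_imp_differentiable[OF assms] by (simp add: ndiff_const)
qed (use bounded_linear_imp_differentiable[OF assms] in auto)

lemma smooth_const: "smooth (\<lambda>_. r)"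
  and smooth_add: "smooth \<phi> \<Longrightarrow> smooth \<psi> \<Longrightarrow> smooth (\<lambda>z. \<phi> z + \<psi> z)"
  and smooth_mult: "smooth \<phi> \<Longrightarrow> smooth \<psi> \<Longrightarrow> smooth (\<lambda>z. \<phi> z * \<psi> z)"
  and smooth_inverse: "smooth \<phi> \<Longrightarrow> (\<And>z. \<phi> z \<noteq> 0) \<Longrightarrow> smooth (\<lambda>z. inverse (\<phi> z))"
  and smooth_linear: "bounded_linear \<phi> \<Longrightarrow> smooth \<phi>"
  and smooth_affine: "bounded_linear A \<Longrightarrow> smooth \<phi> \<Longrightarrow> smooth (\<lambda>z. \<phi> (c + A z))"
  unfolding smooth_iff_ndiff
  by (simp_all add: ndiff_const ndiff_add ndiff_mult ndiff_inverse ndiff_linear ndiff_affine)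


lemma smooth_compose: "smooth (h :: real \<Rightarrow> real) \<Longrightarrow> smooth \<phi> \<Longrightarrow> smooth (\<lambda>z. h (\<phi> z))"
  unfolding smooth_iff_ndiff by (simp add: ndiff_compose)

lemma smooth_sum: "finite I \<Longrightarrow> (\<And>i. i \<in> I \<Longrightarrow> smooth (\<phi> i)) \<Longrightarrow> smooth (\<lambda>z. \<Sum>i\<in>I. \<phi> i z)"
proof (induction rule: finite_induct)
  case (insert i I)
  have "smooth (\<lambda>z. \<phi> i z + (\<Sum>i\<in>I. \<phi> i z))"
    by (rule smooth_add) (use insert in auto)
  then show ?case using insert by simp
qed (simp add: smooth_const)

section \<open>Trigonometric functions, flat functions and smooth steps\<close>

lemma ndiff_trig: "ndiff n (\<lambda>x::real. a * cos x + b * sin x)"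
proof (induction n arbitrary: a b)
  have d: "((\<lambda>x::real. a * cos x + b * sin x) has_derivative (\<lambda>v. v * (b * cos x - a * sin x))) (at x)" for x a b
    by (auto intro!: derivative_eq_intros simp: algebra_simps)
  {
    case 0
    show ?case unfolding ndiff.simps differentiable_def using d by blast
  next
    case (Suc n)
    have "dderiv (\<lambda>x::real. a * cos x + b * sin x) v = (\<lambda>x. (v * b) * cos x + (- v * a) * sin x)" for v
      by (rule ext) (simp add: dderiv_eqI[OF d] algebra_simps)
    moreover have "ndiff n (\<lambda>x. (v * b) * cos x + (- v * a) * sin x)" for v
      by (rule Suc)
    moreover have "(\<lambda>x::real. a * cos x + b * sin x) differentiable (at x)" for x
      unfolding differentiable_def using d by blast
    ultimately show ?case by simp
  }
qed

lemma smooth_cos: "smooth (cos :: real \<Rightarrow> real)" and smooth_sin: "smooth (sin :: real \<Rightarrow> real)"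
  unfolding smooth_iff_ndiff
  using ndiff_trig[where a=1 and b=0] ndiff_trig[where a=0 and b=1] by simp_all

text \<open>For m = 0 this is the classical flat function exp(-1/x). The powers of 1/x are included
  so that the derivative of a member is a linear combination of two members, which carries
  smoothness through by induction.\<close>

definition flat_exp :: "nat \<Rightarrow> real \<Rightarrow> real" where
  "flat_exp m x = (if x > 0 then inverse x ^ m * exp (- inverse x) else 0)"

lemma flat_exp_limit: "(flat_exp m \<longlongrightarrow> 0) (at_right 0)"
proof -
  have "((\<lambda>y::real. y ^ m / exp y) \<longlongrightarrow> 0) at_top" by (rule tendsto_power_div_exp_0)
  then have "((\<lambda>x::real. inverse x ^ m / exp (inverse x)) \<longlongrightarrow> 0) (at_right 0)"
    by (rule filterlim_compose[OF _ filterlim_inverse_at_top_right])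
  moreover have "\<forall>\<^sub>F x in at_right 0. inverse x ^ m / exp (inverse x) = flat_exp m x"
    by (auto simp: eventually_at_filter flat_exp_def exp_minus field_simps)
  ultimately show ?thesis by (rule Lim_transform_eventually)
qed

lemma flat_exp_deriv:
  "(flat_exp m has_real_derivative (flat_exp (m + 2) x + (- real m) * flat_exp (m + 1) x)) (at x)"
proof (cases x "0::real" rule: linorder_cases)
  case less
  have "((\<lambda>_. 0) has_real_derivative 0) (at x)" by simp
  then have "(flat_exp m has_real_derivative 0) (at x)"
    by (rule has_field_derivative_transform_within_open[where S="{..<0}"])
       (use less in \<open>auto simp: flat_exp_def\<close>)
  then show ?thesis using less by (simp add: flat_exp_def)
next
  case greater
  have "((\<lambda>x. inverse x ^ m * exp (- inverse x)) has_real_derivative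
      (flat_exp (m + 2) x + (- real m) * flat_exp (m + 1) x)) (at x)"
    using greater by (auto intro!: derivative_eq_intros simp: flat_exp_def)
     (cases m; simp add: field_simps power2_eq_square power_Suc)
  then show ?thesis
    by (rule has_field_derivative_transform_within_open[where S="{0<..}"])
       (use greater in \<open>auto simp: flat_exp_def\<close>)
next
  case equal
  have "((\<lambda>y. (flat_exp m y - flat_exp m 0) / (y - 0)) \<longlongrightarrow> 0) (at 0)"
    unfolding filterlim_at_split
  proof
    \<comment> \<open>For y > 0 the difference quotient at 0 is \<open>flat_exp (Suc m) y\<close>,
      so differentiability at 0 is the limit statement for the next member.\<close>
    show "((\<lambda>y. (flat_exp m y - flat_exp m 0) / (y - 0)) \<longlongrightarrow> 0) (at_right 0)"
      by (rule Lim_transform_eventually[OF flat_exp_limit[of "Suc m"]])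
         (auto simp: eventually_at_filter flat_exp_def field_simps)
    show "((\<lambda>y. (flat_exp m y - flat_exp m 0) / (y - 0)) \<longlongrightarrow> 0) (at_left 0)"
      by (rule tendsto_eventually) (auto simp: eventually_at_filter flat_exp_def)
  qed
  then show ?thesis using equal by (simp add: has_field_derivative_iff flat_exp_def)
qed

lemma ndiff_flat_exp: "ndiff n (flat_exp m)"
proof (induction n arbitrary: m)
  have d: "(flat_exp m has_derivative (\<lambda>v. (flat_exp (m + 2) x + (- real m) * flat_exp (m + 1) x) * v)) (at x)" for m x
    using flat_exp_deriv[unfolded has_field_derivative_def] .
  {
    case 0
    show ?case unfolding ndiff.simps differentiable_def using d by blast
  next
    case (Suc n)
    have "dderiv (flat_exp m) v = (\<lambda>x. v * (flat_exp (m + 2) x + (- real m) * flat_exp (m + 1) x))" for v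
      by (rule ext) (simp add: dderiv_eqI[OF d] algebra_simps)
    moreover have "ndiff n (\<lambda>x. v * (flat_exp (m + 2) x + (- real m) * flat_exp (m + 1) x))" for v
      by (intro ndiff_mult ndiff_add ndiff_const Suc)
    moreover have "flat_exp m differentiable (at x)" for x
      unfolding differentiable_def using d by blast
    ultimately show ?case by simp
  }
qed

text \<open>Since x and 1 - x are never both nonpositive, the denominator is positive; the quotient
  rises from 0 for x \<le> 0 to 1 for x \<ge> 1.\<close>

definition smooth_step :: "real \<Rightarrow> real" where
  "smooth_step x = flat_exp 0 x * inverse (flat_exp 0 x + flat_exp 0 (1 - x))"

lemma smooth_step_denom: "flat_exp 0 x + flat_exp 0 (1 - x) > 0"
  by (auto simp: flat_exp_def add_pos_pos add_nonneg_pos)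

lemma smooth_smooth_step: "smooth smooth_step"
proof -
  have 1: "smooth (flat_exp 0)" by (simp add: smooth_iff_ndiff ndiff_flat_exp)
  have 2: "smooth (\<lambda>x. flat_exp 0 (1 - x))"
    using smooth_affine[OF bounded_linear_minus[OF bounded_linear_ident] 1, of 1] by simp
  have "smooth (\<lambda>x. inverse (flat_exp 0 x + flat_exp 0 (1 - x)))"
    by (rule smooth_inverse[OF smooth_add[OF 1 2]]) (metis smooth_step_denom less_irrefl)
  then show ?thesis unfolding smooth_step_def[abs_def] by (rule smooth_mult[OF 1])
qed

lemma smooth_step_0: "x \<le> 0 \<Longrightarrow> smooth_step x = 0"
  and smooth_step_1: "x \<ge> 1 \<Longrightarrow> smooth_step x = 1"
  using smooth_step_denom[of x] by (auto simp: smooth_step_def flat_exp_def)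

lemma smooth_step_bounds: "0 \<le> smooth_step x" "smooth_step x \<le> 1"
  using smooth_step_denom[of x] by (auto simp: smooth_step_def flat_exp_def field_simps)

lemma dderiv_zero_open:
  assumes "open S" "z \<in> S" "\<And>y. y \<in> S \<Longrightarrow> \<phi> y = c"
  shows "dderiv \<phi> v z = 0"
proof -
  have "(\<phi> has_derivative (\<lambda>_. 0)) (at z)"
    by (rule has_derivative_transform_within_open[OF has_derivative_const[of c] assms(1,2)])
       (simp add: assms(3))
  then show ?thesis by (simp add: dderiv_eqI)
qed

lemma smooth_step_deriv_0: "x < 0 \<or> x > 1 \<Longrightarrow> dderiv smooth_step v x = 0"
  by (auto intro: dderiv_zero_open[of "{..<0}" _ _ 0] dderiv_zero_open[of "{1<..}" _ _ 1]
      simp: smooth_step_0 smooth_step_1)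

lemma smooth_step_deriv_bounded: obtains B where "B > 0" "\<And>x. \<bar>dderiv smooth_step 1 x\<bar> \<le> B"
proof -
  have "compact (dderiv smooth_step 1 ` {0..1})"
    by (intro compact_continuous_image smooth_continuous_on smooth_dderiv smooth_smooth_step) simp
  then obtain B where B: "B > 0" "\<And>x. x \<in> {0..1} \<Longrightarrow> \<bar>dderiv smooth_step 1 x\<bar> \<le> B"
    using compact_imp_bounded[THEN bounded_pos[THEN iffD1]] by (metis image_eqI real_norm_def)
  have "\<bar>dderiv smooth_step 1 x\<bar> \<le> B" for x
    using B smooth_step_deriv_0[of x 1] by (cases "x \<in> {0..1}") (auto simp: not_le)
  with B that show ?thesis by blast
qed

section \<open>Locally square integrable functions and weak derivatives\<close>

text \<open>Any compact set off which the function vanishes may replace the closed support, which is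
  then a closed subset of it. In this form products, sums and affine images of test functions are
  easily checked.\<close>

lemma test_fun_iff:
  "test_fun U \<phi> \<longleftrightarrow> smooth \<phi> \<and> (\<exists>C. compact C \<and> C \<subseteq> U \<and> (\<forall>z. z \<notin> C \<longrightarrow> \<phi> z = 0))"
proof -
  have "tsupp \<phi> \<subseteq> C" if "closed C" "\<forall>z. z \<notin> C \<longrightarrow> \<phi> z = 0" for C
    unfolding tsupp_def using that by (intro closure_minimal) auto
  moreover have "\<phi> z = 0" if "z \<notin> tsupp \<phi>" for z
    using that closure_subset[of "{z. \<phi> z \<noteq> 0}"] unfolding tsupp_def by auto
  moreover have "compact (tsupp \<phi>)" if "compact C" "tsupp \<phi> \<subseteq> C" for C
    using compact_Int_closed[OF that(1), of "tsupp \<phi>"] that(2) by (simp add: tsupp_def Int_absorb1)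
  ultimately show ?thesis unfolding test_fun_def smooth_def
    by (meson compact_imp_closed order_trans)
qed

lemma test_fun_smooth: "test_fun U \<phi> \<Longrightarrow> smooth \<phi>"
  by (simp add: test_fun_iff)

lemma test_funE:
  assumes "test_fun U \<phi>"
  obtains C where "compact C" "C \<subseteq> U" "\<And>z. z \<notin> C \<Longrightarrow> \<phi> z = 0" "\<And>z v. z \<notin> C \<Longrightarrow> dderiv \<phi> v z = 0"
proof -
  obtain C where C: "compact C" "C \<subseteq> U" "\<forall>z. z \<notin> C \<longrightarrow> \<phi> z = 0"
    using assms by (auto simp: test_fun_iff)
  have "dderiv \<phi> v z = 0" if "z \<notin> C" for z v
    by (rule dderiv_zero_open[of "- C" _ _ 0]) (use that C compact_imp_closed in auto)
  with C that show ?thesis by blast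
qed

lemma test_fun_dderiv: "test_fun U \<phi> \<Longrightarrow> test_fun U (dderiv \<phi> v)"
  by (metis smooth_dderiv test_funE test_fun_iff)

lemma test_fun_mult_left: "test_fun U \<phi> \<Longrightarrow> smooth \<psi> \<Longrightarrow> test_fun U (\<lambda>z. \<phi> z * \<psi> z)"
  unfolding test_fun_iff using smooth_mult by (metis mult_zero_left)

lemma test_fun_bounded:
  assumes "test_fun U \<phi>"
  obtains B C where "B > 0" "compact C" "C \<subseteq> U" "\<And>z. \<bar>\<phi> z\<bar> \<le> B * indicator C z"
proof -
  obtain C where C: "compact C" "C \<subseteq> U" "\<And>z. z \<notin> C \<Longrightarrow> \<phi> z = 0" using assms by (metis test_funE)
  have "bounded (\<phi> ` C)"
    using assms C by (intro compact_imp_bounded compact_continuous_image smooth_continuous_on)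
       (auto simp: test_fun_iff)
  then obtain B where "B > 0" "\<And>z. z \<in> C \<Longrightarrow> \<bar>\<phi> z\<bar> \<le> B"
    by (auto simp: bounded_pos)
  then show ?thesis using C that[of B C] by (auto simp: indicator_def)
qed

lemma test_fun_bounded':
  assumes "test_fun U \<phi>"
  obtains B where "B > 0" "\<And>z. \<bar>\<phi> z\<bar> \<le> B"
proof -
  obtain B C where B: "B > 0" "\<And>z. \<bar>\<phi> z\<bar> \<le> B * indicator C z"
    using test_fun_bounded[OF assms] by metis
  have "\<bar>\<phi> z\<bar> \<le> B" for z
    using B(2)[of z] B(1) by (cases "z \<in> C") auto
  with B that show ?thesis by blast
qed

text \<open>Defined on the whole space: a function known on the slab only is extended by zero, so
  that the integrals below are over \<open>lborel\<close> with no domain attached.\<close>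

definition L2loc :: "('a::euclidean_space \<Rightarrow> real) \<Rightarrow> bool" where
  "L2loc v \<longleftrightarrow> v \<in> borel_measurable borel \<and>
     (\<forall>C. compact C \<longrightarrow> integrable lborel (\<lambda>z. indicator C z * (v z)\<^sup>2))"

lemma L2loc_measurable [measurable_dest]: "L2loc v \<Longrightarrow> v \<in> borel_measurable borel"
  by (simp add: L2loc_def)

lemma integrable_indicator_compact: "compact C \<Longrightarrow> integrable lborel (indicator C :: 'a::euclidean_space \<Rightarrow> real)"
  using emeasure_compact_finite[of C]
  by (intro integrable_real_indicator) (auto simp: borel_compact less_top)

lemma L2loc_integrable_abs:
  fixes v :: "'a::euclidean_space \<Rightarrow> real"
  assumes "L2loc v" "compact C"
  shows "integrable lborel (\<lambda>z. indicator C z * \<bar>v z\<bar>)"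
proof (rule Bochner_Integration.integrable_bound)
  show "integrable lborel (\<lambda>z. indicator C z + indicator C z * (v z)\<^sup>2)"
    using assms by (intro Bochner_Integration.integrable_add integrable_indicator_compact) (auto simp: L2loc_def)
  have [measurable]: "C \<in> sets borel" using assms borel_compact by blast
  show "(\<lambda>z. indicator C z * \<bar>v z\<bar>) \<in> borel_measurable lborel"
    using L2loc_measurable[OF assms(1)] by measurable
  have "\<bar>x\<bar> \<le> 1 + x\<^sup>2" for x :: real
    using sum_squares_bound[of "\<bar>x\<bar>" 1] by (simp add: power2_eq_square)
  then show "AE z in lborel. norm (indicator C z * \<bar>v z\<bar>) \<le> norm (indicator C z + indicator C z * (v z)\<^sup>2)"
    by (auto simp: indicator_def)
qed

lemma L2loc_integrable_mult:
  assumes "L2loc v" "compact C" "\<phi> \<in> borel_measurable borel" "\<And>z. \<bar>\<phi> z\<bar> \<le> B * indicator C z"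
  shows "integrable lborel (\<lambda>z. v z * \<phi> z)"
proof (rule Bochner_Integration.integrable_bound)
  show "integrable lborel (\<lambda>z. B * (indicator C z * \<bar>v z\<bar>))"
    by (intro integrable_mult_right L2loc_integrable_abs assms)
  show "(\<lambda>z. v z * \<phi> z) \<in> borel_measurable lborel"
    using assms(1,3) by measurable
  have "\<bar>v z * \<phi> z\<bar> \<le> \<bar>B * (indicator C z * \<bar>v z\<bar>)\<bar>" for z
  proof -
    have "\<bar>v z * \<phi> z\<bar> \<le> B * (indicator C z * \<bar>v z\<bar>)"
      using mult_left_mono[OF assms(4)[of z], of "\<bar>v z\<bar>"] by (simp add: abs_mult ac_simps)
    then show ?thesis using abs_ge_self order_trans by blast
  qed
  then show "AE z in lborel. norm (v z * \<phi> z) \<le> norm (B * (indicator C z * \<bar>v z\<bar>))" by simp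
qed

lemma smooth_measurable [measurable_dest]: "smooth (\<phi> :: 'a::euclidean_space \<Rightarrow> real) \<Longrightarrow> \<phi> \<in> borel_measurable borel"
  by (intro borel_measurable_continuous_onI smooth_continuous_on)

lemma L2loc_integrable_test:
  assumes "L2loc v" "test_fun U \<phi>"
  shows "integrable lborel (\<lambda>z. v z * \<phi> z)"
proof -
  obtain B C where "compact C" "\<And>z. \<bar>\<phi> z\<bar> \<le> B * indicator C z"
    using test_fun_bounded[OF assms(2)] by metis
  then show ?thesis using assms by (intro L2loc_integrable_mult smooth_measurable test_fun_smooth)
qed

lemma L2loc_add: "L2loc v \<Longrightarrow> L2loc w \<Longrightarrow> L2loc (\<lambda>z. v z + w z)"
  unfolding L2loc_def
proof (intro conjI allI impI)
  fix C :: "'a set"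
  assume v: "v \<in> borel_measurable borel \<and> (\<forall>C. compact C \<longrightarrow> integrable lborel (\<lambda>z. indicator C z * (v z)\<^sup>2))"
    and w: "w \<in> borel_measurable borel \<and> (\<forall>C. compact C \<longrightarrow> integrable lborel (\<lambda>z. indicator C z * (w z)\<^sup>2))"
    and C: "compact C"
  have [measurable]: "C \<in> sets borel" "v \<in> borel_measurable borel" "w \<in> borel_measurable borel"
    using C borel_compact v w by blast+
  show "integrable lborel (\<lambda>z. indicator C z * (v z + w z)\<^sup>2)"
  proof (rule Bochner_Integration.integrable_bound)
    show "integrable lborel (\<lambda>z. 2 * (indicator C z * (v z)\<^sup>2) + 2 * (indicator C z * (w z)\<^sup>2))"
      using v w C by auto
    have "(a + b)\<^sup>2 \<le> 2 * a\<^sup>2 + 2 * b\<^sup>2" for a b :: real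
      using sum_squares_bound[of a b] by (simp add: power2_sum)
    then show "AE z in lborel. norm (indicator C z * (v z + w z)\<^sup>2) \<le> norm (2 * (indicator C z * (v z)\<^sup>2) + 2 * (indicator C z * (w z)\<^sup>2))"
      by (auto simp: indicator_def)
  qed measurable
qed auto

lemma L2loc_mult:
  fixes \<phi> :: "'a::euclidean_space \<Rightarrow> real"
  assumes "L2loc v" "continuous_on UNIV \<phi>" shows "L2loc (\<lambda>z. \<phi> z * v z)"
  unfolding L2loc_def
proof (intro conjI allI impI)
  have m [measurable]: "v \<in> borel_measurable borel" "\<phi> \<in> borel_measurable borel"
    using assms by (auto simp: L2loc_def intro: borel_measurable_continuous_onI)
  then show "(\<lambda>z. \<phi> z * v z) \<in> borel_measurable borel" by measurable
  fix C :: "'a set" assume C: "compact C"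
  then have [measurable]: "C \<in> sets borel" by (rule borel_compact)
  have "bounded (\<phi> ` C)"
    using assms C by (meson compact_continuous_image compact_imp_bounded continuous_on_subset subset_UNIV)
  then obtain B where B: "B > 0" "\<And>z. z \<in> C \<Longrightarrow> \<bar>\<phi> z\<bar> \<le> B"
    by (auto simp: bounded_pos)
  show "integrable lborel (\<lambda>z. indicator C z * (\<phi> z * v z)\<^sup>2)"
  proof (rule Bochner_Integration.integrable_bound)
    show "integrable lborel (\<lambda>z. B\<^sup>2 * (indicator C z * (v z)\<^sup>2))"
      using assms C by (auto simp: L2loc_def)
    have "(\<phi> z * v z)\<^sup>2 \<le> B\<^sup>2 * (v z)\<^sup>2" if "z \<in> C" for z
      using power_mono[OF B(2)[OF that], of 2] by (simp add: power_mult_distrib mult_right_mono)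
    then show "AE z in lborel. norm (indicator C z * (\<phi> z * v z)\<^sup>2) \<le> norm (B\<^sup>2 * (indicator C z * (v z)\<^sup>2))"
      by (auto simp: indicator_def)
  qed measurable
qed

lemma L2loc_cmult: "L2loc v \<Longrightarrow> L2loc (\<lambda>z. c * v z)"
  by (rule L2loc_mult) auto

lemma L2loc_0: "L2loc (\<lambda>z. 0)"
  by (simp add: L2loc_def)

lemma L2loc_sum: "finite I \<Longrightarrow> (\<And>i. i \<in> I \<Longrightarrow> L2loc (v i)) \<Longrightarrow> L2loc (\<lambda>z. \<Sum>i\<in>I. v i z)"
proof (induction rule: finite_induct)
  case (insert i I)
  have "L2loc (\<lambda>z. v i z + (\<Sum>i\<in>I. v i z))"
    by (rule L2loc_add) (use insert in auto)
  then show ?case using insert by simp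
qed (simp add: L2loc_0)

section \<open>Weak derivatives in a fixed direction\<close>

definition wder :: "'a::euclidean_space set \<Rightarrow> 'a \<Rightarrow> ('a \<Rightarrow> real) \<Rightarrow> ('a \<Rightarrow> real) \<Rightarrow> bool" where
  "wder U e v w \<longleftrightarrow> (\<forall>\<phi>. test_fun U \<phi> \<longrightarrow>
     (\<integral>z. v z * dderiv \<phi> e z \<partial>lborel) = - (\<integral>z. w z * \<phi> z \<partial>lborel))"

text \<open>A chain keeps one direction e throughout. For basis vectors e such chains give the
  factors (m . e)^(2k) in the Fourier coefficients, and cutoffs and reflection in time map chains in
  direction e to chains in direction e.\<close>

primrec wchain :: "'a::euclidean_space set \<Rightarrow> 'a \<Rightarrow> nat \<Rightarrow> ('a \<Rightarrow> real) \<Rightarrow> bool" where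
  "wchain U e 0 v \<longleftrightarrow> L2loc v"
| "wchain U e (Suc n) v \<longleftrightarrow> L2loc v \<and> (\<exists>w. wder U e v w \<and> wchain U e n w)"

lemma wchain_pred: "wchain U e (Suc n) v \<Longrightarrow> wchain U e n v"
  by (induction n arbitrary: v) (simp, metis wchain.simps(2))

lemma wchain_L2loc: "wchain U e n v \<Longrightarrow> L2loc v"
  by (cases n) auto

text \<open>Chains of weak derivatives of compactly supported functions may be tested against all smooth
  functions, in particular against the trigonometric ones.\<close>

primrec schain :: "'a::euclidean_space set \<Rightarrow> 'a \<Rightarrow> nat \<Rightarrow> ('a \<Rightarrow> real) \<Rightarrow> bool" where
  "schain C e 0 v \<longleftrightarrow> L2loc v \<and> (\<forall>z. z \<notin> C \<longrightarrow> v z = 0)"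
| "schain C e (Suc n) v \<longleftrightarrow> L2loc v \<and> (\<forall>z. z \<notin> C \<longrightarrow> v z = 0) \<and>
     (\<exists>w. schain C e n w \<and> (\<forall>\<phi>. smooth \<phi> \<longrightarrow>
       (\<integral>z. v z * dderiv \<phi> e z \<partial>lborel) = - (\<integral>z. w z * \<phi> z \<partial>lborel)))"

lemma schain_supp: "schain C e n v \<Longrightarrow> L2loc v \<and> (\<forall>z. z \<notin> C \<longrightarrow> v z = 0)"
  by (cases n) auto

lemma L2loc_integrable_compact_support:
  fixes v :: "'a::euclidean_space \<Rightarrow> real"
  assumes "compact C" "L2loc v" "\<And>z. z \<notin> C \<Longrightarrow> v z = 0" "continuous_on UNIV \<phi>"
  shows "integrable lborel (\<lambda>z. v z * \<phi> z)"
proof -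
  have "bounded (\<phi> ` C)"
    using assms by (meson compact_continuous_image compact_imp_bounded continuous_on_subset subset_UNIV)
  then obtain B where B: "B > 0" "\<And>z. z \<in> C \<Longrightarrow> \<bar>\<phi> z\<bar> \<le> B"
    by (auto simp: bounded_pos)
  have [measurable]: "C \<in> sets borel" "\<phi> \<in> borel_measurable borel"
    using assms borel_compact borel_measurable_continuous_onI by blast+
  have "integrable lborel (\<lambda>z. v z * (indicator C z * \<phi> z))"
    by (rule L2loc_integrable_mult[OF assms(2,1), where B=B]) (use B in \<open>auto simp: indicator_def\<close>)
  moreover have "(\<lambda>z. v z * (indicator C z * \<phi> z)) = (\<lambda>z. v z * \<phi> z)"
    using assms(3) by (auto simp: indicator_def fun_eq_iff)
  ultimately show ?thesis by simp
qed

lemma schain_add: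
  assumes "compact C"
  shows "schain C e n v \<Longrightarrow> schain C e n w \<Longrightarrow> schain C e n (\<lambda>z. v z + w z)"
proof (induction n arbitrary: v w)
  case 0
  then show ?case by (auto intro: L2loc_add)
next
  case (Suc n)
  obtain v' where v': "schain C e n v'" "\<And>\<phi>. smooth \<phi> \<Longrightarrow>
       (\<integral>z. v z * dderiv \<phi> e z \<partial>lborel) = - (\<integral>z. v' z * \<phi> z \<partial>lborel)" using Suc.prems by auto
  obtain w' where w': "schain C e n w'" "\<And>\<phi>. smooth \<phi> \<Longrightarrow>
       (\<integral>z. w z * dderiv \<phi> e z \<partial>lborel) = - (\<integral>z. w' z * \<phi> z \<partial>lborel)" using Suc.prems by auto
  have "(\<integral>z. (v z + w z) * dderiv \<phi> e z \<partial>lborel) = - (\<integral>z. (v' z + w' z) * \<phi> z \<partial>lborel)"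
    if "smooth \<phi>" for \<phi>
  proof -
    have "integrable lborel (\<lambda>z. u z * \<psi> z)" if "schain C e m u" "smooth \<psi>" for m u \<psi>
      using schain_supp[OF that(1)] that(2) assms by (intro L2loc_integrable_compact_support smooth_continuous_on) auto
    note this[OF v'(1) that] this[OF w'(1) that] this[OF Suc.prems(1) smooth_dderiv[OF that]]
      this[OF Suc.prems(2) smooth_dderiv[OF that]]
    then show ?thesis using v'(2)[OF that] w'(2)[OF that] by (simp add: distrib_right)
  qed
  moreover have "schain C e n (\<lambda>z. v' z + w' z)" using v' w' Suc.IH by blast
  ultimately show ?case using Suc.prems unfolding schain.simps
    by (intro conjI L2loc_add exI[of _ "\<lambda>z. v' z + w' z"]) auto
qed

text \<open>Leibniz rule: eta v has the derivative eta' v + eta w, again a sum of cut off chains,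
  which is why eta and v vary in the induction. An arbitrary smooth phi becomes admissible because
  eta phi is a test function on U.\<close>

lemma wchain_cutoff:
  assumes "compact C"
  shows "wchain U e n v \<Longrightarrow> test_fun U \<eta> \<Longrightarrow> (\<And>z. z \<notin> C \<Longrightarrow> \<eta> z = 0) \<Longrightarrow> schain C e n (\<lambda>z. \<eta> z * v z)"
proof (induction n arbitrary: v \<eta>)
  case 0
  then show ?case by (auto intro!: L2loc_mult smooth_continuous_on test_fun_smooth)
next
  case (Suc n)
  obtain w where w: "wder U e v w" "wchain U e n w" using Suc.prems by auto
  note tsm = test_fun_smooth[OF Suc.prems(2)]
  note v = wchain_pred[OF Suc.prems(1)] and Lv = wchain_L2loc[OF Suc.prems(1)] and Lw = wchain_L2loc[OF w(2)]
  have z: "dderiv \<eta> e z = 0" if "z \<notin> C" for z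
    by (rule dderiv_zero_open[of "- C" _ _ 0]) (use that assms Suc.prems compact_imp_closed in auto)
  have "(\<integral>z. (\<eta> z * v z) * dderiv \<phi> e z \<partial>lborel) = - (\<integral>z. (dderiv \<eta> e z * v z + \<eta> z * w z) * \<phi> z \<partial>lborel)"
    if "smooth \<phi>" for \<phi>
  proof -
    have i1: "integrable lborel (\<lambda>z. v z * dderiv (\<lambda>z. \<eta> z * \<phi> z) e z)"
      by (rule L2loc_integrable_test[OF Lv test_fun_dderiv[OF test_fun_mult_left[OF Suc.prems(2) that]]])
    have i2: "integrable lborel (\<lambda>z. v z * (dderiv \<eta> e z * \<phi> z))"
      by (rule L2loc_integrable_test[OF Lv test_fun_mult_left[OF test_fun_dderiv[OF Suc.prems(2)] that]])
    have i3: "integrable lborel (\<lambda>z. w z * (\<eta> z * \<phi> z))"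
      by (rule L2loc_integrable_test[OF Lw test_fun_mult_left[OF Suc.prems(2) that]])
    have "(\<integral>z. (\<eta> z * v z) * dderiv \<phi> e z \<partial>lborel)
       = (\<integral>z. v z * dderiv (\<lambda>z. \<eta> z * \<phi> z) e z - v z * (dderiv \<eta> e z * \<phi> z) \<partial>lborel)"
      by (intro Bochner_Integration.integral_cong refl, subst dderiv_mult)
         (use tsm that smooth_differentiable in \<open>auto simp: algebra_simps\<close>)
    also have "\<dots> = - (\<integral>z. w z * (\<eta> z * \<phi> z) \<partial>lborel) - (\<integral>z. v z * (dderiv \<eta> e z * \<phi> z) \<partial>lborel)"
      using w(1) test_fun_mult_left[OF Suc.prems(2) that] i1 i2 unfolding wder_def by simp
    also have "\<dots> = - (\<integral>z. w z * (\<eta> z * \<phi> z) + v z * (dderiv \<eta> e z * \<phi> z) \<partial>lborel)"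
      using i2 i3 by simp
    also have "\<dots> = - (\<integral>z. (dderiv \<eta> e z * v z + \<eta> z * w z) * \<phi> z \<partial>lborel)"
      by (simp add: algebra_simps)
    finally show ?thesis .
  qed
  moreover have "schain C e n (\<lambda>z. dderiv \<eta> e z * v z + \<eta> z * w z)"
    using Suc.IH[OF v test_fun_dderiv[OF Suc.prems(2)] z] Suc.IH[OF w(2) Suc.prems(2,3)]
    by (intro schain_add assms) auto
  ultimately show ?case using Suc.prems Lv tsm unfolding schain.simps
    by (intro conjI L2loc_mult exI[of _ "\<lambda>z. dderiv \<eta> e z * v z + \<eta> z * w z"])
       (auto intro: smooth_continuous_on)
qed

section \<open>Testing up to the boundary of the time interval\<close>

definition slab :: "real \<Rightarrow> ('b::euclidean_space \<times> real) set" where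
  "slab T = UNIV \<times> {0<..<T}"

text \<open>The definition gives, for each order separately, a derivative relative to u. Applying
  the identity of order j to the test function \<open>dderiv \<phi> e\<close> and comparing with
  order j + 1 shows that each is the weak derivative of the previous one.\<close>

lemma Hk_loc_scalar_wchain:
  fixes u :: "(real^'d::finite) \<times> real \<Rightarrow> real"
  assumes u: "Hk_loc_scalar k T u" and e: "e \<in> Basis"
  shows "wchain (slab T) e k (\<lambda>z. indicator (UNIV \<times> {0..T}) z * u z)"
proof -
  let ?I = "indicator (UNIV \<times> {0..T}) :: (real^'d) \<times> real \<Rightarrow> real"
  let ?sq = "\<lambda>g. \<forall>C. compact C \<and> C \<subseteq> UNIV \<times> {0..T} \<longrightarrow> sq_integrable_on g C"
  have L: "L2loc (\<lambda>z. ?I z * g z)" if g: "?sq g" for g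
    unfolding L2loc_def
  proof (intro conjI allI impI)
    \<comment> \<open>Square integrability is given on compact sets only, so measurability on the
      slab comes from the exhaustion by cylinders over balls of radius n.\<close>
    have m: "(\<lambda>z. indicator (cball 0 (real n) \<times> {0..T}) z * g z) \<in> borel_measurable borel" for n
      using g[rule_format, of "cball 0 (real n) \<times> {0..T}"]
      by (auto simp: sq_integrable_on_def set_borel_measurable_def compact_Times)
    show "(\<lambda>z. ?I z * g z) \<in> borel_measurable borel"
    proof (rule borel_measurable_LIMSEQ_real[OF _ m])
      fix z :: "(real^'d) \<times> real"
      obtain n0 :: nat where n0: "norm (fst z) \<le> real n0" using real_arch_simple by blast
      have "indicator (cball 0 (real n) \<times> {0..T}) z * g z = ?I z * g z" if "n \<ge> n0" for n
      proof -
        have "norm (fst z) \<le> real n" using n0 that by linarith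
        then show ?thesis by (cases z) (auto simp: indicator_def)
      qed
      then have "\<forall>\<^sub>F n in sequentially. indicator (cball 0 (real n) \<times> {0..T}) z * g z = ?I z * g z"
        by (auto simp: eventually_sequentially)
      then show "(\<lambda>n. indicator (cball 0 (real n) \<times> {0..T}) z * g z) \<longlonglongrightarrow> ?I z * g z"
        by (rule tendsto_eventually)
    qed
    fix C :: "((real^'d) \<times> real) set" assume C: "compact C"
    have "compact (C \<inter> UNIV \<times> {0..T})"
      by (intro compact_Int_closed C closed_Times) auto
    then have "integrable lborel (\<lambda>z. indicator (C \<inter> UNIV \<times> {0..T}) z *\<^sub>R (g z)\<^sup>2)"
      using g unfolding sq_integrable_on_def set_integrable_def by auto
    moreover have "indicator (C \<inter> UNIV \<times> {0..T}) z *\<^sub>R (g z)\<^sup>2 = indicator C z * (?I z * g z)\<^sup>2" for z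
      by (auto simp: indicator_def)
    ultimately show "integrable lborel (\<lambda>z. indicator C z * (?I z * g z)\<^sup>2)" by simp
  qed
  define P where "P j g \<longleftrightarrow> ?sq g \<and> (\<forall>\<phi>. test_fun (slab T) \<phi> \<longrightarrow>
                (\<integral>z. u z * iter_dderiv \<phi> (replicate j e) z \<partial>lborel) =
                (-1) ^ j * (\<integral>z. g z * \<phi> z \<partial>lborel))" for j g
  have "\<exists>g. P j g" if "j \<le> k" for j
    using u[unfolded Hk_loc_scalar_def, THEN conjunct2, rule_format, of "replicate j e"] e that
    by (auto simp: P_def slab_def in_lists_conv_set)
  then obtain g0 where g0: "\<And>j. j \<le> k \<Longrightarrow> P j (g0 j)" by metis
  \<comment> \<open>At order 0 the function u itself is taken, not some almost everywhere equal one,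
    so that the chain starts at u.\<close>
  define g where "g j = (if j = 0 then u else g0 j)" for j
  have g: "P j (g j)" if "j \<le> k" for j
    using g0[OF that] u by (cases j) (auto simp: g_def P_def Hk_loc_scalar_def)
  have w: "wder (slab T) e (\<lambda>z. ?I z * g j z) (\<lambda>z. ?I z * g (Suc j) z)" if "Suc j \<le> k" for j
    unfolding wder_def
  proof (intro allI impI)
    fix \<phi> :: "(real^'d) \<times> real \<Rightarrow> real" assume t: "test_fun (slab T) \<phi>"
    obtain C where C: "C \<subseteq> slab T" "\<And>z. z \<notin> C \<Longrightarrow> \<phi> z = 0" "\<And>z v. z \<notin> C \<Longrightarrow> dderiv \<phi> v z = 0"
      using test_funE[OF t] by metis
    have I: "?I z = 1" if "z \<in> C" for z
      using that C(1) by (auto simp: slab_def indicator_def)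
    have 1: "(?I z * f z) * dderiv \<phi> e z = f z * dderiv \<phi> e z" for f z
      using C I by (cases "z \<in> C") auto
    have 2: "(?I z * f z) * \<phi> z = f z * \<phi> z" for f z
      using C I by (cases "z \<in> C") auto
    have "(-1) ^ j * (\<integral>z. g j z * dderiv \<phi> e z \<partial>lborel) = (\<integral>z. u z * iter_dderiv (dderiv \<phi> e) (replicate j e) z \<partial>lborel)"
      using g[of j] that test_fun_dderiv[OF t, of e] by (simp add: P_def)
    also have "iter_dderiv (dderiv \<phi> e) (replicate j e) = iter_dderiv \<phi> (replicate j e @ [e])"
      by (simp add: iter_dderiv_append)
    also have "replicate j e @ [e] = replicate (Suc j) e"
      by (simp add: replicate_append_same)
    also have "(\<integral>z. u z * iter_dderiv \<phi> (replicate (Suc j) e) z \<partial>lborel) = (-1) ^ Suc j * (\<integral>z. g (Suc j) z * \<phi> z \<partial>lborel)"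
      using g[of "Suc j"] that t unfolding P_def by blast
    finally have "(\<integral>z. g j z * dderiv \<phi> e z \<partial>lborel) = - (\<integral>z. g (Suc j) z * \<phi> z \<partial>lborel)"
      by (cases "even j") auto
    then show "(\<integral>z. (?I z * g j z) * dderiv \<phi> e z \<partial>lborel) = - (\<integral>z. (?I z * g (Suc j) z) * \<phi> z \<partial>lborel)"
      by (simp only: 1 2)
  qed
  have "wchain (slab T) e n (\<lambda>z. ?I z * g (k - n) z)" if "n \<le> k" for n
    using that
  proof (induction n)
    case 0
    then show ?case using g[of k] by (simp add: L P_def)
  next
    case (Suc n)
    have "wder (slab T) e (\<lambda>z. ?I z * g (k - Suc n) z) (\<lambda>z. ?I z * g (k - n) z)"
      using w[of "k - Suc n"] Suc.prems by (simp add: Suc_diff_Suc)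
    moreover have "L2loc (\<lambda>z. ?I z * g (k - Suc n) z)"
      using g[of "k - Suc n"] by (intro L) (simp add: P_def)
    ultimately show ?case using Suc by auto
  qed
  from this[of k] show ?thesis by (simp add: g_def)
qed

text \<open>Zero within distance 1/n of the ends 0 and T, one where both distances are at least 2/n,
  with derivative of order n in between.\<close>

definition time_cutoff :: "real \<Rightarrow> nat \<Rightarrow> real \<Rightarrow> real" where
  "time_cutoff T n t = smooth_step (real n * t - 1) * smooth_step (real n * (T - t) - 1)"

lemma smooth_time_cutoff: "smooth (\<lambda>z :: 'b::euclidean_space \<times> real. time_cutoff T n (snd z))"
  and dderiv_time_cutoff: "dderiv (\<lambda>z :: 'b::euclidean_space \<times> real. time_cutoff T n (snd z)) e z =
    real n * snd e * (dderiv smooth_step 1 (real n * snd z - 1) * smooth_step (real n * (T - snd z) - 1)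
     - smooth_step (real n * snd z - 1) * dderiv smooth_step 1 (real n * (T - snd z) - 1))"
proof -
  have b1: "bounded_linear (\<lambda>z :: 'b \<times> real. c * snd z)" for c
    by (intro bounded_linear_intros)
  have e1: "(\<lambda>z :: 'b \<times> real. smooth_step (real n * snd z - 1)) = (\<lambda>z. smooth_step (-1 + real n * snd z))"
    by simp
  have e2: "(\<lambda>z :: 'b \<times> real. smooth_step (real n * (T - snd z) - 1)) = (\<lambda>z. smooth_step (real n * T - 1 + (- real n) * snd z))"
    by (simp add: algebra_simps)
  have s: "smooth (\<lambda>z :: 'b \<times> real. smooth_step (a + c * snd z))" for a c
    by (intro smooth_compose[OF smooth_smooth_step] smooth_add smooth_const smooth_linear b1)
  have d: "dderiv (\<lambda>z :: 'b \<times> real. smooth_step (a + c * snd z)) e z = c * snd e * dderiv smooth_step 1 (a + c * snd z)" for a c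
  proof -
    have 1: "((\<lambda>z :: 'b \<times> real. a + c * snd z) has_derivative (\<lambda>e. c * snd e)) (at z)"
      by (auto intro!: derivative_eq_intros)
    then have "(\<lambda>z :: 'b \<times> real. a + c * snd z) differentiable (at z)"
      unfolding differentiable_def by blast
    then show ?thesis
      using dderiv_compose[of smooth_step "\<lambda>z :: 'b \<times> real. a + c * snd z" z e]
        smooth_differentiable[OF smooth_smooth_step] dderiv_eqI[OF 1, of e] by (simp add: mult.commute)
  qed
  show "smooth (\<lambda>z :: 'b::euclidean_space \<times> real. time_cutoff T n (snd z))"
    unfolding time_cutoff_def by (rule smooth_mult) (simp_all only: e1 e2 s)
  show "dderiv (\<lambda>z :: 'b::euclidean_space \<times> real. time_cutoff T n (snd z)) e z =
    real n * snd e * (dderiv smooth_step 1 (real n * snd z - 1) * smooth_step (real n * (T - snd z) - 1)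
     - smooth_step (real n * snd z - 1) * dderiv smooth_step 1 (real n * (T - snd z) - 1))"
    unfolding time_cutoff_def
    apply (subst dderiv_mult)
    subgoal unfolding e1 by (rule smooth_differentiable[OF s])
    subgoal unfolding e2 by (rule smooth_differentiable[OF s])
    subgoal unfolding e1 e2 d by (simp add: algebra_simps)
    done
qed

lemma time_cutoff_bounds: "\<bar>time_cutoff T n t\<bar> \<le> 1"
  unfolding time_cutoff_def using smooth_step_bounds by (simp add: abs_mult mult_le_one)

lemma real_nat_mult_ge_eventually: "0 < t \<Longrightarrow> \<forall>\<^sub>F n in sequentially. real n * t > 2"
proof -
  assume "0 < t"
  then have "filterlim (\<lambda>n. real n * t) at_top sequentially"
    by (intro filterlim_at_top_mult_tendsto_pos[OF tendsto_const _ filterlim_real_sequentially])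
  then show ?thesis by (simp add: filterlim_at_top_dense)
qed

lemma AE_lborel_snd_neq: "AE z in (lborel :: ('b::euclidean_space \<times> real) measure). snd z \<noteq> c"
proof -
  have eq: "(0, 1) \<bullet> z = snd z" for z :: "'b \<times> real" by (cases z) auto
  have "negligible {z :: 'b \<times> real. (0, 1) \<bullet> z = c}"
    by (rule negligible_hyperplane) (auto simp: zero_prod_def)
  then have "{z :: 'b \<times> real. snd z = c} \<in> null_sets lebesgue"
    unfolding eq by (simp add: negligible_iff_null_sets)
  moreover have "{z :: 'b \<times> real. snd z = c} \<in> sets borel"
    by (intro borel_closed closed_Collect_eq continuous_intros)
  ultimately have "{z :: 'b \<times> real. snd z = c} \<in> null_sets lborel"
    by (simp add: null_sets_completion_iff)
  then show ?thesis by (rule AE_I') auto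
qed

text \<open>A weak derivative on the open slab may be tested against functions that do not vanish near the
  boundary, as long as those vanish on it whenever the direction is not tangential: multiply by a
  cutoff in time, whose derivative is of the order of the inverse distance to the boundary.\<close>

lemma wder_up_to_boundary:
  fixes v w :: "'b::euclidean_space \<times> real \<Rightarrow> real"
  assumes v: "L2loc v" and w: "L2loc w" and vw: "wder (slab T) e v w"
    and v0: "\<And>z. snd z \<notin> {0..T} \<Longrightarrow> v z = 0" and w0: "\<And>z. snd z \<notin> {0..T} \<Longrightarrow> w z = 0"
    and \<psi>: "test_fun UNIV \<psi>"
    and bd: "\<And>z. snd z \<in> {0..T} \<Longrightarrow> \<bar>snd e * \<psi> z\<bar> \<le> L * min (snd z) (T - snd z)"
  shows "(\<integral>z. v z * dderiv \<psi> e z \<partial>lborel) = - (\<integral>z. w z * \<psi> z \<partial>lborel)"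
proof -
  obtain B where B: "B > 0" "\<And>x. \<bar>dderiv smooth_step 1 x\<bar> \<le> B"
    using smooth_step_deriv_bounded by blast
  define \<rho> :: "nat \<Rightarrow> 'b \<times> real \<Rightarrow> real" where "\<rho> n z = time_cutoff T n (snd z)" for n z
  have s\<rho>: "smooth (\<rho> n)" for n unfolding \<rho>_def[abs_def] by (rule smooth_time_cutoff)
  have s\<psi>: "smooth \<psi>" using \<psi> by (rule test_fun_smooth)
  obtain C where C: "compact C" "\<And>z. z \<notin> C \<Longrightarrow> \<psi> z = 0" "\<And>z v. z \<notin> C \<Longrightarrow> dderiv \<psi> v z = 0"
    using test_funE[OF \<psi>] by metis
  obtain B1 where B1: "B1 > 0" "\<And>z. \<bar>\<psi> z\<bar> \<le> B1"
    using test_fun_bounded'[OF \<psi>] by blast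
  obtain B2 where B2: "B2 > 0" "\<And>z. \<bar>dderiv \<psi> e z\<bar> \<le> B2"
    using test_fun_bounded'[OF test_fun_dderiv[OF \<psi>]] by blast
  have mC [measurable]: "C \<in> sets borel" using C borel_compact by blast
  have mv [measurable]: "v \<in> borel_measurable borel" "w \<in> borel_measurable borel" using v w by (auto simp: L2loc_def)
  have m\<rho> [measurable]: "\<rho> n \<in> borel_measurable borel" for n using s\<rho> by (rule smooth_measurable)
  have md\<rho> [measurable]: "dderiv (\<rho> n) e \<in> borel_measurable borel" for n using smooth_dderiv[OF s\<rho>] by (rule smooth_measurable)
  have m\<psi> [measurable]: "\<psi> \<in> borel_measurable borel" using s\<psi> by (rule smooth_measurable)
  have md\<psi> [measurable]: "dderiv \<psi> e \<in> borel_measurable borel" using smooth_dderiv[OF s\<psi>] by (rule smooth_measurable)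
  have supp: "test_fun (slab T) (\<lambda>z. \<rho> n z * \<psi> z)" if "n > 0" for n
    unfolding test_fun_iff
  proof (intro conjI exI[of _ "C \<inter> UNIV \<times> {1 / real n..T - 1 / real n}"] allI impI)
    show "smooth (\<lambda>z. \<rho> n z * \<psi> z)" by (intro smooth_mult s\<rho> s\<psi>)
    show "compact (C \<inter> UNIV \<times> {1 / real n..T - 1 / real n})"
      by (intro compact_Int_closed C closed_Times) auto
    show "C \<inter> UNIV \<times> {1 / real n..T - 1 / real n} \<subseteq> slab T"
      using that by (auto simp: slab_def) (smt (verit) of_nat_0_less_iff zero_less_divide_iff)+
    fix z assume z: "z \<notin> C \<inter> UNIV \<times> {1 / real n..T - 1 / real n}"
    show "\<rho> n z * \<psi> z = 0"
    proof (cases "z \<in> C")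
      case True
      with z have "snd z < 1 / real n \<or> T - 1 / real n < snd z" by (cases z) auto
      then have "real n * snd z - 1 \<le> 0 \<or> real n * (T - snd z) - 1 \<le> 0"
        using that by (auto simp: field_simps)
      then show ?thesis by (auto simp: \<rho>_def time_cutoff_def smooth_step_0)
    qed (use C in simp)
  qed
  have eq: "(\<integral>z. v z * (\<rho> n z * dderiv \<psi> e z + dderiv (\<rho> n) e z * \<psi> z) \<partial>lborel) = - (\<integral>z. w z * (\<rho> n z * \<psi> z) \<partial>lborel)" if "n > 0" for n
  proof -
    have "dderiv (\<lambda>z. \<rho> n z * \<psi> z) e z = \<rho> n z * dderiv \<psi> e z + dderiv (\<rho> n) e z * \<psi> z" for z
      by (intro dderiv_mult smooth_differentiable s\<rho> s\<psi>)
    then show ?thesis using vw[unfolded wder_def, rule_format, OF supp[OF that]] by simp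
  qed
  have bdd: "\<bar>v z * (\<rho> n z * dderiv \<psi> e z + dderiv (\<rho> n) e z * \<psi> z)\<bar> \<le> (B2 + 4 * B * \<bar>L\<bar>) * (indicator C z * \<bar>v z\<bar>)" for n z
  proof (cases "z \<in> C \<and> snd z \<in> {0..T}")
    case True
    have 1: "\<bar>\<rho> n z * dderiv \<psi> e z\<bar> \<le> B2"
      using mult_mono[OF time_cutoff_bounds[of T n "snd z"] B2(2)[of z]] by (simp add: \<rho>_def abs_mult)
    \<comment> \<open>The step has stopped varying once n s > 2, so its slope times the scaled
      distance n s stays below 2 B for every n. In this way the linear decay of psi absorbs the
      factor n that comes from differentiating the cutoff.\<close>
    have key: "\<bar>dderiv smooth_step 1 (real n * s - 1)\<bar> * (real n * s) \<le> 2 * B" if "s \<ge> 0" for s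
    proof (cases "real n * s - 1 > 1")
      case True then show ?thesis using smooth_step_deriv_0[of "real n * s - 1" 1] B by simp
    next
      case False
      then have "\<bar>dderiv smooth_step 1 (real n * s - 1)\<bar> * (real n * s) \<le> B * 2"
        using B that by (intro mult_mono) auto
      then show ?thesis by simp
    qed
    have ss: "\<bar>smooth_step x\<bar> \<le> 1" for x using smooth_step_bounds[of x] by simp
    let ?a = "dderiv smooth_step 1 (real n * snd z - 1)" and ?b = "dderiv smooth_step 1 (real n * (T - snd z) - 1)"
    let ?m = "min (snd z) (T - snd z)"
    have m0: "?m \<ge> 0" using True by auto
    have "\<bar>dderiv (\<rho> n) e z * \<psi> z\<bar> = real n * \<bar>snd e * \<psi> z\<bar> * \<bar>?a * smooth_step (real n * (T - snd z) - 1)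
       - smooth_step (real n * snd z - 1) * ?b\<bar>"
      unfolding \<rho>_def[abs_def] dderiv_time_cutoff by (simp add: abs_mult ac_simps)
    also have "\<dots> \<le> real n * \<bar>snd e * \<psi> z\<bar> * (\<bar>?a\<bar> + \<bar>?b\<bar>)"
    proof (rule mult_left_mono)
      have "\<bar>?a * smooth_step (real n * (T - snd z) - 1)\<bar> \<le> \<bar>?a\<bar>"
        using mult_left_mono[OF ss[of "real n * (T - snd z) - 1"], of "\<bar>?a\<bar>"] by (simp add: abs_mult)
      moreover have "\<bar>smooth_step (real n * snd z - 1) * ?b\<bar> \<le> \<bar>?b\<bar>"
        using mult_right_mono[OF ss[of "real n * snd z - 1"], of "\<bar>?b\<bar>"] by (simp add: abs_mult)
      ultimately show "\<bar>?a * smooth_step (real n * (T - snd z) - 1) - smooth_step (real n * snd z - 1) * ?b\<bar> \<le> \<bar>?a\<bar> + \<bar>?b\<bar>"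
        by linarith
    qed simp
    also have "\<dots> \<le> real n * (\<bar>L\<bar> * ?m) * (\<bar>?a\<bar> + \<bar>?b\<bar>)"
    proof (intro mult_right_mono mult_left_mono)
      show "\<bar>snd e * \<psi> z\<bar> \<le> \<bar>L\<bar> * ?m"
        using bd[of z] True mult_right_mono[OF abs_ge_self[of L] m0] by linarith
    qed auto
    also have "\<dots> = \<bar>L\<bar> * (\<bar>?a\<bar> * (real n * ?m) + \<bar>?b\<bar> * (real n * ?m))"
      by (simp add: algebra_simps)
    also have "\<dots> \<le> \<bar>L\<bar> * (\<bar>?a\<bar> * (real n * snd z) + \<bar>?b\<bar> * (real n * (T - snd z)))"
      by (intro mult_left_mono add_mono) auto
    also have "\<dots> \<le> \<bar>L\<bar> * (2 * B + 2 * B)"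
      using True by (intro mult_left_mono add_mono key) auto
    finally have 2: "\<bar>dderiv (\<rho> n) e z * \<psi> z\<bar> \<le> 4 * B * \<bar>L\<bar>" by (simp add: mult.commute)
    have "\<bar>\<rho> n z * dderiv \<psi> e z + dderiv (\<rho> n) e z * \<psi> z\<bar> \<le> B2 + 4 * B * \<bar>L\<bar>"
      using 1 2 by linarith
    from mult_left_mono[OF this, of "\<bar>v z\<bar>"] show ?thesis
      using True by (simp add: abs_mult ac_simps)
  next
    case False
    then consider "z \<notin> C" | "snd z \<notin> {0..T}" by blast
    then show ?thesis using C v0 B B2 by cases auto
  qed
  \<comment> \<open>A fixed interior point eventually lies where the cutoff is locally constant 1;
    the two boundary slices are null sets.\<close>
  have lim\<rho>: "(\<lambda>n. \<rho> n z) \<longlonglongrightarrow> 1" and limd: "(\<lambda>n. dderiv (\<rho> n) e z) \<longlonglongrightarrow> 0" if z: "z \<in> slab T" for z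
  proof -
    have t: "0 < snd z" "0 < T - snd z" using z by (auto simp: slab_def)
    have ev: "\<forall>\<^sub>F n in sequentially. real n * snd z > 2 \<and> real n * (T - snd z) > 2"
      using real_nat_mult_ge_eventually[OF t(1)] real_nat_mult_ge_eventually[OF t(2)] by (rule eventually_conj)
    have "\<forall>\<^sub>F n in sequentially. \<rho> n z = 1"
      using ev by eventually_elim (simp add: \<rho>_def time_cutoff_def smooth_step_1)
    then show "(\<lambda>n. \<rho> n z) \<longlonglongrightarrow> 1" by (rule tendsto_eventually)
    have "\<forall>\<^sub>F n in sequentially. dderiv (\<rho> n) e z = 0"
      using ev by eventually_elim (simp add: \<rho>_def[abs_def] dderiv_time_cutoff smooth_step_deriv_0)
    then show "(\<lambda>n. dderiv (\<rho> n) e z) \<longlonglongrightarrow> 0" by (rule tendsto_eventually)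
  qed
  have lim1: "(\<lambda>n. \<integral>z. v z * (\<rho> n z * dderiv \<psi> e z + dderiv (\<rho> n) e z * \<psi> z) \<partial>lborel) \<longlonglongrightarrow> (\<integral>z. v z * dderiv \<psi> e z \<partial>lborel)"
  proof (rule integral_dominated_convergence[where w="\<lambda>z. (B2 + 4 * B * \<bar>L\<bar>) * (indicator C z * \<bar>v z\<bar>)"])
    show "integrable lborel (\<lambda>z. (B2 + 4 * B * \<bar>L\<bar>) * (indicator C z * \<bar>v z\<bar>))"
      by (intro integrable_mult_right L2loc_integrable_abs v C)
    show "AE z in lborel. (\<lambda>n. v z * (\<rho> n z * dderiv \<psi> e z + dderiv (\<rho> n) e z * \<psi> z)) \<longlonglongrightarrow> v z * dderiv \<psi> e z"
      using AE_lborel_snd_neq[of 0] AE_lborel_snd_neq[of T]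
    proof eventually_elim
      case (elim z)
      show ?case
      proof (cases "z \<in> slab T")
        case True
        have "(\<lambda>n. v z * (\<rho> n z * dderiv \<psi> e z + dderiv (\<rho> n) e z * \<psi> z)) \<longlonglongrightarrow> v z * (1 * dderiv \<psi> e z + 0 * \<psi> z)"
          by (intro tendsto_intros lim\<rho> limd True)
        then show ?thesis by simp
      next
        case False
        then have "v z = 0" using elim by (intro v0) (cases z, auto simp: slab_def)
        then show ?thesis by simp
      qed
    qed
    show "AE z in lborel. norm (v z * (\<rho> n z * dderiv \<psi> e z + dderiv (\<rho> n) e z * \<psi> z)) \<le> (B2 + 4 * B * \<bar>L\<bar>) * (indicator C z * \<bar>v z\<bar>)" for n
      using bdd by simp
  qed measurable
  have "(\<lambda>n. \<integral>z. w z * (\<rho> n z * \<psi> z) \<partial>lborel) \<longlonglongrightarrow> (\<integral>z. w z * \<psi> z \<partial>lborel)"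
  proof (rule integral_dominated_convergence[where w="\<lambda>z. B1 * (indicator C z * \<bar>w z\<bar>)"])
    show "integrable lborel (\<lambda>z. B1 * (indicator C z * \<bar>w z\<bar>))"
      by (intro integrable_mult_right L2loc_integrable_abs w C)
    show "AE z in lborel. (\<lambda>n. w z * (\<rho> n z * \<psi> z)) \<longlonglongrightarrow> w z * \<psi> z"
      using AE_lborel_snd_neq[of 0] AE_lborel_snd_neq[of T]
    proof eventually_elim
      case (elim z)
      show ?case
      proof (cases "z \<in> slab T")
        case True
        have "(\<lambda>n. w z * (\<rho> n z * \<psi> z)) \<longlonglongrightarrow> w z * (1 * \<psi> z)"
          by (intro tendsto_intros lim\<rho> True)
        then show ?thesis by simp
      next
        case False
        then have "w z = 0" using elim by (intro w0) (cases z, auto simp: slab_def)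
        then show ?thesis by simp
      qed
    qed
    have "\<bar>w z * (\<rho> n z * \<psi> z)\<bar> \<le> B1 * (indicator C z * \<bar>w z\<bar>)" for n z
    proof (cases "z \<in> C")
      case True
      have "\<bar>\<rho> n z * \<psi> z\<bar> \<le> B1"
        using mult_mono[OF time_cutoff_bounds[of T n "snd z"] B1(2)[of z]] by (simp add: \<rho>_def abs_mult)
      from mult_left_mono[OF this, of "\<bar>w z\<bar>"] show ?thesis using True by (simp add: abs_mult ac_simps)
    qed (use C in auto)
    then show "AE z in lborel. norm (w z * (\<rho> n z * \<psi> z)) \<le> B1 * (indicator C z * \<bar>w z\<bar>)" for n
      by simp
  qed measurable
  then have lim2: "(\<lambda>n. - (\<integral>z. w z * (\<rho> n z * \<psi> z) \<partial>lborel)) \<longlonglongrightarrow> - (\<integral>z. w z * \<psi> z \<partial>lborel)"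
    by (rule tendsto_minus)
  have "\<forall>\<^sub>F n in sequentially. (\<integral>z. v z * (\<rho> n z * dderiv \<psi> e z + dderiv (\<rho> n) e z * \<psi> z) \<partial>lborel) = - (\<integral>z. w z * (\<rho> n z * \<psi> z) \<partial>lborel)"
    using eventually_gt_at_top[of 0] by eventually_elim (rule eq)
  then have "(\<lambda>n. - (\<integral>z. w z * (\<rho> n z * \<psi> z) \<partial>lborel)) \<longlonglongrightarrow> (\<integral>z. v z * dderiv \<psi> e z \<partial>lborel)"
    by (rule Lim_transform_eventually[OF lim1])
  then show ?thesis using lim2 by (rule LIMSEQ_unique)
qed

section \<open>Extension by reflection\<close>

definition time_affine :: "real \<Rightarrow> real \<Rightarrow> 'b::euclidean_space \<times> real \<Rightarrow> 'b \<times> real" where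
  "time_affine c a z = (fst z, a + c * snd z)"

lemma continuous_time_affine: "continuous_on S (time_affine c a)"
  unfolding time_affine_def by (intro continuous_intros)

lemma time_affine_measurable [measurable]: "time_affine c a \<in> borel_measurable borel"
  by (rule borel_measurable_continuous_onI[OF continuous_time_affine])

lemma lborel_time_affine:
  assumes "c \<noteq> 0"
  shows "(lborel :: ('b::euclidean_space \<times> real) measure) = density (distr lborel borel (time_affine c a)) (\<lambda>_. ennreal \<bar>c\<bar>)"
proof -
  \<comment> \<open>Diagonal scaling: factor 1 on the spatial basis vectors and c on the time
    vector, hence Jacobian |c|.\<close>
  define cc :: "'b \<times> real \<Rightarrow> real" where "cc j = (if snd j = 0 then 1 else c)" for j
  have BP: "(Basis :: ('b \<times> real) set) = (\<lambda>i. (i, 0)) ` Basis \<union> {(0, 1)}"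
    by (auto simp: Basis_prod_def)
  have inj: "inj_on (\<lambda>i::'b. (i, 0::real)) Basis" by (auto simp: inj_on_def)
  have T: "(0, a) + (\<Sum>j\<in>Basis. (cc j * (x \<bullet> j)) *\<^sub>R j) = time_affine c a x" for x :: "'b \<times> real"
  proof -
    have "(\<Sum>j\<in>Basis. (cc j * (x \<bullet> j)) *\<^sub>R j) = (\<Sum>j\<in>(\<lambda>i::'b. (i, 0::real)) ` Basis. (cc j * (x \<bullet> j)) *\<^sub>R j) + (cc (0,1) * (x \<bullet> (0,1))) *\<^sub>R (0,1)"
      unfolding BP by (subst sum.union_disjoint) auto
    also have "(\<Sum>j\<in>(\<lambda>i::'b. (i, 0::real)) ` Basis. (cc j * (x \<bullet> j)) *\<^sub>R j) = (\<Sum>i\<in>Basis. ((fst x \<bullet> i) *\<^sub>R i, 0))"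
      by (subst sum.reindex[OF inj]) (auto simp: cc_def inner_prod_def intro!: sum.cong)
    also have "\<dots> = (fst x, 0)"
      by (rule prod_eqI) (simp_all add: fst_sum snd_sum euclidean_representation)
    finally show ?thesis by (cases x) (simp add: cc_def time_affine_def)
  qed
  have P: "(\<Prod>j\<in>(Basis :: ('b \<times> real) set). \<bar>cc j\<bar>) = \<bar>c\<bar>"
  proof -
    have "(\<Prod>j\<in>(Basis :: ('b \<times> real) set). \<bar>cc j\<bar>) = (\<Prod>j\<in>(\<lambda>i::'b. (i, 0::real)) ` Basis. \<bar>cc j\<bar>) * \<bar>cc (0,1)\<bar>"
      unfolding BP by (subst prod.union_disjoint) auto
    also have "(\<Prod>j\<in>(\<lambda>i::'b. (i, 0::real)) ` Basis. \<bar>cc j\<bar>) = 1"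
      by (rule prod.neutral) (auto simp: cc_def)
    finally show ?thesis by (simp add: cc_def)
  qed
  have "cc j \<noteq> 0" for j using assms by (simp add: cc_def)
  from lborel_affine_euclidean[of cc "(0, a)", OF this] show ?thesis
    unfolding T P by simp
qed

lemma integral_time_affine:
  fixes g :: "'b::euclidean_space \<times> real \<Rightarrow> real"
  assumes c: "c \<noteq> 0" and g: "g \<in> borel_measurable borel"
  shows "(\<integral>z. g z \<partial>lborel) = \<bar>c\<bar> * (\<integral>z. g (time_affine c a z) \<partial>lborel)"
    and "integrable lborel g \<longleftrightarrow> integrable lborel (\<lambda>z. g (time_affine c a z))"
proof -
  have m: "g \<in> borel_measurable (distr lborel borel (time_affine c a))" using g by simp
  have m2: "time_affine c a \<in> lborel \<rightarrow>\<^sub>M (borel :: ('b \<times> real) measure)" by simp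
  show "(\<integral>z. g z \<partial>lborel) = \<bar>c\<bar> * (\<integral>z. g (time_affine c a z) \<partial>lborel)"
    by (subst lborel_time_affine[OF c, of a], subst integral_density)
       (use g in \<open>auto simp: integral_distr[OF m2]\<close>)
  have "integrable lborel g \<longleftrightarrow> integrable (distr lborel borel (time_affine c a)) (\<lambda>z. \<bar>c\<bar> *\<^sub>R g z)"
    by (subst lborel_time_affine[OF c, of a], subst integrable_density) (use g in auto)
  also have "\<dots> \<longleftrightarrow> integrable lborel (\<lambda>z. \<bar>c\<bar> *\<^sub>R g (time_affine c a z))"
    by (subst integrable_distr_eq[OF m2]) (use g in auto)
  also have "\<dots> \<longleftrightarrow> integrable lborel (\<lambda>z. g (time_affine c a z))"
    using c by simp
  finally show "integrable lborel g \<longleftrightarrow> integrable lborel (\<lambda>z. g (time_affine c a z))" .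
qed

lemma L2loc_time_affine:
  fixes v :: "'b::euclidean_space \<times> real \<Rightarrow> real"
  assumes v: "L2loc v" and c: "c \<noteq> 0"
  shows "L2loc (\<lambda>z. v (time_affine c a z))"
  unfolding L2loc_def
proof (intro conjI allI impI)
  have [measurable]: "v \<in> borel_measurable borel" using v by (simp add: L2loc_def)
  show "(\<lambda>z. v (time_affine c a z)) \<in> borel_measurable borel" by measurable
  fix C :: "('b \<times> real) set" assume C: "compact C"
  define D where "D = time_affine c a ` C"
  have D: "compact D" unfolding D_def by (intro compact_continuous_image C continuous_time_affine)
  then have [measurable]: "D \<in> sets borel" by (rule borel_compact)
  have inj: "inj (time_affine c a :: 'b \<times> real \<Rightarrow> _)" using c by (auto simp: inj_def time_affine_def)
  then have "indicator D (time_affine c a z) = (indicator C z :: real)" for z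
    unfolding D_def indicator_def by (simp only: inj_image_mem_iff[OF inj])
  moreover have "integrable lborel (\<lambda>z. indicator D z * (v z)\<^sup>2)" using v D by (simp add: L2loc_def)
  then have "integrable lborel (\<lambda>z. indicator D (time_affine c a z) * (v (time_affine c a z))\<^sup>2)"
    by (subst (asm) integral_time_affine(2)[OF c]) measurable
  ultimately show "integrable lborel (\<lambda>z. indicator C z * (v (time_affine c a z))\<^sup>2)" by simp
qed

text \<open>Higher order reflection at both ends \<open>\<tau> = 0, T\<close> of the time interval, with reflected points
  \<open>\<tau> - (2 j - 1) (t - \<tau>)\<close>. The factors \<open>1, -1, -3, \<dots>\<close> are equispaced, so the conditions under which
  the derivatives match across \<open>\<tau>\<close> say that a k-th finite difference of a polynomial of smaller
  degree vanishes, and the coefficients are alternating binomial ones.\<close>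

definition refl_rate :: "nat \<Rightarrow> real" where "refl_rate j = 2 * real j - 1"

text \<open>The affine map sends t to \<tau> - r (t - \<tau>) with r the rate. The sum makes no case
  distinction: for v vanishing off the closed time interval, the wrong reflections of a point near
  the interval, other than its ends, land outside it and contribute zero.\<close>

definition refl_ext :: "real \<Rightarrow> nat \<Rightarrow> (nat \<Rightarrow> real) \<Rightarrow> ('b::euclidean_space \<times> real \<Rightarrow> real) \<Rightarrow> 'b \<times> real \<Rightarrow> real" where
  "refl_ext T k b v z = v z + (\<Sum>(j, \<tau>) \<in> {1..k} \<times> {0, T}.
      b j * v (time_affine (- refl_rate j) (\<tau> * (1 + refl_rate j)) z))"

lemma refl_rate_bounds: "j \<in> {1..k} \<Longrightarrow> 1 \<le> refl_rate j \<and> refl_rate j \<le> 2 * real k"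
  by (auto simp: refl_rate_def)

lemma L2loc_refl_ext: "L2loc v \<Longrightarrow> L2loc (refl_ext T k b v)"
  unfolding refl_ext_def[abs_def] split_def
  by (intro L2loc_add L2loc_sum L2loc_cmult L2loc_time_affine)
     (auto simp: refl_rate_def)

text \<open>A test function vanishing at an end of the time interval is thus bounded by L times the
  distance to that end, the decay that testing up to the boundary asks for.\<close>

lemma test_fun_lipschitz_time:
  fixes \<psi> :: "'b::euclidean_space \<times> real \<Rightarrow> real"
  assumes \<psi>: "test_fun UNIV \<psi>"
  obtains L where "L \<ge> 0" "\<And>x s t. \<bar>\<psi> (x, t) - \<psi> (x, s)\<bar> \<le> L * \<bar>t - s\<bar>"
proof -
  obtain B where B: "B > 0" "\<And>z. \<bar>dderiv \<psi> (0, 1) z\<bar> \<le> B"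
    using test_fun_bounded'[OF test_fun_dderiv[OF \<psi>]] by blast
  have "\<bar>\<psi> (x, t) - \<psi> (x, s)\<bar> \<le> B * \<bar>t - s\<bar>" for x s t
  proof -
    have d: "((\<lambda>t. \<psi> (x, t)) has_real_derivative dderiv \<psi> (0, 1) (x, t)) (at t)" for t
    proof -
      have 1: "(\<psi> has_derivative (\<lambda>v. dderiv \<psi> v (x, t))) (at (x, t))"
        by (rule smooth_has_derivative[OF test_fun_smooth[OF \<psi>]])
      have 2: "((\<lambda>t. (x, t)) has_derivative (\<lambda>h. (0, h))) (at t)"
        by (auto intro!: derivative_eq_intros)
      have "((\<lambda>t. \<psi> (x, t)) has_derivative (\<lambda>h. dderiv \<psi> (0, h) (x, t))) (at t)"
        using has_derivative_compose[OF 2 1] by simp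
      moreover have "dderiv \<psi> (0, h) (x, t) = dderiv \<psi> (0, 1) (x, t) * h" for h
        using linear_cmul[OF has_derivative_linear[OF 1], of h "(0, 1)"] by simp
      then have "(\<lambda>h. dderiv \<psi> (0, h) (x, t)) = (*) (dderiv \<psi> (0, 1) (x, t))" by blast
      ultimately show ?thesis unfolding has_field_derivative_def by (simp only:)
    qed
    show ?thesis
      using field_differentiable_bound[of UNIV "\<lambda>t. \<psi> (x, t)" "\<lambda>t. dderiv \<psi> (0, 1) (x, t)" B t s] d B
      by auto
  qed
  with B that show ?thesis by (meson less_imp_le)
qed

text \<open>Transposition: a change of variables moves the reflections from v to the test function,
  so testing the extension with phi amounts to testing v with psi, which is phi plus weighted
  reflected copies of it. In the time direction psi vanishes at both ends as the b_j sum to 1; in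
  spatial directions nothing is asked of psi at the boundary. Hence psi may be used on the closed
  slab. A time derivative of a reflected copy brings out minus the rate as a factor.\<close>

lemma wder_refl_ext:
  fixes v w :: "'b::euclidean_space \<times> real \<Rightarrow> real"
  assumes v: "L2loc v" and w: "L2loc w" and vw: "wder (slab T) e v w"
    and v0: "\<And>z. snd z \<notin> {0..T} \<Longrightarrow> v z = 0" and w0: "\<And>z. snd z \<notin> {0..T} \<Longrightarrow> w z = 0"
    and T: "T > 0" and k: "k \<ge> 1"
    and e: "snd e = 0 \<or> e = (0, 1) \<and> (\<Sum>j\<in>{1..k}. b j) = 1"
  shows "wder (UNIV \<times> {- T / (2 * real k)<..<T + T / (2 * real k)}) e (refl_ext T k b v)
     (refl_ext T k (\<lambda>j. b j * (if snd e = 0 then 1 else - refl_rate j)) w)"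
  unfolding wder_def
proof (intro allI impI)
  define \<delta> where "\<delta> = T / (2 * real k)"
  define I where "I = {1..k} \<times> {0, T}"
  define R where "R p = (time_affine (- refl_rate (fst p)) (snd p * (1 + refl_rate (fst p))) :: 'b \<times> real \<Rightarrow> 'b \<times> real)" for p
  define Q where "Q p = (time_affine (- inverse (refl_rate (fst p))) (snd p * (1 + inverse (refl_rate (fst p)))) :: 'b \<times> real \<Rightarrow> 'b \<times> real)" for p
  \<comment> \<open>This is the factor by which the reflection scales the direction e. Together with
    the Jacobian 1/rate it forms the weights \<beta> of the transposed reflections.\<close>
  define \<epsilon> where "\<epsilon> p = (if snd e = 0 then 1 else - refl_rate (fst p))" for p :: "nat \<times> real"
  define \<beta> where "\<beta> p = b (fst p) * \<epsilon> p / refl_rate (fst p)" for p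
  have l1: "refl_rate (fst p) \<ge> 1" if "p \<in> I" for p
    using that refl_rate_bounds[of "fst p" k] by (auto simp: I_def)
  have fI: "finite I" by (simp add: I_def)
  have QR: "Q p (R p z) = z" if "p \<in> I" for p z
    using l1[OF that] by (cases z) (simp add: Q_def R_def time_affine_def field_simps)
  have ext: "refl_ext T k b' u z = u z + (\<Sum>p\<in>I. b' (fst p) * u (R p z))" for b' u z
    by (simp add: refl_ext_def I_def R_def split_def)
  fix \<phi> :: "'b \<times> real \<Rightarrow> real" assume t: "test_fun (UNIV \<times> {- T / (2 * real k)<..<T + T / (2 * real k)}) \<phi>"
  then have tU: "test_fun UNIV \<phi>" unfolding test_fun_iff by blast
  have s\<phi>: "smooth \<phi>" by (rule test_fun_smooth[OF t])
  have tQ: "test_fun UNIV (\<lambda>z. \<phi> (Q p z))" if "p \<in> I" for p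
  proof -
    obtain C where C: "compact C" "\<And>z. z \<notin> C \<Longrightarrow> \<phi> z = 0" using test_funE[OF t] by metis
    have "bounded_linear (\<lambda>z :: 'b \<times> real. (fst z, - inverse (refl_rate (fst p)) * snd z))"
      by (intro bounded_linear_intros bounded_linear_Pair)
    from smooth_affine[OF this s\<phi>, of "(0, snd p * (1 + inverse (refl_rate (fst p))))"]
    have "smooth (\<lambda>z. \<phi> (Q p z))" by (simp add: Q_def time_affine_def)
    moreover have "compact (R p ` C)" unfolding R_def by (intro compact_continuous_image C continuous_time_affine)
    moreover have "\<phi> (Q p z) = 0" if "z \<notin> R p ` C" for z
    proof -
      have "R p (Q p z) = z"
        using l1[OF \<open>p \<in> I\<close>] by (cases z) (simp add: Q_def R_def time_affine_def field_simps)
      then have "Q p z \<notin> C" using that by (metis imageI)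
      then show ?thesis using C by simp
    qed
    ultimately show ?thesis unfolding test_fun_iff by blast
  qed
  define \<psi> where "\<psi> z = \<phi> z + (\<Sum>p\<in>I. \<beta> p * \<phi> (Q p z))" for z
  have s\<psi>': "smooth (\<lambda>z. \<Sum>p\<in>I. \<beta> p * \<phi> (Q p z))"
    by (intro smooth_sum fI smooth_mult smooth_const test_fun_smooth[OF tQ])
  have t\<psi>: "test_fun UNIV \<psi>"
  proof -
    obtain C where C: "compact C" "\<And>z. z \<notin> C \<Longrightarrow> \<phi> z = 0" using test_funE[OF tU] by metis
    have "\<forall>p\<in>I. \<exists>C. compact C \<and> (\<forall>z. z \<notin> C \<longrightarrow> \<phi> (Q p z) = 0)"
      using tQ unfolding test_fun_iff by blast
    then obtain D where D: "\<And>p. p \<in> I \<Longrightarrow> compact (D p)" "\<And>p z. p \<in> I \<Longrightarrow> z \<notin> D p \<Longrightarrow> \<phi> (Q p z) = 0"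
      by metis
    have "compact (C \<union> (\<Union>p\<in>I. D p))" using C D fI by blast
    moreover have "\<psi> z = 0" if "z \<notin> C \<union> (\<Union>p\<in>I. D p)" for z
      using that C D by (simp add: \<psi>_def)
    moreover have "smooth \<psi>" unfolding \<psi>_def[abs_def] by (intro smooth_add s\<phi> s\<psi>')
    ultimately show ?thesis unfolding test_fun_iff by blast
  qed
  have dQ: "\<epsilon> p * dderiv (\<lambda>z. \<phi> (Q p z)) e z = dderiv \<phi> e (Q p z)" if "p \<in> I" for p z
  proof -
    let ?A = "\<lambda>z :: 'b \<times> real. (fst z, - inverse (refl_rate (fst p)) * snd z)"
    let ?c = "(0, snd p * (1 + inverse (refl_rate (fst p)))) :: 'b \<times> real"
    have bl: "bounded_linear ?A"
      by (intro bounded_linear_intros bounded_linear_Pair)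
    have Qe: "Q p = (\<lambda>z. ?c + ?A z)" by (auto simp: Q_def time_affine_def fun_eq_iff)
    have "dderiv (\<lambda>z. \<phi> (Q p z)) e z = dderiv \<phi> (?A e) (Q p z)"
      unfolding Qe by (rule dderiv_affine[OF bl smooth_differentiable[OF s\<phi>]])
    also have "?A e = inverse (\<epsilon> p) *\<^sub>R e"
      using e by (cases e) (auto simp: \<epsilon>_def)
    also have "dderiv \<phi> (inverse (\<epsilon> p) *\<^sub>R e) (Q p z) = inverse (\<epsilon> p) * dderiv \<phi> e (Q p z)"
      using linear_cmul[OF has_derivative_linear[OF smooth_has_derivative[OF s\<phi>]]] by simp
    finally show ?thesis using l1[OF that] by (simp add: \<epsilon>_def)
  qed
  have d\<psi>: "dderiv \<psi> e z = dderiv \<phi> e z + (\<Sum>p\<in>I. \<beta> p * dderiv (\<lambda>z. \<phi> (Q p z)) e z)" for z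
  proof -
    have "(\<psi> has_derivative (\<lambda>v. dderiv \<phi> v z + (\<Sum>p\<in>I. \<beta> p * dderiv (\<lambda>z. \<phi> (Q p z)) v z))) (at z)"
      unfolding \<psi>_def[abs_def]
      by (intro has_derivative_add smooth_has_derivative s\<phi> has_derivative_sum has_derivative_mult_right test_fun_smooth[OF tQ])
    then show ?thesis by (rule dderiv_eqI)
  qed
  have cov: "(\<integral>z. u (R p z) * h z \<partial>lborel) = inverse (refl_rate (fst p)) * (\<integral>z. u z * h (Q p z) \<partial>lborel)"
    if "p \<in> I" "L2loc u" "continuous_on UNIV h" for u h p
  proof -
    have [measurable]: "u \<in> borel_measurable borel" "h \<in> borel_measurable borel"
      using that by (auto simp: L2loc_def intro: borel_measurable_continuous_onI)
    have "(\<integral>z. u z * h (Q p z) \<partial>lborel) = refl_rate (fst p) * (\<integral>z. u (R p z) * h (Q p (R p z)) \<partial>lborel)"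
      using l1[OF that(1)] unfolding R_def Q_def
      by (subst integral_time_affine(1)[of "- refl_rate (fst p)" _ "snd p * (1 + refl_rate (fst p))"]) auto
    then show ?thesis using l1[OF that(1)] QR[OF that(1)] by (simp add: field_simps)
  qed
  have LR: "L2loc (\<lambda>z. u (R p z))" if "L2loc u" "p \<in> I" for u p
    using l1[OF that(2)] unfolding R_def by (intro L2loc_time_affine that) auto
  have ci: "continuous_on UNIV \<phi>" "continuous_on UNIV (dderiv \<phi> e)"
    using s\<phi> by (auto intro: smooth_continuous_on smooth_dderiv)
  have expand: "(\<integral>z. refl_ext T k b' u z * h z \<partial>lborel) = (\<integral>z. u z * h z \<partial>lborel) +
      (\<Sum>p\<in>I. b' (fst p) * (inverse (refl_rate (fst p)) * (\<integral>z. u z * h (Q p z) \<partial>lborel)))"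
    if u: "L2loc u" and h: "test_fun UNIV h" for b' u h
  proof -
    have i: "integrable lborel (\<lambda>z. u (R p z) * h z)" if "p \<in> I" for p
      by (rule L2loc_integrable_test[OF LR[OF u that] h])
    have "(\<integral>z. refl_ext T k b' u z * h z \<partial>lborel) = (\<integral>z. u z * h z + (\<Sum>p\<in>I. b' (fst p) * (u (R p z) * h z)) \<partial>lborel)"
      by (simp add: ext distrib_right sum_distrib_right mult.assoc)
    also have "\<dots> = (\<integral>z. u z * h z \<partial>lborel) + (\<Sum>p\<in>I. b' (fst p) * (\<integral>z. u (R p z) * h z \<partial>lborel))"
      using i L2loc_integrable_test[OF u h]
      by (subst Bochner_Integration.integral_add) (auto simp: Bochner_Integration.integral_sum)
    also have "\<dots> = (\<integral>z. u z * h z \<partial>lborel) + (\<Sum>p\<in>I. b' (fst p) * (inverse (refl_rate (fst p)) * (\<integral>z. u z * h (Q p z) \<partial>lborel)))"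
      using cov[OF _ u smooth_continuous_on[OF test_fun_smooth[OF h]]] by simp
    finally show ?thesis .
  qed
  obtain L where L: "L \<ge> 0" "\<And>x s t. \<bar>\<psi> (x, t) - \<psi> (x, s)\<bar> \<le> L * \<bar>t - s\<bar>"
    using test_fun_lipschitz_time[OF t\<psi>] by blast
  \<comment> \<open>Reflection about the same end fixes the end point, while reflection about the
    other end lands T/rate beyond it, which is at least \<delta> since rates are at most 2 k, hence
    outside the support of phi. What remains is phi times 1 minus the sum of the b_j.\<close>
  have vanish: "\<psi> (x, \<tau>) = 0" if e1: "e = (0, 1)" "(\<Sum>j\<in>{1..k}. b j) = 1" and \<tau>: "\<tau> \<in> {0, T}" for x \<tau>
  proof -
    obtain C where C: "C \<subseteq> UNIV \<times> {- \<delta><..<T + \<delta>}" "\<And>z. z \<notin> C \<Longrightarrow> \<phi> z = 0"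
      using test_funE[OF t] unfolding \<delta>_def by (metis minus_divide_left)
    have \<beta>: "\<beta> p = - b (fst p)" if "p \<in> I" for p
      using l1[OF that] e1 by (simp add: \<beta>_def \<epsilon>_def)
    have Q1: "\<phi> (Q (j, \<sigma>) (x, \<tau>)) = (if \<sigma> = \<tau> then \<phi> (x, \<tau>) else 0)" if j: "j \<in> {1..k}" and \<sigma>: "\<sigma> \<in> {0, T}" for j \<sigma>
    proof (cases "\<sigma> = \<tau>")
      case True
      then show ?thesis using l1[of "(j, \<sigma>)"] that by (simp add: Q_def time_affine_def I_def algebra_simps)
    next
      case False
      have r: "1 \<le> refl_rate j" "refl_rate j \<le> 2 * real k" using refl_rate_bounds[OF j] by auto
      have "T * inverse (refl_rate j) \<ge> \<delta>"
        unfolding \<delta>_def divide_inverse using r T k by (intro mult_left_mono le_imp_inverse_le) auto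
      then have "snd (Q (j, \<sigma>) (x, \<tau>)) \<le> - \<delta> \<or> snd (Q (j, \<sigma>) (x, \<tau>)) \<ge> T + \<delta>"
        using False \<tau> \<sigma> by (auto simp: Q_def time_affine_def algebra_simps)
      then have "Q (j, \<sigma>) (x, \<tau>) \<notin> C" using C(1) by (cases "Q (j, \<sigma>) (x, \<tau>)") auto
      then show ?thesis using C(2) False by simp
    qed
    have "(\<Sum>p\<in>I. \<beta> p * \<phi> (Q p (x, \<tau>))) = (\<Sum>p\<in>I. - b (fst p) * \<phi> (Q p (x, \<tau>)))"
      using \<beta> by simp
    also have "\<dots> = (\<Sum>j\<in>{1..k}. \<Sum>\<sigma>\<in>{0,T}. - b j * \<phi> (Q (j, \<sigma>) (x, \<tau>)))"
      unfolding I_def by (simp add: sum.cartesian_product split_def)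
    also have "\<dots> = (\<Sum>j\<in>{1..k}. \<Sum>\<sigma>\<in>{0,T}. if \<sigma> = \<tau> then - b j * \<phi> (x, \<tau>) else 0)"
      by (intro sum.cong refl) (use Q1 in auto)
    also have "\<dots> = (\<Sum>j\<in>{1..k}. - b j * \<phi> (x, \<tau>))"
      using \<tau> by (simp add: sum.delta)
    also have "\<dots> = - (\<Sum>j\<in>{1..k}. b j) * \<phi> (x, \<tau>)"
      by (simp add: sum_distrib_right sum_negf)
    finally show ?thesis using e1 by (simp add: \<psi>_def)
  qed
  have bd: "\<bar>snd e * \<psi> z\<bar> \<le> L * min (snd z) (T - snd z)" if z: "snd z \<in> {0..T}" for z
  proof (cases "snd e = 0")
    case True
    then show ?thesis using L(1) z by (auto intro!: mult_nonneg_nonneg)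
  next
    case False
    then have e1: "e = (0, 1)" "(\<Sum>j\<in>{1..k}. b j) = 1" using e by auto
    have "\<bar>\<psi> z\<bar> \<le> L * snd z" "\<bar>\<psi> z\<bar> \<le> L * (T - snd z)"
      using L(2)[of "fst z" "snd z" 0] L(2)[of "fst z" "snd z" T] vanish[OF e1] z by auto
    then show ?thesis using e1 by (auto simp: min_def)
  qed
  have "(\<integral>z. refl_ext T k b v z * dderiv \<phi> e z \<partial>lborel) = (\<integral>z. v z * dderiv \<phi> e z \<partial>lborel) +
      (\<Sum>p\<in>I. b (fst p) * (inverse (refl_rate (fst p)) * (\<integral>z. v z * dderiv \<phi> e (Q p z) \<partial>lborel)))"
    by (rule expand[OF v test_fun_dderiv[OF tU]])
  also have "\<dots> = (\<integral>z. v z * dderiv \<phi> e z \<partial>lborel) +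
      (\<Sum>p\<in>I. \<beta> p * (\<integral>z. v z * dderiv (\<lambda>z. \<phi> (Q p z)) e z \<partial>lborel))"
  proof -
    have "(\<integral>z. v z * dderiv \<phi> e (Q p z) \<partial>lborel) = \<epsilon> p * (\<integral>z. v z * dderiv (\<lambda>z. \<phi> (Q p z)) e z \<partial>lborel)" if "p \<in> I" for p
      unfolding dQ[OF that, symmetric] integral_mult_right_zero[symmetric]
      by (intro Bochner_Integration.integral_cong) auto
    then show ?thesis by (simp add: \<beta>_def divide_inverse ac_simps)
  qed
  also have "\<dots> = (\<integral>z. v z * dderiv \<psi> e z \<partial>lborel)"
  proof -
    have "integrable lborel (\<lambda>z. v z * dderiv (\<lambda>z. \<phi> (Q p z)) e z)" if "p \<in> I" for p
      by (rule L2loc_integrable_test[OF v test_fun_dderiv[OF tQ[OF that]]])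
    then have "(\<integral>z. v z * dderiv \<phi> e z + (\<Sum>p\<in>I. \<beta> p * (v z * dderiv (\<lambda>z. \<phi> (Q p z)) e z)) \<partial>lborel) = (\<integral>z. v z * dderiv \<phi> e z \<partial>lborel) +
      (\<Sum>p\<in>I. \<beta> p * (\<integral>z. v z * dderiv (\<lambda>z. \<phi> (Q p z)) e z \<partial>lborel))"
      using L2loc_integrable_test[OF v test_fun_dderiv[OF tU]]
      by (subst Bochner_Integration.integral_add) (auto simp: Bochner_Integration.integral_sum)
    then show ?thesis unfolding d\<psi> by (simp add: distrib_left sum_distrib_left ac_simps)
  qed
  also have "\<dots> = - (\<integral>z. w z * \<psi> z \<partial>lborel)"
    by (rule wder_up_to_boundary[OF v w vw v0 w0 t\<psi> bd])
  also have "(\<integral>z. w z * \<psi> z \<partial>lborel) = (\<integral>z. w z * \<phi> z \<partial>lborel) + (\<Sum>p\<in>I. \<beta> p * (\<integral>z. w z * \<phi> (Q p z) \<partial>lborel))"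
  proof -
    have "integrable lborel (\<lambda>z. w z * \<phi> (Q p z))" if "p \<in> I" for p
      by (rule L2loc_integrable_test[OF w tQ[OF that]])
    then have "(\<integral>z. w z * \<phi> z + (\<Sum>p\<in>I. \<beta> p * (w z * \<phi> (Q p z))) \<partial>lborel) = (\<integral>z. w z * \<phi> z \<partial>lborel) +
      (\<Sum>p\<in>I. \<beta> p * (\<integral>z. w z * \<phi> (Q p z) \<partial>lborel))"
      using L2loc_integrable_test[OF w tU]
      by (subst Bochner_Integration.integral_add) (auto simp: Bochner_Integration.integral_sum)
    then show ?thesis by (simp add: \<psi>_def distrib_left sum_distrib_left ac_simps)
  qed
  also have "\<dots> = (\<integral>z. refl_ext T k (\<lambda>j. b j * (if snd e = 0 then 1 else - refl_rate j)) w z * \<phi> z \<partial>lborel)"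
    unfolding expand[OF w tU] by (simp add: \<beta>_def \<epsilon>_def divide_inverse ac_simps)
  finally show "(\<integral>z. refl_ext T k b v z * dderiv \<phi> e z \<partial>lborel) =
    - (\<integral>z. refl_ext T k (\<lambda>j. b j * (if snd e = 0 then 1 else - refl_rate j)) w z * \<phi> z \<partial>lborel)" .
qed

section \<open>Finite differences and the moments of the reflection coefficients\<close>

lemma alternating_binomial_shift:
  fixes f :: "nat \<Rightarrow> real"
  shows "(\<Sum>j\<le>Suc k. (-1) ^ j * real (Suc k choose j) * f j) = (\<Sum>j\<le>k. (-1) ^ j * real (k choose j) * (f j - f (Suc j)))"
proof -
  have "(\<Sum>j\<le>Suc k. (-1) ^ j * real (Suc k choose j) * f j)
      = f 0 + (\<Sum>j\<le>k. (-1) ^ Suc j * real (Suc k choose Suc j) * f (Suc j))"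
    by (subst sum.atMost_Suc_shift) simp
  also have "(\<Sum>j\<le>k. (-1) ^ Suc j * real (Suc k choose Suc j) * f (Suc j))
      = (\<Sum>j\<le>k. (-1) ^ Suc j * real (k choose Suc j) * f (Suc j)) - (\<Sum>j\<le>k. (-1) ^ j * real (k choose j) * f (Suc j))"
    unfolding sum_subtractf[symmetric] by (intro sum.cong refl) (simp add: algebra_simps)
  also have "(\<Sum>j\<le>k. (-1) ^ Suc j * real (k choose Suc j) * f (Suc j)) = (\<Sum>j\<le>Suc k. (-1) ^ j * real (k choose j) * f j) - f 0"
    by (subst sum.atMost_Suc_shift) simp
  also have "(\<Sum>j\<le>Suc k. (-1) ^ j * real (k choose j) * f j) = (\<Sum>j\<le>k. (-1) ^ j * real (k choose j) * f j)"
    by simp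
  finally show ?thesis by (simp add: right_diff_distrib sum_subtractf)
qed

text \<open>Pascal's rule turns the alternating sum of order k + 1 into one of order k of first
  differences. The first difference of an i-th power is a combination of lower powers, to each of
  which the induction hypothesis applies.\<close>

lemma alternating_binomial_power:
  fixes a c :: real
  shows "i < k \<Longrightarrow> (\<Sum>j\<le>k. (-1) ^ j * real (k choose j) * (a + c * real j) ^ i) = 0"
proof (induction k arbitrary: i)
  case (Suc k)
  have "(a + c * real j) ^ i - (a + c * real (Suc j)) ^ i = - (\<Sum>l<i. real (i choose l) * c ^ (i - l) * (a + c * real j) ^ l)" for j
  proof -
    have "(a + c * real (Suc j)) ^ i = ((a + c * real j) + c) ^ i" by (simp add: algebra_simps)
    also have "\<dots> = (\<Sum>l\<le>i. real (i choose l) * (a + c * real j) ^ l * c ^ (i - l))"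
      by (rule binomial_ring)
    also have "\<dots> = (\<Sum>l<i. real (i choose l) * c ^ (i - l) * (a + c * real j) ^ l) + (a + c * real j) ^ i"
      by (simp add: lessThan_Suc_atMost[symmetric] ac_simps)
    finally show ?thesis by simp
  qed
  then have "(\<Sum>j\<le>Suc k. (-1) ^ j * real (Suc k choose j) * (a + c * real j) ^ i)
     = (\<Sum>j\<le>k. \<Sum>l<i. - (real (i choose l) * c ^ (i - l) * ((-1) ^ j * real (k choose j) * (a + c * real j) ^ l)))"
    unfolding alternating_binomial_shift by (simp add: sum_distrib_left sum_negf ac_simps)
  also have "\<dots> = (\<Sum>l<i. - (real (i choose l) * c ^ (i - l) * (\<Sum>j\<le>k. (-1) ^ j * real (k choose j) * (a + c * real j) ^ l)))"
    by (subst sum.swap) (simp add: sum_distrib_left sum_negf)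
  also have "\<dots> = 0" using Suc by (intro sum.neutral) auto
  finally show ?case .
qed simp

definition refl_coeff :: "nat \<Rightarrow> nat \<Rightarrow> real" where
  "refl_coeff k j = (-1) ^ Suc j * real (k choose j)"

text \<open>The nodes 1 - 2 j equal minus the rates for j \<ge> 1 and 1 for j = 0. The k-th
  difference of the i-th power over these nodes vanishes; its j = 0 term, equal to 1, is moved to
  the other side.\<close>

lemma refl_coeff_moments:
  assumes "i < k"
  shows "(\<Sum>j\<in>{1..k}. refl_coeff k j * (- refl_rate j) ^ i) = 1"
proof -
  have "(\<Sum>j\<le>k. (-1) ^ j * real (k choose j) * (1 + (-2) * real j) ^ i) = 0"
    using assms by (rule alternating_binomial_power)
  also have "(\<Sum>j\<le>k. (-1) ^ j * real (k choose j) * (1 + (-2) * real j) ^ i) = 1 - (\<Sum>j\<in>{1..k}. refl_coeff k j * (- refl_rate j) ^ i)"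
    by (simp add: atMost_atLeast0 sum.atLeast_Suc_atMost refl_coeff_def refl_rate_def sum_negf[symmetric])
  finally show ?thesis by simp
qed

lemma wder_slab_restrict:
  assumes "wder (slab T) e v w"
  shows "wder (slab T) e (\<lambda>z. indicator (UNIV \<times> {0..T}) z * v z) (\<lambda>z. indicator (UNIV \<times> {0..T}) z * w z)"
  unfolding wder_def
proof (intro allI impI)
  let ?I = "indicator (UNIV \<times> {0..T}) :: 'a \<times> real \<Rightarrow> real"
  fix \<phi> :: "'a \<times> real \<Rightarrow> real" assume t: "test_fun (slab T) \<phi>"
  obtain C where C: "C \<subseteq> slab T" "\<And>z. z \<notin> C \<Longrightarrow> \<phi> z = 0" "\<And>z v. z \<notin> C \<Longrightarrow> dderiv \<phi> v z = 0"
    using test_funE[OF t] by metis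
  have I: "?I z = 1" if "z \<in> C" for z
    using that C(1) by (auto simp: slab_def indicator_def)
  have eq: "(?I z * v z) * dderiv \<phi> e z = v z * dderiv \<phi> e z" "(?I z * w z) * \<phi> z = w z * \<phi> z" for z
    using C I by (cases "z \<in> C"; simp)+
  show "(\<integral>z. (?I z * v z) * dderiv \<phi> e z \<partial>lborel) = - (\<integral>z. (?I z * w z) * \<phi> z \<partial>lborel)"
    using assms[unfolded wder_def, rule_format, OF t] by (simp only: eq)
qed

lemma L2loc_slab_restrict:
  fixes v :: "'b::euclidean_space \<times> real \<Rightarrow> real"
  assumes "L2loc v"
  shows "L2loc (\<lambda>z. indicator (UNIV \<times> {0..T}) z * v z)"
  unfolding L2loc_def
proof (intro conjI allI impI)
  have [measurable]: "v \<in> borel_measurable borel" using assms by (simp add: L2loc_def)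
  have [measurable]: "(UNIV \<times> {0..T}) \<in> sets (borel :: ('b \<times> real) measure)"
    by (intro borel_closed closed_Times) auto
  show "(\<lambda>z. indicator (UNIV \<times> {0..T}) z * v z) \<in> borel_measurable borel" by measurable
  fix C :: "('b \<times> real) set" assume C: "compact C"
  then have [measurable]: "C \<in> sets borel" by (rule borel_compact)
  show "integrable lborel (\<lambda>z. indicator C z * (indicator (UNIV \<times> {0..T}) z * v z)\<^sup>2)"
  proof (rule Bochner_Integration.integrable_bound)
    show "integrable lborel (\<lambda>z. indicator C z * (v z)\<^sup>2)" using assms C by (simp add: L2loc_def)
  qed (measurable, auto simp: indicator_def)
qed

text \<open>Test functions on the open slab do not see values outside it, so all members of a chain
  may be set to zero there, which the reflection formula presupposes.\<close>

lemma wchain_slab_restrict: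
  "wchain (slab T) e n v \<Longrightarrow> wchain (slab T) e n (\<lambda>z. indicator (UNIV \<times> {0..T}) z * v z)"
proof (induction n arbitrary: v)
  case (Suc n)
  then obtain w where "wder (slab T) e v w" "wchain (slab T) e n w" by auto
  with Suc show ?case unfolding wchain.simps
    by (intro conjI exI[of _ "\<lambda>z. indicator (UNIV \<times> {0..T}) z * w z"] L2loc_slab_restrict wder_slab_restrict) auto
qed (simp add: L2loc_slab_restrict)

text \<open>One time derivative multiplies b_j by minus the j-th rate, so the i-th moment condition
  of the new coefficients is the (i + 1)-st of the old ones; spatial derivatives leave the
  coefficients alone. A chain of n time derivatives thus uses up n moment conditions.\<close>

lemma wchain_refl_ext:
  fixes v :: "'b::euclidean_space \<times> real \<Rightarrow> real"
  assumes T: "T > 0" and k: "k \<ge> 1" and e: "snd e = 0 \<or> e = (0, 1)"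
  shows "wchain (slab T) e n v \<Longrightarrow> (\<And>z. snd z \<notin> {0..T} \<Longrightarrow> v z = 0) \<Longrightarrow>
    (\<And>i. i < n \<Longrightarrow> (\<Sum>j\<in>{1..k}. b j * (- refl_rate j) ^ i) = 1) \<Longrightarrow>
    wchain (UNIV \<times> {- T / (2 * real k)<..<T + T / (2 * real k)}) e n (refl_ext T k b v)"
proof (induction n arbitrary: v b)
  case 0
  then show ?case by (simp add: L2loc_refl_ext)
next
  case (Suc n)
  let ?I = "indicator (UNIV \<times> {0..T}) :: 'b \<times> real \<Rightarrow> real"
  let ?b = "\<lambda>j. b j * (if snd e = 0 then 1 else - refl_rate j)"
  obtain w0 where w0: "wder (slab T) e v w0" "wchain (slab T) e n w0" using Suc.prems by auto
  define w where "w z = ?I z * w0 z" for z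
  have Iv: "(\<lambda>z. ?I z * v z) = v"
    using Suc.prems(2) by (force simp: fun_eq_iff indicator_def)
  have w: "wder (slab T) e v w" "wchain (slab T) e n w" "\<And>z. snd z \<notin> {0..T} \<Longrightarrow> w z = 0"
    using wder_slab_restrict[OF w0(1)] wchain_slab_restrict[OF w0(2)] unfolding Iv w_def[abs_def]
    by (auto simp: indicator_def)
  have Lv: "L2loc v" and Lw: "L2loc w" using Suc.prems(1) w(2) wchain_L2loc by blast+
  have "wder (UNIV \<times> {- T / (2 * real k)<..<T + T / (2 * real k)}) e (refl_ext T k b v) (refl_ext T k ?b w)"
    by (rule wder_refl_ext[OF Lv Lw w(1) Suc.prems(2) w(3) T k]) (use e Suc.prems(3)[of 0] in auto)
  moreover have "wchain (UNIV \<times> {- T / (2 * real k)<..<T + T / (2 * real k)}) e n (refl_ext T k ?b w)"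
  proof (rule Suc.IH[OF w(2,3)])
    fix i assume i: "i < n"
    show "(\<Sum>j\<in>{1..k}. ?b j * (- refl_rate j) ^ i) = 1"
      using Suc.prems(3)[of i] Suc.prems(3)[of "Suc i"] i by (cases "snd e = 0") (simp_all add: mult.assoc)
  qed
  ultimately show ?case using L2loc_refl_ext[OF Lv] by auto
qed

section \<open>Cutoff and the compactly supported extension\<close>

lemma L2loc_AE_cong:
  assumes "L2loc v" "v' \<in> borel_measurable borel" "AE z in lborel. v z = v' z"
  shows "L2loc v'"
  unfolding L2loc_def
proof (intro conjI allI impI)
  fix C :: "'a set" assume C: "compact C"
  then have [measurable]: "C \<in> sets borel" by (rule borel_compact)
  have [measurable]: "v \<in> borel_measurable borel" "v' \<in> borel_measurable borel" using assms by (auto simp: L2loc_def)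
  have "integrable lborel (\<lambda>z. indicator C z * (v z)\<^sup>2)" using assms C by (simp add: L2loc_def)
  then show "integrable lborel (\<lambda>z. indicator C z * (v' z)\<^sup>2)"
    by (rule Bochner_Integration.integrable_cong_AE_imp) (use assms(3) in \<open>auto elim: eventually_mono\<close>)
qed (use assms in auto)

text \<open>Chains are tested through integrals only; this permits passing to a continuous
  representative.\<close>

lemma schain_AE_cong:
  assumes v: "schain C e n v" and v': "v' \<in> borel_measurable borel" "AE z in lborel. v z = v' z"
    and 0: "\<And>z. z \<notin> C \<Longrightarrow> v' z = 0"
  shows "schain C e n v'"
proof -
  have L: "L2loc v" "L2loc v'" using v schain_supp L2loc_AE_cong[OF _ v'] by blast+
  have [measurable]: "v \<in> borel_measurable borel" using L by (simp add: L2loc_def)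
  note v'(1)[measurable]
  have "(\<integral>z. v z * dderiv \<phi> e z \<partial>lborel) = (\<integral>z. v' z * dderiv \<phi> e z \<partial>lborel)" if "smooth \<phi>" for \<phi>
  proof -
    have [measurable]: "dderiv \<phi> e \<in> borel_measurable borel" using smooth_dderiv[OF that] smooth_measurable by blast
    show ?thesis by (rule integral_cong_AE) (use v'(2) in \<open>auto elim: eventually_mono\<close>)
  qed
  then show ?thesis using v L 0 by (cases n) auto
qed

lemma slab_cutoff:
  fixes R \<delta> T :: real
  assumes "R > 0" "\<delta> > 0" "T > 0"
  obtains \<eta> :: "'b::euclidean_space \<times> real \<Rightarrow> real" where "smooth \<eta>"
    "\<And>z. z \<notin> cball 0 (R + 1) \<times> {- \<delta> / 2..T + \<delta> / 2} \<Longrightarrow> \<eta> z = 0"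
    "\<And>z. z \<in> cball 0 R \<times> {0..T} \<Longrightarrow> \<eta> z = 1"
proof
  \<comment> \<open>The squared norm is a polynomial, hence smooth where the norm is not. R^2 + 1 -
    |x|^2 is at least 1 for |x| \<le> R and at most 0 for |x| \<ge> R + 1.\<close>
  define \<eta> :: "'b \<times> real \<Rightarrow> real" where "\<eta> z = smooth_step (R\<^sup>2 + 1 + (-1) * (\<Sum>i\<in>Basis. (fst z \<bullet> i) * (fst z \<bullet> i))) *
    (smooth_step (1 + 2 / \<delta> * snd z) * smooth_step (1 + 2 / \<delta> * T + (- 2 / \<delta>) * snd z))" for z
  have n: "(\<Sum>i\<in>Basis. (fst z \<bullet> i) * (fst z \<bullet> i)) = (norm (fst z))\<^sup>2" for z :: "'b \<times> real"
    by (metis euclidean_inner power2_norm_eq_inner)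
  show "smooth \<eta>" unfolding \<eta>_def[abs_def]
    by (intro smooth_mult smooth_compose[OF smooth_smooth_step] smooth_add smooth_const smooth_sum smooth_linear
        bounded_linear_intros finite_Basis)
  show "\<eta> z = 0" if "z \<notin> cball 0 (R + 1) \<times> {- \<delta> / 2..T + \<delta> / 2}" for z
  proof -
    have "norm (fst z) > R + 1 \<or> snd z < - \<delta> / 2 \<or> snd z > T + \<delta> / 2"
      using that by (auto simp: mem_Times_iff)
    then consider "norm (fst z) > R + 1" | "snd z < - \<delta> / 2" | "snd z > T + \<delta> / 2"
      by blast
    then show ?thesis
    proof cases
      case 1
      have "(R + 1)\<^sup>2 \<le> (norm (fst z))\<^sup>2" using 1 assms by (intro power_mono) auto
      then have "R\<^sup>2 + 1 + (-1) * (norm (fst z))\<^sup>2 \<le> 0" using assms by (simp add: power2_sum)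
      then show ?thesis unfolding \<eta>_def n by (simp add: smooth_step_0)
    next
      case 2
      then have "1 + 2 / \<delta> * snd z \<le> 0" using assms by (simp add: field_simps)
      then show ?thesis unfolding \<eta>_def by (simp add: smooth_step_0)
    next
      case 3
      then have "2 / \<delta> * (\<delta> / 2 + T - snd z) \<le> 0" using assms by (intro mult_nonneg_nonpos) auto
      moreover have "2 / \<delta> * (\<delta> / 2 + T - snd z) = 1 + 2 / \<delta> * T + (- 2 / \<delta>) * snd z"
        using assms by (simp add: field_simps)
      ultimately have "1 + 2 / \<delta> * T + (- 2 / \<delta>) * snd z \<le> 0" by simp
      then show ?thesis unfolding \<eta>_def by (simp only: smooth_step_0 mult_zero_right)
    qed
  qed
  show "\<eta> z = 1" if "z \<in> cball 0 R \<times> {0..T}" for z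
  proof -
    have "norm (fst z) \<le> R" "0 \<le> snd z" "snd z \<le> T" using that by (cases z, auto)+
    then have "(norm (fst z))\<^sup>2 \<le> R\<^sup>2" by (intro power_mono) auto
    then have "smooth_step (R\<^sup>2 + 1 + (-1) * (norm (fst z))\<^sup>2) = 1"
      by (intro smooth_step_1) auto
    moreover have "smooth_step (1 + 2 / \<delta> * snd z) = 1"
      using assms \<open>0 \<le> snd z\<close> by (intro smooth_step_1) auto
    moreover have "smooth_step (1 + 2 / \<delta> * T + (- 2 / \<delta>) * snd z) = 1"
      using assms \<open>snd z \<le> T\<close> by (intro smooth_step_1) (auto simp: field_simps)
    ultimately show ?thesis unfolding \<eta>_def n by simp
  qed
qed

text \<open>The sum defining \<open>refl_ext\<close> counts the slices t = 0 and t = T twice, so it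
  is in general discontinuous there. F is built from the piecewise formula V instead, which is
  continuous on U as the coefficients sum to 1 and agrees with the sum there off null slices.
  Continuity of F is what allows uniform approximation by its Fourier series.\<close>

theorem compactly_supported_extension:
  fixes u :: "(real^'d::finite) \<times> real \<Rightarrow> real"
  assumes u: "Hk_loc_scalar k T u" and k: "k \<ge> 1" and T: "T > 0" and R: "R > 0"
    and cont: "continuous_on (UNIV \<times> {0..T}) u"
  obtains F C where "compact C" "continuous_on UNIV F" "\<And>e. e \<in> Basis \<Longrightarrow> schain C e k F"
    "\<And>z. z \<in> cball 0 R \<times> {0..T} \<Longrightarrow> F z = u z"
proof -
  \<comment> \<open>Width of the collar around the time interval whose points reflect back into the
    interval, the rates being at most 2 k.\<close>
  define \<delta> where "\<delta> = T / (2 * real k)"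
  have \<delta>: "\<delta> > 0" using T k by (simp add: \<delta>_def)
  obtain \<eta> :: "(real^'d) \<times> real \<Rightarrow> real" where \<eta>: "smooth \<eta>"
    "\<And>z. z \<notin> cball 0 (R + 1) \<times> {- \<delta> / 2..T + \<delta> / 2} \<Longrightarrow> \<eta> z = 0"
    "\<And>z. z \<in> cball 0 R \<times> {0..T} \<Longrightarrow> \<eta> z = 1"
    using slab_cutoff[OF R \<delta> T] by metis
  define C where "C = (cball 0 (R + 1) :: (real^'d) set) \<times> {- \<delta> / 2..T + \<delta> / 2}"
  define U where "U = (UNIV :: (real^'d) set) \<times> {- \<delta><..<T + \<delta>}"
  have C: "compact C" unfolding C_def by (intro compact_Times) auto
  have CU: "C \<subseteq> U" unfolding C_def U_def using \<delta> by auto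
  have t\<eta>: "test_fun U \<eta>" unfolding test_fun_iff using \<eta> C CU C_def by blast
  define b where "b = refl_coeff k"
  define v where "v z = indicator (UNIV \<times> {0..T}) z * u z" for z
  define left where "left z = (\<Sum>j\<in>{1..k}. b j * u (fst z, - refl_rate j * snd z))" for z
  define right where "right z = (\<Sum>j\<in>{1..k}. b j * u (fst z, T * (1 + refl_rate j) - refl_rate j * snd z))" for z
  define V where "V z = (if snd z \<le> 0 then left z else if snd z \<le> T then u z else right z)" for z
  have b1: "(\<Sum>j\<in>{1..k}. b j) = 1"
    using refl_coeff_moments[of 0 k] k by (simp add: b_def)
  have rr: "refl_rate j * \<delta> \<le> T" "0 < refl_rate j" if "j \<in> {1..k}" for j
  proof -
    have "1 \<le> refl_rate j \<and> refl_rate j \<le> 2 * real k" by (rule refl_rate_bounds[OF that])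
    then show "refl_rate j * \<delta> \<le> T" "0 < refl_rate j"
      using T k by (auto simp: \<delta>_def field_simps)
  qed
  have le: "refl_rate j * s \<le> T" if "j \<in> {1..k}" "s \<le> \<delta>" for j s
    using mult_left_mono[OF that(2), of "refl_rate j"] rr[OF that(1)] by linarith
  have cV: "continuous_on U V"
    unfolding V_def[abs_def]
  proof (intro continuous_on_cases_le)
    have "- refl_rate j * snd z \<in> {0..T}" if "j \<in> {1..k}" "z \<in> U" "snd z \<le> 0" for j z
      using that rr[OF that(1)] le[OF that(1), of "- snd z"] by (auto simp: U_def mult_nonneg_nonpos)
    then show "continuous_on {z \<in> U. snd z \<le> 0} left"
      unfolding left_def[abs_def]
      by (intro continuous_intros continuous_on_compose2[OF cont]) auto
    show "continuous_on {t \<in> {z \<in> U. 0 \<le> snd z}. snd t \<le> T} u"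
      by (rule continuous_on_subset[OF cont]) (auto simp: U_def)
    have "T * (1 + refl_rate j) - refl_rate j * snd z \<in> {0..T}" if "j \<in> {1..k}" "z \<in> U" "T \<le> snd z" for j z
    proof -
      have "refl_rate j * (snd z - T) \<le> T" "0 \<le> refl_rate j * (snd z - T)"
        using that rr[OF that(1)] le[OF that(1), of "snd z - T"] by (auto simp: U_def)
      then show ?thesis by (simp add: algebra_simps)
    qed
    then show "continuous_on {t \<in> {z \<in> U. 0 \<le> snd z}. T \<le> snd t} right"
      unfolding right_def[abs_def]
      by (intro continuous_intros continuous_on_compose2[OF cont]) auto
    fix z :: "(real^'d) \<times> real"
    show "u z = right z" if "snd z = T"
      using that b1 by (cases z) (simp add: right_def algebra_simps sum_distrib_right[symmetric])
    show "left z = (if snd z \<le> T then u z else right z)" if "snd z = 0"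
      using that b1 T by (cases z) (simp add: left_def sum_distrib_right[symmetric])
  qed (intro continuous_intros)+
  define F where "F z = \<eta> z * V z" for z
  have oU: "open U" unfolding U_def by (intro open_Times) auto
  have F0: "F z = 0" if "z \<notin> C" for z using \<eta>(2) that by (simp add: F_def C_def)
  have "continuous_on (U \<union> - C) F"
  proof (rule continuous_on_open_Un[OF oU])
    show "open (- C)" using C compact_imp_closed by blast
    show "continuous_on U F" unfolding F_def[abs_def] by (intro continuous_intros cV smooth_continuous_on \<eta>)
    have "continuous_on (- C) (\<lambda>_. 0 :: real)" by simp
    then show "continuous_on (- C) F" by (rule continuous_on_eq) (simp add: F0)
  qed
  moreover have "U \<union> - C = UNIV" using CU by blast
  ultimately have cF: "continuous_on UNIV F" by simp
  have "schain C e k F" if e: "e \<in> Basis" for e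
  proof -
    have e': "snd e = 0 \<or> e = (0, 1)" using e by (auto simp: Basis_prod_def)
    have vz: "v z = 0" if "snd z \<notin> {0..T}" for z using that by (auto simp: v_def indicator_def)
    have "wchain (slab T) e k v" unfolding v_def[abs_def] by (rule Hk_loc_scalar_wchain[OF u e])
    from wchain_refl_ext[OF T k e' this vz, of b]
    have "wchain U e k (refl_ext T k b v)"
      unfolding U_def \<delta>_def b_def using refl_coeff_moments[of _ k] by simp
    from wchain_cutoff[OF C this t\<eta>]
    have "schain C e k (\<lambda>z. \<eta> z * refl_ext T k b v z)" using \<eta>(2) by (simp add: C_def)
    then show ?thesis
    proof (rule schain_AE_cong)
      show "F \<in> borel_measurable borel" by (rule borel_measurable_continuous_onI[OF cF])
      show "AE z in lborel. \<eta> z * refl_ext T k b v z = F z"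
        using AE_lborel_snd_neq[of 0] AE_lborel_snd_neq[of T]
      proof eventually_elim
        case (elim z)
        show ?case
        proof (cases "z \<in> U")
          case True
          obtain x t where z: "z = (x, t)" by (cases z)
          have t: "t \<noteq> 0" "t \<noteq> T" "- \<delta> < t" "t < T + \<delta>" using elim True by (auto simp: z U_def)
          have ve: "v (x, s) = (if 0 \<le> s \<and> s \<le> T then u (x, s) else 0)" for s
            by (auto simp: v_def indicator_def)
          have expand: "refl_ext T k b v z = v (x, t) + (\<Sum>j\<in>{1..k}. b j * v (x, - refl_rate j * t))
             + (\<Sum>j\<in>{1..k}. b j * v (x, T * (1 + refl_rate j) - refl_rate j * t))"
            unfolding refl_ext_def sum.cartesian_product[symmetric]
            using T by (simp add: z time_affine_def sum.distrib)
          consider "t < 0" | "0 < t" "t < T" | "t > T" using t by linarith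
          then have "refl_ext T k b v z = V z"
          proof cases
            case 1
            have "v (x, - refl_rate j * t) = u (x, - refl_rate j * t)" if "j \<in> {1..k}" for j
              using 1 t le[OF that, of "-t"] rr[OF that] unfolding ve by (auto simp: mult_nonneg_nonpos)
            moreover have "v (x, T * (1 + refl_rate j) - refl_rate j * t) = 0" if "j \<in> {1..k}" for j
            proof -
              have "refl_rate j * t < refl_rate j * T" using 1 T rr[OF that] by (intro mult_strict_left_mono) auto
              then show ?thesis unfolding ve by (auto simp: algebra_simps)
            qed
            ultimately show ?thesis using 1 unfolding expand by (simp add: V_def left_def z ve)
          next
            case 2
            have "v (x, - refl_rate j * t) = 0" if "j \<in> {1..k}" for j
              using mult_pos_pos[OF rr(2)[OF that] 2(1)] unfolding ve by auto
            moreover have "v (x, T * (1 + refl_rate j) - refl_rate j * t) = 0" if "j \<in> {1..k}" for j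
            proof -
              have "refl_rate j * t < refl_rate j * T" using 2 T rr[OF that] by (intro mult_strict_left_mono) auto
              then show ?thesis unfolding ve by (auto simp: algebra_simps)
            qed
            ultimately show ?thesis using 2 unfolding expand by (simp add: V_def z ve)
          next
            case 3
            have "v (x, - refl_rate j * t) = 0" if "j \<in> {1..k}" for j
              using mult_pos_pos[OF rr(2)[OF that], of t] 3 T unfolding ve by auto
            moreover have "v (x, T * (1 + refl_rate j) - refl_rate j * t) = u (x, T * (1 + refl_rate j) - refl_rate j * t)" if "j \<in> {1..k}" for j
            proof -
              have "refl_rate j * T < refl_rate j * t" using 3 T rr[OF that] by (intro mult_strict_left_mono) auto
              moreover have "refl_rate j * (t - T) \<le> T" using le[OF that, of "t - T"] t by simp
              ultimately show ?thesis unfolding ve by (auto simp: algebra_simps)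
            qed
            ultimately show ?thesis using 3 T unfolding expand by (simp add: V_def right_def z ve)
          qed
          then show ?thesis by (simp add: F_def)
        next
          case False
          then have "z \<notin> C" using CU by blast
          then show ?thesis using F0 \<eta>(2) by (simp add: C_def)
        qed
      qed
    qed (rule F0)
  qed
  moreover have "F z = u z" if z: "z \<in> cball 0 R \<times> {0..T}" for z
  proof -
    have "left z = u z" if "snd z = 0"
      using that b1 by (cases z) (simp add: left_def sum_distrib_right[symmetric])
    then show ?thesis using z \<eta>(3)[OF z] by (cases z) (auto simp: F_def V_def)
  qed
  ultimately show ?thesis using that C cF by blast
qed

section \<open>Fourier series in several variables\<close>

definition lattice_pts :: "'a::euclidean_space set" where
  "lattice_pts = {m. \<forall>b\<in>Basis. m \<bullet> b \<in> \<int>}"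

text \<open>Period cell of side 2 S centred at the origin: waves with frequency pi/S times an
  integer vector are periodic with respect to it.\<close>

definition fbox :: "real \<Rightarrow> 'a::euclidean_space set" where
  "fbox S = cbox (- (S *\<^sub>R One)) (S *\<^sub>R One)"

lemma mem_fbox: "z \<in> fbox S \<longleftrightarrow> (\<forall>b\<in>Basis. - S \<le> z \<bullet> b \<and> z \<bullet> b \<le> S)"
  by (auto simp: fbox_def mem_box)

lemma lattice_pts_diff: "m \<in> lattice_pts \<Longrightarrow> n \<in> lattice_pts \<Longrightarrow> m - n \<in> lattice_pts"
  and lattice_pts_add: "m \<in> lattice_pts \<Longrightarrow> n \<in> lattice_pts \<Longrightarrow> m + n \<in> lattice_pts"
  and lattice_pts_uminus: "m \<in> lattice_pts \<Longrightarrow> - m \<in> lattice_pts"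
  and lattice_pts_0: "0 \<in> lattice_pts"
  by (auto simp: lattice_pts_def inner_diff_left inner_add_left)

lemma lattice_pts_Basis: "b \<in> Basis \<Longrightarrow> b \<in> lattice_pts"
  unfolding lattice_pts_def by (auto simp: inner_Basis)

section \<open>Orthogonality of the lattice waves\<close>

lemma integral_cis_period:
  assumes S: "S > 0" and n: "n \<in> \<int>"
  shows "(\<integral>s. indicator {-S..S} s *\<^sub>R cis (pi / S * (n * s)) \<partial>lborel) = (if n = 0 then of_real (2 * S) else 0)"
proof (cases "n = 0")
  case True
  then show ?thesis using S by (simp add: scaleR_conv_of_real)
next
  case False
  define c where "c = pi / S * n"
  have c: "c \<noteq> 0" using False S by (simp add: c_def)
  have "(\<integral>s. indicator {-S..S} s *\<^sub>R cis (c * s) \<partial>lborel) = cis (c * S) / (\<i> * c) - cis (c * (-S)) / (\<i> * c)"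
  proof (rule integral_FTC_atLeastAtMost)
    show "-S \<le> S" using S by simp
    have cis: "cis (c * x) = exp (\<i> * (c * x))" for x by (simp add: cis_conv_exp)
    show "((\<lambda>s. cis (c * s) / (\<i> * c)) has_vector_derivative cis (c * x)) (at x within {-S..S})" for x
    proof -
      have "((\<lambda>w. exp (\<i> * (c * w)) / (\<i> * c)) has_field_derivative exp (\<i> * (c * complex_of_real x))) (at (complex_of_real x))"
        using c by (auto intro!: derivative_eq_intros simp: mult.commute[of _ \<i>])
      from has_vector_derivative_real_field[OF this] show ?thesis unfolding cis by simp
    qed
    show "continuous_on {-S..S} (\<lambda>x. cis (c * x))"
      by (intro continuous_intros)
  qed
  also have "cis (c * S) = cis (c * (-S))"
  proof -
    obtain k :: int where k: "n = of_int k" using n by (auto elim: Ints_cases)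
    have "c * S = c * (-S) + 2 * pi * of_int k" using S by (simp add: c_def k field_simps)
    then have "sin (c * S) = sin (c * (-S)) \<and> cos (c * S) = cos (c * (-S))"
      using sin_cos_eq_iff by blast
    then show ?thesis by (simp add: complex_eq_iff)
  qed
  finally show ?thesis using False by (simp add: c_def ac_simps)
qed

lemma cis_sum: "finite I \<Longrightarrow> cis (\<Sum>i\<in>I. f i) = (\<Prod>i\<in>I. cis (f i))"
  by (induction rule: finite_induct) (simp_all add: cis_mult[symmetric])

lemma integral_lborel_prod:
  fixes f :: "'a::euclidean_space \<Rightarrow> real \<Rightarrow> complex"
  assumes "\<And>b. b \<in> Basis \<Longrightarrow> integrable lborel (f b)"
  shows "(\<integral>z. (\<Prod>b\<in>Basis. f b (z \<bullet> b)) \<partial>(lborel :: 'a measure)) = (\<Prod>b\<in>Basis. \<integral>x. f b x \<partial>lborel)"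
proof -
  interpret product_sigma_finite "\<lambda>_::'a. lborel :: real measure" by standard
  have [measurable]: "f b \<in> borel_measurable borel" if "b \<in> Basis" for b
    using borel_measurable_integrable[OF assms[OF that]] by simp
  have "(\<integral>z. (\<Prod>b\<in>Basis. f b (z \<bullet> b)) \<partial>(lborel :: 'a measure))
     = (\<integral>g. (\<Prod>b\<in>Basis. f b ((\<Sum>i\<in>Basis. g i *\<^sub>R i) \<bullet> b)) \<partial>(\<Pi>\<^sub>M b\<in>(Basis::'a set). lborel))"
    by (subst lborel_eq, subst integral_distr) (auto intro!: borel_measurable_sum borel_measurable_prod)
  also have "\<dots> = (\<integral>g. (\<Prod>b\<in>Basis. f b (g b)) \<partial>(\<Pi>\<^sub>M b\<in>(Basis::'a set). lborel))"
    by (simp add: inner_sum_left_Basis cong: prod.cong)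
  also have "\<dots> = (\<Prod>b\<in>Basis. \<integral>x. f b x \<partial>lborel)"
    by (rule product_integral_prod) (auto intro: assms)
  finally show ?thesis .
qed

abbreviation fcos :: "real \<Rightarrow> 'a::euclidean_space \<Rightarrow> 'a \<Rightarrow> real" where
  "fcos S m z \<equiv> cos (pi / S * (m \<bullet> z))"

abbreviation fsin :: "real \<Rightarrow> 'a::euclidean_space \<Rightarrow> 'a \<Rightarrow> real" where
  "fsin S m z \<equiv> sin (pi / S * (m \<bullet> z))"

lemma continuous_fcos: "continuous_on A (fcos S m)" and continuous_fsin: "continuous_on A (fsin S m)"
  by (intro continuous_intros)+

text \<open>The complex exponential factors over the coordinates, unlike cosine and sine; the
  integral is a product of one-dimensional ones, one of which vanishes unless m = 0. The real
  integrals are its real and imaginary parts.\<close>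

lemma integral_fbox_cis:
  fixes m :: "'a::euclidean_space"
  assumes S: "S > 0" and m: "m \<in> lattice_pts"
  shows "(\<integral>z. indicator (fbox S) z *\<^sub>R cis (pi / S * (m \<bullet> z)) \<partial>lborel) = (if m = 0 then of_real ((2 * S) ^ DIM('a)) else 0)"
proof -
  let ?f = "\<lambda>b s. indicator {-S..S} s *\<^sub>R cis (pi / S * ((m \<bullet> b) * s)) :: complex"
  have eq: "indicator (fbox S) z *\<^sub>R cis (pi / S * (m \<bullet> z)) = (\<Prod>b\<in>Basis. ?f b (z \<bullet> b))" for z
  proof -
    have "pi / S * (m \<bullet> z) = (\<Sum>b\<in>Basis. pi / S * ((m \<bullet> b) * (z \<bullet> b)))"
      by (subst euclidean_inner) (simp add: sum_distrib_left)
    then have 1: "cis (pi / S * (m \<bullet> z)) = (\<Prod>b\<in>Basis. cis (pi / S * ((m \<bullet> b) * (z \<bullet> b))))"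
      by (simp only: cis_sum finite_Basis)
    show ?thesis
    proof (cases "z \<in> fbox S")
      case True
      then show ?thesis unfolding 1 by (simp add: mem_fbox cong: prod.cong)
    next
      case False
      then obtain b where "b \<in> Basis" "z \<bullet> b \<notin> {-S..S}" by (auto simp: mem_fbox)
      then have "(\<Prod>b\<in>Basis. ?f b (z \<bullet> b)) = 0" 
        by (intro prod_zero bexI[of _ b]) (auto simp: indicator_def)
      then show ?thesis using False by simp
    qed
  qed
  have i: "integrable lborel (?f b)" for b
    by (rule borel_integrable_compact) (use S in \<open>auto intro!: continuous_intros\<close>)
  have "(\<integral>z. indicator (fbox S) z *\<^sub>R cis (pi / S * (m \<bullet> z)) \<partial>lborel) = (\<Prod>b\<in>Basis. \<integral>x. ?f b x \<partial>lborel)"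
    unfolding eq by (rule integral_lborel_prod[OF i])
  also have "\<dots> = (\<Prod>b\<in>Basis. if m \<bullet> b = 0 then of_real (2 * S) else 0)"
    by (intro prod.cong refl integral_cis_period S) (use m in \<open>auto simp: lattice_pts_def\<close>)
  also have "\<dots> = (if m = 0 then of_real ((2 * S) ^ DIM('a)) else 0)"
  proof (cases "m = 0")
    case False
    then obtain b where "b \<in> Basis" "m \<bullet> b \<noteq> 0" using euclidean_all_zero_iff by blast
    then have "(\<Prod>b\<in>Basis. if m \<bullet> b = 0 then of_real (2 * S) else 0 :: complex) = 0"
      by (intro prod_zero bexI[of _ b]) auto
    then show ?thesis using False by simp
  qed simp
  finally show ?thesis .
qed

lemma integrable_fbox:
  fixes f :: "'a::euclidean_space \<Rightarrow> real"
  assumes "continuous_on UNIV f"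
  shows "integrable lborel (\<lambda>z. indicator (fbox S) z * f z)"
  using borel_integrable_compact[of "fbox S" f] assms continuous_on_subset[of UNIV f]
  by (auto simp: fbox_def)

lemma integral_fbox_eq:
  fixes f :: "'a::euclidean_space \<Rightarrow> real"
  assumes "continuous_on UNIV f"
  shows "integral (fbox S) f = (\<integral>z. indicator (fbox S) z * f z \<partial>lborel)"
  using set_borel_integral_eq_integral(2)[of "fbox S" f] integrable_fbox[OF assms]
  by (simp add: set_integrable_def set_lebesgue_integral_def)

lemma integral_fbox_trig:
  fixes m :: "'a::euclidean_space"
  assumes S: "S > 0" and m: "m \<in> lattice_pts"
  shows "integral (fbox S) (fcos S m) = (if m = 0 then (2 * S) ^ DIM('a) else 0)"
    and "integral (fbox S) (fsin S m) = 0"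
proof -
  have i: "integrable lborel (\<lambda>z. indicator (fbox S) z *\<^sub>R cis (pi / S * (m \<bullet> z)))"
    unfolding fbox_def by (rule borel_integrable_compact) (use S in \<open>auto intro!: continuous_intros\<close>)
  note c = integral_fbox_cis[OF S m]
  have "integral (fbox S) (fcos S m) = Re (\<integral>z. indicator (fbox S) z *\<^sub>R cis (pi / S * (m \<bullet> z)) \<partial>lborel)"
    by (subst integral_fbox_eq[OF continuous_fcos], subst integral_Re[OF i, symmetric]) simp
  then show "integral (fbox S) (fcos S m) = (if m = 0 then (2 * S) ^ DIM('a) else 0)"
    unfolding c by simp
  have "integral (fbox S) (fsin S m) = Im (\<integral>z. indicator (fbox S) z *\<^sub>R cis (pi / S * (m \<bullet> z)) \<partial>lborel)"
    by (subst integral_fbox_eq[OF continuous_fsin], subst integral_Im[OF i, symmetric]) simp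
  then show "integral (fbox S) (fsin S m) = 0"
    unfolding c by simp
qed

lemma trig_products:
  "fcos S m z * fcos S n z = (fcos S (m - n) z + fcos S (m + n) z) / 2"
  "fsin S m z * fsin S n z = (fcos S (m - n) z - fcos S (m + n) z) / 2"
  "fsin S m z * fcos S n z = (fsin S (m + n) z + fsin S (m - n) z) / 2"
proof -
  have "pi / S * ((m - n) \<bullet> z) = pi / S * (m \<bullet> z) - pi / S * (n \<bullet> z)"
    "pi / S * ((m + n) \<bullet> z) = pi / S * (m \<bullet> z) + pi / S * (n \<bullet> z)"
    by (simp_all only: inner_diff_left inner_add_left right_diff_distrib distrib_left)
  note e = this
  show "fcos S m z * fcos S n z = (fcos S (m - n) z + fcos S (m + n) z) / 2"
    "fsin S m z * fsin S n z = (fcos S (m - n) z - fcos S (m + n) z) / 2"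
    "fsin S m z * fcos S n z = (fsin S (m + n) z + fsin S (m - n) z) / 2"
    unfolding e by (simp_all only: cos_diff cos_add sin_diff sin_add) simp_all
qed

lemma integral_linear_combination:
  fixes f g :: "'i \<Rightarrow> 'a::euclidean_space \<Rightarrow> real"
  assumes "finite A" "\<And>m. m \<in> A \<Longrightarrow> f m integrable_on Q" "\<And>m. m \<in> A \<Longrightarrow> g m integrable_on Q"
  shows "integral Q (\<lambda>z. \<Sum>m\<in>A. a m * f m z + b m * g m z) = (\<Sum>m\<in>A. a m * integral Q (f m) + b m * integral Q (g m))"
  by (intro integral_unique has_integral_sum has_integral_add has_integral_mult_right integrable_integral assms)

lemma integrable_fbox_HK: "continuous_on UNIV f \<Longrightarrow> f integrable_on fbox S" for f :: "'a::euclidean_space \<Rightarrow> real"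
  unfolding fbox_def by (rule integrable_continuous) (rule continuous_on_subset, auto)

text \<open>Product-to-sum formulas reduce to the frequencies m - n and m + n. As frequencies run
  over the whole lattice, m and -m carry the same waves up to sign, which is the source of the terms
  with n = -m.\<close>

lemma trig_orthogonality:
  fixes m n :: "'a::euclidean_space"
  assumes S: "S > 0" and m: "m \<in> lattice_pts" "n \<in> lattice_pts"
  defines "V \<equiv> (2 * S) ^ DIM('a)"
  shows "integral (fbox S) (\<lambda>z. fcos S m z * fcos S n z) = V / 2 * ((if n = m then 1 else 0) + (if n = - m then 1 else 0))"
    and "integral (fbox S) (\<lambda>z. fsin S m z * fsin S n z) = V / 2 * ((if n = m then 1 else 0) - (if n = - m then 1 else 0))"
    and "integral (fbox S) (\<lambda>z. fsin S m z * fcos S n z) = 0"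
    and "integral (fbox S) (\<lambda>z. fcos S m z * fsin S n z) = 0"
proof -
  have L: "m - n \<in> lattice_pts" "m + n \<in> lattice_pts" "n + m \<in> lattice_pts" "n - m \<in> lattice_pts" using m lattice_pts_diff lattice_pts_add by auto
  have eq: "m - n = 0 \<longleftrightarrow> n = m" "m + n = 0 \<longleftrightarrow> n = - m"
    by (auto simp: eq_neg_iff_add_eq_0 add.commute)
  note ii = integrable_fbox_HK[OF continuous_fcos] integrable_fbox_HK[OF continuous_fsin]
  note vals = integral_fbox_trig[OF S L(1)] integral_fbox_trig[OF S L(2)] integral_fbox_trig[OF S L(3)] integral_fbox_trig[OF S L(4)]
  show "integral (fbox S) (\<lambda>z. fcos S m z * fcos S n z) = V / 2 * ((if n = m then 1 else 0) + (if n = - m then 1 else 0))"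
    unfolding trig_products using vals(1,3) by (simp only: integral_divide integral_add[OF ii(1) ii(1)] eq V_def) auto
  show "integral (fbox S) (\<lambda>z. fsin S m z * fsin S n z) = V / 2 * ((if n = m then 1 else 0) - (if n = - m then 1 else 0))"
    unfolding trig_products using vals(1,3) by (simp only: integral_divide integral_diff[OF ii(1) ii(1)] eq V_def) auto
  show "integral (fbox S) (\<lambda>z. fsin S m z * fcos S n z) = 0"
    unfolding trig_products using vals by (simp only: integral_divide integral_add[OF ii(2) ii(2)]) simp
  have "(\<lambda>z. fcos S m z * fsin S n z) = (\<lambda>z. fsin S n z * fcos S m z)" by (simp add: mult.commute)
  then show "integral (fbox S) (\<lambda>z. fcos S m z * fsin S n z) = 0"
    unfolding trig_products using vals by (simp only: integral_divide integral_add[OF ii(2) ii(2)] trig_products) simp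
qed

definition trig_sum :: "real \<Rightarrow> ('a::euclidean_space \<Rightarrow> real) \<Rightarrow> ('a \<Rightarrow> real) \<Rightarrow> 'a set \<Rightarrow> 'a \<Rightarrow> real" where
  "trig_sum S a b A z = (\<Sum>m\<in>A. a m * fcos S m z + b m * fsin S m z)"

lemma continuous_trig_sum: "continuous_on X (trig_sum S a b A)"
  unfolding trig_sum_def[abs_def] by (intro continuous_intros)

lemma integral_trig_sum_mult:
  fixes n :: "'a::euclidean_space"
  assumes S: "S > 0" and A: "finite A" "A \<subseteq> lattice_pts" and n: "n \<in> lattice_pts"
  defines "V \<equiv> (2 * S) ^ DIM('a)"
  shows "integral (fbox S) (\<lambda>z. trig_sum S a b A z * fcos S n z) = V / 2 * ((if n \<in> A then a n else 0) + (if - n \<in> A then a (- n) else 0))"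
    and "integral (fbox S) (\<lambda>z. trig_sum S a b A z * fsin S n z) = V / 2 * ((if n \<in> A then b n else 0) - (if - n \<in> A then b (- n) else 0))"
proof -
  have ic: "(\<lambda>z. fcos S m z * fcos S n z) integrable_on fbox S" "(\<lambda>z. fsin S m z * fcos S n z) integrable_on fbox S"
     "(\<lambda>z. fcos S m z * fsin S n z) integrable_on fbox S" "(\<lambda>z. fsin S m z * fsin S n z) integrable_on fbox S" for m
    by (intro integrable_fbox_HK continuous_intros)+
  have neg: "n = - m \<longleftrightarrow> m = - n" for m by auto
  have "integral (fbox S) (\<lambda>z. trig_sum S a b A z * fcos S n z) = integral (fbox S) (\<lambda>z. \<Sum>m\<in>A. a m * (fcos S m z * fcos S n z) + b m * (fsin S m z * fcos S n z))"
    by (simp add: trig_sum_def sum_distrib_right distrib_right mult.assoc)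
  also have "\<dots> = (\<Sum>m\<in>A. a m * integral (fbox S) (\<lambda>z. fcos S m z * fcos S n z) + b m * integral (fbox S) (\<lambda>z. fsin S m z * fcos S n z))"
    by (rule integral_linear_combination[OF A(1)]) (rule ic)+
  also have "\<dots> = (\<Sum>m\<in>A. (if m = n then a m * (V / 2) else 0) + (if m = - n then a m * (V / 2) else 0))"
  proof (intro sum.cong refl)
    fix m assume "m \<in> A"
    then have mL: "m \<in> lattice_pts" using A by auto
    show "a m * integral (fbox S) (\<lambda>z. fcos S m z * fcos S n z) + b m * integral (fbox S) (\<lambda>z. fsin S m z * fcos S n z) = (if m = n then a m * (V / 2) else 0) + (if m = - n then a m * (V / 2) else 0)"
      unfolding trig_orthogonality[OF S mL n] neg V_def by auto
  qed
  also have "\<dots> = V / 2 * ((if n \<in> A then a n else 0) + (if - n \<in> A then a (- n) else 0))"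
    using A by (simp add: sum.distrib sum.delta algebra_simps)
  finally show "integral (fbox S) (\<lambda>z. trig_sum S a b A z * fcos S n z) = V / 2 * ((if n \<in> A then a n else 0) + (if - n \<in> A then a (- n) else 0))" .
  have "integral (fbox S) (\<lambda>z. trig_sum S a b A z * fsin S n z) = integral (fbox S) (\<lambda>z. \<Sum>m\<in>A. a m * (fcos S m z * fsin S n z) + b m * (fsin S m z * fsin S n z))"
    by (simp add: trig_sum_def sum_distrib_right distrib_right mult.assoc)
  also have "\<dots> = (\<Sum>m\<in>A. a m * integral (fbox S) (\<lambda>z. fcos S m z * fsin S n z) + b m * integral (fbox S) (\<lambda>z. fsin S m z * fsin S n z))"
    by (rule integral_linear_combination[OF A(1)]) (rule ic)+
  also have "\<dots> = (\<Sum>m\<in>A. (if m = n then b m * (V / 2) else 0) - (if m = - n then b m * (V / 2) else 0))"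
  proof (intro sum.cong refl)
    fix m assume "m \<in> A"
    then have mL: "m \<in> lattice_pts" using A by auto
    show "a m * integral (fbox S) (\<lambda>z. fcos S m z * fsin S n z) + b m * integral (fbox S) (\<lambda>z. fsin S m z * fsin S n z) = (if m = n then b m * (V / 2) else 0) - (if m = - n then b m * (V / 2) else 0)"
      unfolding trig_orthogonality[OF S mL n] neg V_def by auto
  qed
  also have "\<dots> = V / 2 * ((if n \<in> A then b n else 0) - (if - n \<in> A then b (- n) else 0))"
    using A by (simp add: sum_subtractf sum.delta algebra_simps)
  finally show "integral (fbox S) (\<lambda>z. trig_sum S a b A z * fsin S n z) = V / 2 * ((if n \<in> A then b n else 0) - (if - n \<in> A then b (- n) else 0))" .
qed

section \<open>Fourier coefficients and Bessel's inequality\<close>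

definition cos_coeff :: "real \<Rightarrow> ('a::euclidean_space \<Rightarrow> real) \<Rightarrow> 'a \<Rightarrow> real" where
  "cos_coeff S g m = (\<integral>z. g z * fcos S m z \<partial>lborel)"

definition sin_coeff :: "real \<Rightarrow> ('a::euclidean_space \<Rightarrow> real) \<Rightarrow> 'a \<Rightarrow> real" where
  "sin_coeff S g m = (\<integral>z. g z * fsin S m z \<partial>lborel)"

lemma coeff_uminus: "cos_coeff S g (- m) = cos_coeff S g m" "sin_coeff S g (- m) = - sin_coeff S g m"
  by (simp_all add: cos_coeff_def sin_coeff_def)

text \<open>Expansion of the square of V g - p over the cell, with p the wave sum whose coefficients
  are the unnormalised ones of g. The waves of A need not be orthogonal since A may contain m and
  -m, but by parity of the coefficients this at most doubles the diagonal value V E / 2, where E is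
  the left-hand side.\<close>

lemma bessel:
  fixes g :: "'a::euclidean_space \<Rightarrow> real"
  assumes S: "S > 0" and A: "finite A" "A \<subseteq> lattice_pts" and g: "L2loc g" "\<And>z. z \<notin> fbox S \<Longrightarrow> g z = 0"
  shows "(\<Sum>m\<in>A. (cos_coeff S g m)\<^sup>2 + (sin_coeff S g m)\<^sup>2) \<le> (2 * S) ^ DIM('a) * (\<integral>z. (g z)\<^sup>2 \<partial>lborel)"
proof -
  define V where "V = (2 * S) ^ DIM('a)"
  have V: "V > 0" using S by (simp add: V_def)
  define a where "a = cos_coeff S g" define b where "b = sin_coeff S g"
  define p where "p = trig_sum S a b A"
  define E where "E = (\<Sum>m\<in>A. (a m)\<^sup>2 + (b m)\<^sup>2)"
  have cp: "continuous_on UNIV p" unfolding p_def by (rule continuous_trig_sum)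
  have Qc: "compact (fbox S :: 'a set)" by (simp add: fbox_def)
  have ig: "integrable lborel (\<lambda>z. (g z)\<^sup>2)"
  proof -
    have "integrable lborel (\<lambda>z. indicator (fbox S) z * (g z)\<^sup>2)" using g Qc by (simp add: L2loc_def)
    moreover have "(\<lambda>z. indicator (fbox S) z * (g z)\<^sup>2) = (\<lambda>z. (g z)\<^sup>2)" using g(2) by (auto simp: indicator_def fun_eq_iff)
    ultimately show ?thesis by simp
  qed
  have igp: "integrable lborel (\<lambda>z. g z * f z)" if "continuous_on UNIV f" for f
    by (rule L2loc_integrable_compact_support[OF Qc g that])
  have ipp: "integrable lborel (\<lambda>z. indicator (fbox S) z * (p z * p z))"
    by (intro integrable_fbox continuous_intros cp)
  have gp: "(\<integral>z. g z * p z \<partial>lborel) = E"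
  proof -
    have "(\<integral>z. g z * p z \<partial>lborel) = (\<integral>z. (\<Sum>m\<in>A. a m * (g z * fcos S m z) + b m * (g z * fsin S m z)) \<partial>lborel)"
      by (simp add: p_def trig_sum_def sum_distrib_left distrib_left ac_simps)
    also have "\<dots> = (\<Sum>m\<in>A. a m * cos_coeff S g m + b m * sin_coeff S g m)"
      using igp[OF continuous_fcos] igp[OF continuous_fsin]
      by (subst Bochner_Integration.integral_sum) (auto simp: cos_coeff_def sin_coeff_def)
    finally show ?thesis by (simp add: E_def a_def b_def power2_eq_square)
  qed
  have pp: "(\<integral>z. indicator (fbox S) z * (p z * p z) \<partial>lborel) \<le> V * E"
  proof -
    have "(\<integral>z. indicator (fbox S) z * (p z * p z) \<partial>lborel) = integral (fbox S) (\<lambda>z. p z * p z)"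
      by (rule integral_fbox_eq[symmetric]) (intro continuous_intros cp)
    also have "\<dots> = integral (fbox S) (\<lambda>z. \<Sum>n\<in>A. a n * (p z * fcos S n z) + b n * (p z * fsin S n z))"
    proof -
      have "p z * p z = (\<Sum>n\<in>A. a n * (p z * fcos S n z) + b n * (p z * fsin S n z))" for z
      proof -
        have "p z * p z = p z * (\<Sum>m\<in>A. a m * fcos S m z + b m * fsin S m z)" by (simp add: p_def trig_sum_def)
        then show ?thesis by (simp add: sum_distrib_left distrib_left ac_simps)
      qed
      then show ?thesis by simp
    qed
    also have "\<dots> = (\<Sum>n\<in>A. a n * integral (fbox S) (\<lambda>z. p z * fcos S n z) + b n * integral (fbox S) (\<lambda>z. p z * fsin S n z))"
    proof -
      have "(\<lambda>z. p z * fcos S n z) integrable_on fbox S" "(\<lambda>z. p z * fsin S n z) integrable_on fbox S" for n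
        by (intro integrable_fbox_HK continuous_intros cp)+
      then show ?thesis by (intro integral_linear_combination A(1))
    qed
    also have "\<dots> \<le> (\<Sum>n\<in>A. V * ((a n)\<^sup>2 + (b n)\<^sup>2))"
    proof (rule sum_mono)
      fix n assume n: "n \<in> A"
      have nL: "n \<in> lattice_pts" using n A by auto
      have par: "a (- n) = a n" "b (- n) = - b n" by (simp_all add: a_def b_def coeff_uminus)
      have "a n * integral (fbox S) (\<lambda>z. p z * fcos S n z) + b n * integral (fbox S) (\<lambda>z. p z * fsin S n z)
        = V / 2 * (((a n)\<^sup>2 + (b n)\<^sup>2) * (1 + (if - n \<in> A then 1 else 0)))"
        unfolding p_def integral_trig_sum_mult[OF S A nL] using n par by (simp add: V_def power2_eq_square algebra_simps)
      also have "\<dots> \<le> V / 2 * (((a n)\<^sup>2 + (b n)\<^sup>2) * 2)"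
        using V by (intro mult_left_mono) auto
      also have "\<dots> = V * ((a n)\<^sup>2 + (b n)\<^sup>2)" by simp
      finally show "a n * integral (fbox S) (\<lambda>z. p z * fcos S n z) + b n * integral (fbox S) (\<lambda>z. p z * fsin S n z) \<le> V * ((a n)\<^sup>2 + (b n)\<^sup>2)" .
    qed
    finally show ?thesis by (simp add: E_def sum_distrib_left)
  qed
  have "0 \<le> (\<integral>z. indicator (fbox S) z * (V * g z - p z)\<^sup>2 \<partial>lborel)"
    by (intro Bochner_Integration.integral_nonneg) auto
  also have "\<dots> = (\<integral>z. V\<^sup>2 * (g z)\<^sup>2 - 2 * V * (g z * p z) + indicator (fbox S) z * (p z * p z) \<partial>lborel)"
    by (intro Bochner_Integration.integral_cong refl)
       (use g(2) in \<open>auto simp: indicator_def power2_eq_square algebra_simps\<close>)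
  also have "\<dots> = V\<^sup>2 * (\<integral>z. (g z)\<^sup>2 \<partial>lborel) - 2 * V * E + (\<integral>z. indicator (fbox S) z * (p z * p z) \<partial>lborel)"
    using ig igp[OF cp] ipp gp by simp
  also have "\<dots> \<le> V\<^sup>2 * (\<integral>z. (g z)\<^sup>2 \<partial>lborel) - 2 * V * E + V * E"
    using pp by (simp add: mult.commute)
  finally have "V * E \<le> V * (V * (\<integral>z. (g z)\<^sup>2 \<partial>lborel))"
    by (simp add: power2_eq_square ac_simps)
  then have "E \<le> V * (\<integral>z. (g z)\<^sup>2 \<partial>lborel)" using V by simp
  then show ?thesis by (simp add: E_def a_def b_def V_def)
qed

lemma smooth_trig: "smooth (fcos S m)" "smooth (fsin S m)"
  and dderiv_trig: "dderiv (fcos S m) e z = - (pi / S * (m \<bullet> e)) * fsin S m z"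
    "dderiv (fsin S m) e z = pi / S * (m \<bullet> e) * fcos S m z"
proof -
  have "bounded_linear (\<lambda>z. pi / S * (m \<bullet> z))"
    by (intro bounded_linear_intros)
  then have "smooth (\<lambda>z. pi / S * (m \<bullet> z))" by (rule smooth_linear)
  then show "smooth (fcos S m)" "smooth (fsin S m)"
    by (rule smooth_compose[OF smooth_cos], rule smooth_compose[OF smooth_sin])
  have "(fcos S m has_derivative (\<lambda>e. - (pi / S * (m \<bullet> e)) * fsin S m z)) (at z)"
    by (rule derivative_eq_intros refl)+ (auto simp: fun_eq_iff)
  then show "dderiv (fcos S m) e z = - (pi / S * (m \<bullet> e)) * fsin S m z" by (rule dderiv_eqI)
  have "(fsin S m has_derivative (\<lambda>e. pi / S * (m \<bullet> e) * fcos S m z)) (at z)"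
    by (rule derivative_eq_intros refl)+ (auto simp: fun_eq_iff)
  then show "dderiv (fsin S m) e z = pi / S * (m \<bullet> e) * fcos S m z" by (rule dderiv_eqI)
qed

text \<open>Testing against cosine and sine exchanges the two coefficients and multiplies them by
  the frequency, up to sign. The sum of squares is insensitive to the exchange, so it can be tracked
  through k steps.\<close>

lemma schain_coeffs:
  assumes "schain C e k F"
  obtains G where "L2loc G" "\<And>z. z \<notin> C \<Longrightarrow> G z = 0"
    "\<And>m. (cos_coeff S G m)\<^sup>2 + (sin_coeff S G m)\<^sup>2 = (pi / S * (m \<bullet> e)) ^ (2 * k) * ((cos_coeff S F m)\<^sup>2 + (sin_coeff S F m)\<^sup>2)"
  using assms
proof (induction k arbitrary: F thesis)
  case 0
  show ?case by (rule 0(1)[of F]) (use schain_supp[OF 0(2)] in auto)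
next
  case (Suc k)
  obtain w where w: "schain C e k w" "\<And>\<phi>. smooth \<phi> \<Longrightarrow>
       (\<integral>z. F z * dderiv \<phi> e z \<partial>lborel) = - (\<integral>z. w z * \<phi> z \<partial>lborel)"
    using Suc.prems(2) by auto
  obtain G where G: "L2loc G" "\<And>z. z \<notin> C \<Longrightarrow> G z = 0"
    "\<And>m. (cos_coeff S G m)\<^sup>2 + (sin_coeff S G m)\<^sup>2 = (pi / S * (m \<bullet> e)) ^ (2 * k) * ((cos_coeff S w m)\<^sup>2 + (sin_coeff S w m)\<^sup>2)"
    using Suc.IH[OF _ w(1)] by blast
  have "(cos_coeff S w m)\<^sup>2 + (sin_coeff S w m)\<^sup>2 = (pi / S * (m \<bullet> e))\<^sup>2 * ((cos_coeff S F m)\<^sup>2 + (sin_coeff S F m)\<^sup>2)" for m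
  proof -
    let ?c = "pi / S * (m \<bullet> e)"
    have "cos_coeff S w m = - (\<integral>z. F z * dderiv (fcos S m) e z \<partial>lborel)"
      using w(2)[OF smooth_trig(1)] by (simp add: cos_coeff_def)
    also have "(\<lambda>z. F z * dderiv (fcos S m) e z) = (\<lambda>z. (- ?c) * (F z * fsin S m z))"
      unfolding dderiv_trig by (simp add: fun_eq_iff ac_simps)
    finally have 1: "cos_coeff S w m = ?c * sin_coeff S F m"
      unfolding sin_coeff_def integral_mult_right_zero by simp
    have "sin_coeff S w m = - (\<integral>z. F z * dderiv (fsin S m) e z \<partial>lborel)"
      using w(2)[OF smooth_trig(2)] by (simp add: sin_coeff_def)
    also have "(\<lambda>z. F z * dderiv (fsin S m) e z) = (\<lambda>z. ?c * (F z * fcos S m z))"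
      unfolding dderiv_trig by (simp add: fun_eq_iff ac_simps)
    finally have 2: "sin_coeff S w m = - (?c * cos_coeff S F m)"
      unfolding cos_coeff_def integral_mult_right_zero by simp
    have "(?c * s)\<^sup>2 + (- (?c * t))\<^sup>2 = ?c\<^sup>2 * (t\<^sup>2 + s\<^sup>2)" for s t
      by (simp only: power_mult_distrib power2_minus distrib_left add.commute)
    then show ?thesis unfolding 1 2 .
  qed
  then have "(cos_coeff S G m)\<^sup>2 + (sin_coeff S G m)\<^sup>2 = (pi / S * (m \<bullet> e)) ^ (2 * Suc k) * ((cos_coeff S F m)\<^sup>2 + (sin_coeff S F m)\<^sup>2)" for m
    unfolding G(3) by (simp only: mult.assoc[symmetric] power_add[symmetric] mult_Suc_right add.commute)
  with G Suc.prems(1) show ?case by blast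
qed

section \<open>Lattice sums and weighted summability of the coefficients\<close>

lemma integer_powr_sum_bound:
  assumes p: "p > 1"
  obtains K :: real where "K \<ge> 0" "\<And>B. finite B \<Longrightarrow> B \<subseteq> \<int> \<Longrightarrow> (\<Sum>x\<in>B. (1 + \<bar>x\<bar>) powr (- p)) \<le> K"
proof -
  define g :: "nat \<Rightarrow> real" where "g n = real (Suc n) powr (- p)" for n
  have "summable (\<lambda>n. real n powr (- p))" using p by (simp add: summable_real_powr_iff)
  then have sg: "summable g" unfolding g_def[abs_def] by (subst summable_Suc_iff)
  \<comment> \<open>On integers of one sign the absolute value is injective, so the sum is part of a
    convergent p-series; the two signs account for the factor 2 below.\<close>
  have half: "(\<Sum>x\<in>B. (1 + \<bar>x\<bar>) powr (- p)) \<le> suminf g"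
    if "finite B" "B \<subseteq> \<int>" "inj_on (\<lambda>x. nat \<lfloor>\<bar>x\<bar>\<rfloor>) B" for B :: "real set"
  proof -
    have "(1 + \<bar>x\<bar>) powr (- p) = g (nat \<lfloor>\<bar>x\<bar>\<rfloor>)" if x: "x \<in> B" for x
    proof -
      have "x \<in> \<int>" using x \<open>B \<subseteq> \<int>\<close> by auto
      then obtain i :: int where "x = of_int i" by (auto elim: Ints_cases)
      then show ?thesis by (simp add: g_def add.commute)
    qed
    then have "(\<Sum>x\<in>B. (1 + \<bar>x\<bar>) powr (- p)) = (\<Sum>x\<in>B. g (nat \<lfloor>\<bar>x\<bar>\<rfloor>))"
      by (intro sum.cong) auto
    also have "\<dots> = (\<Sum>n\<in>(\<lambda>x. nat \<lfloor>\<bar>x\<bar>\<rfloor>) ` B. g n)"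
      by (simp add: sum.reindex[OF that(3)])
    also have "\<dots> \<le> suminf g" by (rule sum_le_suminf[OF sg]) (use that(1) in \<open>auto simp: g_def\<close>)
    finally show ?thesis .
  qed
  have "(\<Sum>x\<in>B. (1 + \<bar>x\<bar>) powr (- p)) \<le> 2 * suminf g" if B: "finite B" "B \<subseteq> \<int>" for B :: "real set"
  proof -
    have inj: "x = y" if "x \<in> \<int>" "y \<in> \<int>" "nat \<lfloor>\<bar>x\<bar>\<rfloor> = nat \<lfloor>\<bar>y\<bar>\<rfloor>" "x \<ge> 0 \<and> y \<ge> 0 \<or> x < 0 \<and> y < 0" for x y :: real
      using that by (auto elim!: Ints_cases)
    have "(\<Sum>x\<in>B. (1 + \<bar>x\<bar>) powr (- p)) = (\<Sum>x\<in>{x\<in>B. x \<ge> 0}. (1 + \<bar>x\<bar>) powr (- p)) + (\<Sum>x\<in>{x\<in>B. x < 0}. (1 + \<bar>x\<bar>) powr (- p))"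
      using B(1) by (subst sum.union_disjoint[symmetric]) (auto intro!: sum.cong)
    also have "\<dots> \<le> suminf g + suminf g"
    proof (intro add_mono half)
      show "inj_on (\<lambda>x. nat \<lfloor>\<bar>x\<bar>\<rfloor>) {x\<in>B. x \<ge> 0}" "inj_on (\<lambda>x. nat \<lfloor>\<bar>x\<bar>\<rfloor>) {x\<in>B. x < 0}"
        using B(2) by (intro inj_onI inj; force)+
    qed (use B in auto)
    finally show ?thesis by simp
  qed
  moreover have "suminf g \<ge> 0" by (rule suminf_nonneg[OF sg]) (simp add: g_def)
  ultimately show ?thesis using that[of "2 * suminf g"] by auto
qed

lemma lattice_sum_bound:
  obtains K :: real where "K \<ge> 0"
    "\<And>A. finite A \<Longrightarrow> A \<subseteq> (lattice_pts :: 'a::euclidean_space set) \<Longrightarrow> (\<Sum>m\<in>A. inverse ((1 + norm m) ^ (DIM('a) + 1))) \<le> K"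
proof -
  define N where "N = DIM('a)"
  \<comment> \<open>The exponent N + 1 is spread evenly over N coordinates, leaving p = (N + 1)/N >
    1 for each; the lattice sum is then dominated by a product of N convergent one-dimensional
    sums.\<close>
  define p where "p = 1 + 1 / real N"
  have N: "N > 0" by (simp add: N_def)
  then have p: "p > 1" by (simp add: p_def)
  obtain K :: real where K: "K \<ge> 0" "\<And>B. finite B \<Longrightarrow> B \<subseteq> \<int> \<Longrightarrow> (\<Sum>x\<in>B. (1 + \<bar>x\<bar>) powr (- p)) \<le> K"
    using integer_powr_sum_bound[OF p] by metis
  have "(\<Sum>m\<in>A. inverse ((1 + norm m) ^ (N + 1))) \<le> K ^ N" if A: "finite A" "A \<subseteq> (lattice_pts :: 'a set)" for A
  proof -
    define B where "B = (\<Union>b\<in>Basis. (\<lambda>m::'a. m \<bullet> b) ` A)"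
    have B: "finite B" "B \<subseteq> \<int>" using A by (auto simp: B_def lattice_pts_def)
    define h :: "'a \<Rightarrow> 'a \<Rightarrow> real" where "h m = (\<lambda>b\<in>Basis. m \<bullet> b)" for m
    have inj: "inj_on h A"
    proof (rule inj_onI)
      fix m n assume "h m = h n"
      then have "m \<bullet> b = n \<bullet> b" if "b \<in> Basis" for b using that by (auto simp: h_def restrict_def fun_eq_iff split: if_splits)
      then show "m = n" by (rule euclidean_eqI)
    qed
    have bound: "inverse ((1 + norm m) ^ (N + 1)) \<le> (\<Prod>b\<in>Basis. (1 + \<bar>m \<bullet> b\<bar>) powr (- p))" for m :: 'a
    proof -
      have "(\<Prod>b\<in>(Basis :: 'a set). (1 + norm m) powr (- p)) \<le> (\<Prod>b\<in>Basis. (1 + \<bar>m \<bullet> b\<bar>) powr (- p))"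
      proof (rule prod_mono, intro conjI)
        fix b :: 'a assume "b \<in> Basis"
        then have "\<bar>m \<bullet> b\<bar> \<le> norm m" by (rule Basis_le_norm)
        then show "(1 + norm m) powr (- p) \<le> (1 + \<bar>m \<bullet> b\<bar>) powr (- p)"
          using p by (intro powr_mono2') auto
      qed simp
      also have "(\<Prod>b\<in>(Basis :: 'a set). (1 + norm m) powr (- p)) = (1 + norm m) powr (- p * real N)"
        using norm_ge_zero[of m] by (simp add: N_def powr_powr powr_realpow[symmetric] del: norm_ge_zero) 
      also have "- p * real N = - real (N + 1)" using N by (simp add: p_def field_simps)
      also have "(1 + norm m) powr (- real (N + 1)) = inverse ((1 + norm m) ^ (N + 1))"
        using norm_ge_zero[of m] by (subst powr_minus, subst powr_realpow) (auto intro: add_pos_nonneg)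
      finally show ?thesis .
    qed
    have "(\<Sum>m\<in>A. inverse ((1 + norm m) ^ (N + 1))) \<le> (\<Sum>m\<in>A. \<Prod>b\<in>Basis. (1 + \<bar>h m b\<bar>) powr (- p))"
      using bound by (intro sum_mono) (simp add: h_def)
    also have "\<dots> = (\<Sum>f\<in>h ` A. \<Prod>b\<in>Basis. (1 + \<bar>f b\<bar>) powr (- p))"
      by (simp add: sum.reindex[OF inj])
    also have "\<dots> \<le> (\<Sum>f\<in>PiE (Basis :: 'a set) (\<lambda>_. B). \<Prod>b\<in>Basis. (1 + \<bar>f b\<bar>) powr (- p))"
    proof (rule sum_mono2)
      show "finite (PiE (Basis :: 'a set) (\<lambda>_. B))" using B by (intro finite_PiE) auto
      show "h ` A \<subseteq> PiE Basis (\<lambda>_. B)" by (auto simp: h_def B_def)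
    qed (auto intro: prod_nonneg)
    also have "\<dots> = (\<Prod>b\<in>(Basis :: 'a set). \<Sum>x\<in>B. (1 + \<bar>x\<bar>) powr (- p))"
      by (rule prod_sum_PiE[symmetric]) (use B in auto)
    also have "\<dots> \<le> K ^ N"
      using power_mono[OF K(2)[OF B], of N] by (simp add: N_def sum_nonneg)
    finally show ?thesis .
  qed
  then show ?thesis using that[of "K ^ N"] K by (auto simp: N_def)
qed

text \<open>With \<mu> the largest of 1 and the |m . b|, the left base is at most (DIM + 1) \<mu>,
  and \<mu>^(2k) is one of the summands on the right. This converts decay in each coordinate
  direction into decay in the norm.\<close>

lemma one_plus_norm_power_le:
  fixes m :: "'a::euclidean_space"
  shows "(1 + norm m) ^ (2 * k) \<le> real (DIM('a) + 1) ^ (2 * k) * (1 + (\<Sum>b\<in>Basis. (m \<bullet> b) ^ (2 * k)))"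
proof -
  define \<mu> where "\<mu> = Max (insert 1 ((\<lambda>b. \<bar>m \<bullet> b\<bar>) ` Basis))"
  have \<mu>: "1 \<le> \<mu>" "\<And>b. b \<in> Basis \<Longrightarrow> \<bar>m \<bullet> b\<bar> \<le> \<mu>"
    unfolding \<mu>_def by (rule Max_ge; simp)+
  have "\<mu> \<in> insert 1 ((\<lambda>b. \<bar>m \<bullet> b\<bar>) ` Basis)" unfolding \<mu>_def by (rule Max_in) auto
  then have "\<mu> ^ (2 * k) \<le> 1 + (\<Sum>b\<in>Basis. (m \<bullet> b) ^ (2 * k))"
  proof
    assume "\<mu> = 1"
    moreover have "0 \<le> (\<Sum>b\<in>Basis. (m \<bullet> b) ^ (2 * k))"
      by (intro sum_nonneg zero_le_even_power) auto
    ultimately show ?thesis by simp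
  next
    assume "\<mu> \<in> (\<lambda>b. \<bar>m \<bullet> b\<bar>) ` Basis"
    then obtain b where b: "b \<in> Basis" "\<mu> = \<bar>m \<bullet> b\<bar>" by auto
    have "(m \<bullet> b) ^ (2 * k) \<le> (\<Sum>b\<in>Basis. (m \<bullet> b) ^ (2 * k))"
      using b(1) by (intro member_le_sum zero_le_even_power) auto
    moreover have "\<mu> ^ (2 * k) = (m \<bullet> b) ^ (2 * k)" unfolding b(2) by (rule power_even_abs) simp
    ultimately show ?thesis by simp
  qed
  moreover have "(1 + norm m) ^ (2 * k) \<le> (real (DIM('a) + 1) * \<mu>) ^ (2 * k)"
  proof (rule power_mono)
    have "norm m \<le> (\<Sum>b\<in>Basis. \<bar>m \<bullet> b\<bar>)" by (rule norm_le_l1)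
    also have "\<dots> \<le> real DIM('a) * \<mu>" using sum_bounded_above[of Basis "\<lambda>b. \<bar>m \<bullet> b\<bar>" \<mu>] \<mu>(2) by simp
    finally show "1 + norm m \<le> real (DIM('a) + 1) * \<mu>" using \<mu>(1) by (simp add: algebra_simps)
  qed simp
  ultimately show ?thesis
    by (smt (verit, best) mult_left_mono power_mult_distrib zero_le_power of_nat_0_le_iff)
qed

text \<open>This is where the order of smoothness enters: by Cauchy--Schwarz, square summability of the
  k-fold differentiated coefficients beats the weight as soon as \<open>2 k - 4\<close> exceeds the dimension.\<close>

lemma weighted_coeff_bound:
  fixes F :: "'a::euclidean_space \<Rightarrow> real"
  assumes S: "S > 0" and C: "compact C" "C \<subseteq> fbox S" and F: "\<And>e. e \<in> Basis \<Longrightarrow> schain C e k F"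
    and k: "2 * k \<ge> DIM('a) + 5"
  obtains M where "\<And>A. finite A \<Longrightarrow> A \<subseteq> lattice_pts \<Longrightarrow>
    (\<Sum>m\<in>A. (1 + norm m)\<^sup>2 * (\<bar>cos_coeff S F m\<bar> + \<bar>sin_coeff S F m\<bar>)) \<le> M"
proof -
  define E where "E g m = (cos_coeff S g m)\<^sup>2 + (sin_coeff S g m)\<^sup>2" for g :: "'a \<Rightarrow> real" and m
  have "\<exists>G. L2loc G \<and> (\<forall>z. z \<notin> C \<longrightarrow> G z = 0) \<and> (\<forall>m. E G m = (pi / S * (m \<bullet> e)) ^ (2 * k) * E F m)"
    if "e \<in> Basis" for e
    using schain_coeffs[OF F[OF that], of S] unfolding E_def by metis
  then obtain G where G: "\<And>e. e \<in> Basis \<Longrightarrow> L2loc (G e)" "\<And>e z. e \<in> Basis \<Longrightarrow> z \<notin> C \<Longrightarrow> G e z = 0"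
     "\<And>e m. e \<in> Basis \<Longrightarrow> E (G e) m = (pi / S * (m \<bullet> e)) ^ (2 * k) * E F m" by metis
  obtain e0 :: 'a where e0: "e0 \<in> Basis" using nonempty_Basis by blast
  have LF: "L2loc F" "\<And>z. z \<notin> C \<Longrightarrow> F z = 0" using schain_supp[OF F[OF e0]] by auto
  define V where "V = (2 * S) ^ DIM('a)"
  define \<kappa> where "\<kappa> = (pi / S) ^ (2 * k)"
  have \<kappa>: "\<kappa> > 0" using S by (simp add: \<kappa>_def)
  \<comment> \<open>Bessel bounds for F and for its k-fold derivatives \<open>G e\<close>, the
    latter divided by the factor (pi/S)^(2k) that differentiation introduces.\<close>
  define K1 where "K1 = V * (\<integral>z. (F z)\<^sup>2 \<partial>lborel) + (\<Sum>e\<in>Basis. V * (\<integral>z. (G e z)\<^sup>2 \<partial>lborel) / \<kappa>)"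
  define K2 where "K2 = real (DIM('a) + 1) ^ (2 * k) * K1"
  obtain K where K: "K \<ge> 0" "\<And>A. finite A \<Longrightarrow> A \<subseteq> (lattice_pts :: 'a set) \<Longrightarrow> (\<Sum>m\<in>A. inverse ((1 + norm m) ^ (DIM('a) + 1))) \<le> K"
    using lattice_sum_bound by metis
  have "(\<Sum>m\<in>A. (1 + norm m)\<^sup>2 * (\<bar>cos_coeff S F m\<bar> + \<bar>sin_coeff S F m\<bar>)) \<le> 2 * K2 + K"
    if A: "finite A" "A \<subseteq> lattice_pts" for A
  proof -
    have bes: "(\<Sum>m\<in>A. E g m) \<le> V * (\<integral>z. (g z)\<^sup>2 \<partial>lborel)" if "L2loc g" "\<And>z. z \<notin> C \<Longrightarrow> g z = 0" for g
      unfolding E_def V_def by (rule bessel[OF S A that(1)]) (use that(2) C in auto)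
    have E0: "E F m \<ge> 0" for m by (simp add: E_def)
    have "(\<Sum>m\<in>A. (1 + norm m) ^ (2 * k) * E F m) \<le> (\<Sum>m\<in>A. real (DIM('a) + 1) ^ (2 * k) * (E F m + (\<Sum>e\<in>Basis. E (G e) m / \<kappa>)))"
    proof (rule sum_mono)
      fix m :: 'a
      have "(m \<bullet> e) ^ (2 * k) * E F m = E (G e) m / \<kappa>" if "e \<in> Basis" for e
      proof -
        have "E (G e) m = \<kappa> * ((m \<bullet> e) ^ (2 * k) * E F m)"
          unfolding G(3)[OF that] \<kappa>_def power_mult_distrib by (rule mult.assoc)
        then show ?thesis using \<kappa> by simp
      qed
      then have "(1 + (\<Sum>b\<in>Basis. (m \<bullet> b) ^ (2 * k))) * E F m = E F m + (\<Sum>e\<in>Basis. E (G e) m / \<kappa>)"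
        by (simp add: distrib_right sum_distrib_right)
      then show "(1 + norm m) ^ (2 * k) * E F m \<le> real (DIM('a) + 1) ^ (2 * k) * (E F m + (\<Sum>e\<in>Basis. E (G e) m / \<kappa>))"
        using mult_right_mono[OF one_plus_norm_power_le[of m k] E0[of m]] by (simp only: mult.assoc)
    qed
    also have "\<dots> = real (DIM('a) + 1) ^ (2 * k) * ((\<Sum>m\<in>A. E F m) + (\<Sum>e\<in>Basis. (\<Sum>m\<in>A. E (G e) m) / \<kappa>))"
      unfolding sum_distrib_left[symmetric] sum.distrib sum_divide_distrib by (subst (2) sum.swap) (rule refl)
    also have "\<dots> \<le> K2"
      unfolding K2_def K1_def using \<kappa> G LF
      by (intro mult_left_mono add_mono sum_mono divide_right_mono bes) auto
    finally have main: "(\<Sum>m\<in>A. (1 + norm m) ^ (2 * k) * E F m) \<le> K2" .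
    have "(\<Sum>m\<in>A. (1 + norm m)\<^sup>2 * (\<bar>cos_coeff S F m\<bar> + \<bar>sin_coeff S F m\<bar>)) \<le>
       (\<Sum>m\<in>A. 2 * ((1 + norm m) ^ (2 * k) * E F m) + inverse ((1 + norm m) ^ (DIM('a) + 1)))"
    proof (rule sum_mono)
      fix m :: 'a
      define r where "r = 1 + norm m"
      define s where "s = \<bar>cos_coeff S F m\<bar> + \<bar>sin_coeff S F m\<bar>"
      have r: "r \<ge> 1" by (simp add: r_def)
      have s: "s\<^sup>2 \<le> 2 * E F m" "s \<ge> 0"
        using sum_squares_bound[of "\<bar>cos_coeff S F m\<bar>" "\<bar>sin_coeff S F m\<bar>"]
        by (simp_all add: s_def E_def power2_sum)
      \<comment> \<open>The product q t is arranged so that q^2 carries the Sobolev weight and t^2 =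
        r^(4 - 2k), which is at most r^(-DIM - 1) because 2 k \<ge> DIM + 5; that power is summable
        over the lattice.\<close>
      define q where "q = r ^ k * s"
      define t where "t = r\<^sup>2 / r ^ k"
      have "r\<^sup>2 * s = q * t" using r by (simp add: q_def t_def)
      also have "\<dots> \<le> q\<^sup>2 + t\<^sup>2" using sum_squares_bound[of q t] zero_le_power2[of q] zero_le_power2[of t] by linarith
      also have "q\<^sup>2 \<le> 2 * (r ^ (2 * k) * E F m)"
        using mult_left_mono[OF s(1), of "r ^ (2 * k)"] r by (simp add: q_def power_mult_distrib power_mult[symmetric] mult.commute)
      also have "t\<^sup>2 \<le> inverse (r ^ (DIM('a) + 1))"
      proof -
        have e: "r\<^sup>2 ^ 2 * r ^ (DIM('a) + 1) = r ^ (DIM('a) + 5)"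
          unfolding power_mult[symmetric] power_add[symmetric] by (rule arg_cong[where f="(^) r"]) simp
        have "r ^ (DIM('a) + 5) \<le> r ^ (2 * k)" using r k by (intro power_increasing) auto
        then have "t\<^sup>2 * r ^ (DIM('a) + 1) \<le> 1"
          using r e by (simp add: t_def power_divide power_mult[symmetric] mult.commute[of k])
        then show ?thesis using r by (simp add: field_simps)
      qed
      finally show "(1 + norm m)\<^sup>2 * (\<bar>cos_coeff S F m\<bar> + \<bar>sin_coeff S F m\<bar>) \<le> 2 * ((1 + norm m) ^ (2 * k) * E F m) + inverse ((1 + norm m) ^ (DIM('a) + 1))"
        by (simp add: r_def s_def)
    qed
    also have "\<dots> \<le> 2 * K2 + K"
      using main K(2)[OF A] by (simp add: sum.distrib sum_distrib_left[symmetric])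
    finally show ?thesis .
  qed
  then show ?thesis using that by blast
qed

section \<open>Trigonometric polynomials and completeness\<close>

inductive trigp :: "real \<Rightarrow> ('a::euclidean_space \<Rightarrow> real) \<Rightarrow> bool" for S where
  cos: "m \<in> lattice_pts \<Longrightarrow> trigp S (\<lambda>z. c * fcos S m z)"
| sin: "m \<in> lattice_pts \<Longrightarrow> trigp S (\<lambda>z. c * fsin S m z)"
| add: "trigp S p \<Longrightarrow> trigp S q \<Longrightarrow> trigp S (\<lambda>z. p z + q z)"

lemma trigp_continuous: "trigp S p \<Longrightarrow> continuous_on X p"
  by (induction rule: trigp.induct)
     (intro continuous_on_add continuous_on_mult continuous_on_const continuous_fcos continuous_fsin; assumption)+

lemma trigp_cmul: "trigp S p \<Longrightarrow> trigp S (\<lambda>z. a * p z)"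
proof (induction rule: trigp.induct)
  case (cos m c)
  then show ?case using trigp.cos[of m S "a * c"] by (simp add: mult.assoc)
next
  case (sin m c)
  then show ?case using trigp.sin[of m S "a * c"] by (simp add: mult.assoc)
next
  case (add p q)
  then show ?case using trigp.add[of S "\<lambda>z. a * p z" "\<lambda>z. a * q z"] by (simp add: distrib_left)
qed

lemma trigp_const: "trigp S (\<lambda>z. c)"
  using trigp.cos[of 0 S c] lattice_pts_0 by simp

lemma trigp_sum: "finite I \<Longrightarrow> (\<And>i. i \<in> I \<Longrightarrow> trigp S (p i)) \<Longrightarrow> trigp S (\<lambda>z. \<Sum>i\<in>I. p i z)"
proof (induction rule: finite_induct)
  case (insert i I)
  have "trigp S (\<lambda>z. p i z + (\<Sum>i\<in>I. p i z))" by (rule trigp.add) (use insert in auto)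
  then show ?case using insert by simp
qed (simp add: trigp_const)

text \<open>Product-to-sum formulas keep the frequencies in the lattice; closure under products is
  what pulling back polynomials from the embedded torus requires.\<close>

lemma trigp_mult_trig: "trigp S p \<Longrightarrow> m \<in> lattice_pts \<Longrightarrow> trigp S (\<lambda>z. p z * fcos S m z) \<and> trigp S (\<lambda>z. p z * fsin S m z)"
proof (induction rule: trigp.induct)
  case (cos n c)
  have L: "n - m \<in> lattice_pts" "n + m \<in> lattice_pts" "m + n \<in> lattice_pts" "m - n \<in> lattice_pts"
    using cos lattice_pts_diff lattice_pts_add by auto
  have "(\<lambda>z. c * fcos S n z * fcos S m z) = (\<lambda>z. (c / 2) * fcos S (n - m) z + (c / 2) * fcos S (n + m) z)"
    unfolding mult.assoc trig_products by (simp add: fun_eq_iff distrib_left)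
  note eq1 = this
  have "(\<lambda>z. c * fcos S n z * fsin S m z) = (\<lambda>z. (c / 2) * fsin S (m + n) z + (c / 2) * fsin S (m - n) z)"
    unfolding mult.assoc mult.commute[of "fcos S n _" "fsin S m _"] trig_products by (simp add: fun_eq_iff distrib_left)
  note eq2 = this
  show ?case unfolding eq1 eq2 by (intro conjI trigp.add trigp.cos trigp.sin L)
next
  case (sin n c)
  have L: "n - m \<in> lattice_pts" "n + m \<in> lattice_pts"
    using sin lattice_pts_diff lattice_pts_add by auto
  have "(\<lambda>z. c * fsin S n z * fcos S m z) = (\<lambda>z. (c / 2) * fsin S (n + m) z + (c / 2) * fsin S (n - m) z)"
    unfolding mult.assoc trig_products by (simp add: fun_eq_iff distrib_left)
  note eq1 = this
  have "(\<lambda>z. c * fsin S n z * fsin S m z) = (\<lambda>z. (c / 2) * fcos S (n - m) z + (- c / 2) * fcos S (n + m) z)"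
    unfolding mult.assoc trig_products by (simp add: fun_eq_iff right_diff_distrib)
  note eq2 = this
  show ?case unfolding eq1 eq2 by (intro conjI trigp.add trigp.cos trigp.sin L)
next
  case (add p q)
  then show ?case by (simp add: distrib_right trigp.add)
qed

lemma trigp_mult: "trigp S q \<Longrightarrow> trigp S p \<Longrightarrow> trigp S (\<lambda>z. p z * q z)"
proof (induction rule: trigp.induct)
  case (cos m c)
  then have "trigp S (\<lambda>z. p z * fcos S m z)" using trigp_mult_trig by blast
  from trigp_cmul[OF this, of c] show ?case by (simp only: mult.left_commute)
next
  case (sin m c)
  then have "trigp S (\<lambda>z. p z * fsin S m z)" using trigp_mult_trig by blast
  from trigp_cmul[OF this, of c] show ?case by (simp only: mult.left_commute)
next
  case (add q r)
  then show ?case by (simp add: distrib_left trigp.add)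
qed

text \<open>Embeds the torus into a Euclidean space by the cosines and sines of the coordinates:
  points are identified exactly when they agree modulo 2 S in each coordinate, and polynomials on
  the target pull back to trigonometric polynomials.\<close>

definition torus_map :: "real \<Rightarrow> 'a::euclidean_space \<Rightarrow> 'a \<times> 'a" where
  "torus_map S z = ((\<Sum>b\<in>Basis. fcos S b z *\<^sub>R b), (\<Sum>b\<in>Basis. fsin S b z *\<^sub>R b))"

lemma continuous_torus_map: "continuous_on X (torus_map S)"
  unfolding torus_map_def[abs_def] by (intro continuous_intros)

lemma torus_map_eqD:
  assumes "S > 0" "torus_map S y = torus_map S z" "b \<in> Basis"
  obtains n :: int where "y \<bullet> b = z \<bullet> b + 2 * S * of_int n"
proof -
  have "fst (torus_map S y) \<bullet> b = fst (torus_map S z) \<bullet> b" "snd (torus_map S y) \<bullet> b = snd (torus_map S z) \<bullet> b"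
    using assms(2) by auto
  then have "cos (pi / S * (b \<bullet> y)) = cos (pi / S * (b \<bullet> z))" "sin (pi / S * (b \<bullet> y)) = sin (pi / S * (b \<bullet> z))"
    using assms(3) by (simp_all add: torus_map_def inner_sum_left_Basis)
  then obtain n :: int where "pi / S * (b \<bullet> y) = pi / S * (b \<bullet> z) + 2 * pi * of_int n"
    using sin_cos_eq_iff by blast
  then have "pi * (b \<bullet> y) = pi * (b \<bullet> z + 2 * S * of_int n)"
    using assms(1) by (simp add: field_simps)
  then have "b \<bullet> y = b \<bullet> z + 2 * S * of_int n" by simp
  then have "y \<bullet> b = z \<bullet> b + 2 * S * of_int n" by (simp only: inner_commute[of b])
  then show ?thesis by (rule that)
qed

lemma trig_torus_invariant:
  assumes S: "S > 0" and yz: "torus_map S y = torus_map S z" and m: "m \<in> lattice_pts"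
  shows "fcos S m y = fcos S m z \<and> fsin S m y = fsin S m z"
proof -
  have "\<exists>n :: int. y \<bullet> b = z \<bullet> b + 2 * S * of_int n" if "b \<in> Basis" for b
    using torus_map_eqD[OF S yz that] by metis
  then obtain n where n: "\<And>b. b \<in> Basis \<Longrightarrow> y \<bullet> b = z \<bullet> b + 2 * S * of_int (n b :: int)" by metis
  have "\<exists>i :: int. m \<bullet> b = of_int i" if "b \<in> Basis" for b
    using m that by (auto simp: lattice_pts_def elim: Ints_cases)
  then obtain i where i: "\<And>b. b \<in> Basis \<Longrightarrow> m \<bullet> b = of_int (i b)" by metis
  have "m \<bullet> y = (\<Sum>b\<in>Basis. (m \<bullet> b) * (y \<bullet> b))" by (rule euclidean_inner)
  also have "\<dots> = (\<Sum>b\<in>Basis. (m \<bullet> b) * (z \<bullet> b) + 2 * S * of_int (i b * n b))"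
    by (intro sum.cong refl) (simp add: n i algebra_simps)
  also have "\<dots> = m \<bullet> z + 2 * S * of_int (\<Sum>b\<in>Basis. i b * n b)"
    by (simp add: sum.distrib sum_distrib_left euclidean_inner[of m z])
  finally have "pi / S * (m \<bullet> y) = pi / S * (m \<bullet> z) + 2 * pi * of_int (\<Sum>b\<in>Basis. i b * n b)"
    using S by (simp add: field_simps)
  then have "sin (pi / S * (m \<bullet> y)) = sin (pi / S * (m \<bullet> z)) \<and> cos (pi / S * (m \<bullet> y)) = cos (pi / S * (m \<bullet> z))"
    using sin_cos_eq_iff by blast
  then show ?thesis by simp
qed

text \<open>Coordinates of the two points differ by a multiple of 2 S, yet by less than 2 S because
  one point lies in the open cell. Identification only affects the faces.\<close>

lemma torus_map_injective_interior:
  assumes S: "S > 0" and yz: "torus_map S y = torus_map S z" and y: "y \<in> fbox S"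
    and z: "z \<in> box (- (S *\<^sub>R One)) (S *\<^sub>R One)"
  shows "y = z"
proof (rule euclidean_eqI)
  fix b :: 'a assume b: "b \<in> Basis"
  obtain n :: int where n: "y \<bullet> b = z \<bullet> b + 2 * S * of_int n" using torus_map_eqD[OF S yz b] by blast
  have "\<bar>y \<bullet> b\<bar> \<le> S" "\<bar>z \<bullet> b\<bar> < S" using y z b by (auto simp: mem_fbox mem_box)
  then have "\<bar>2 * S * of_int n\<bar> < 2 * S" using n by linarith
  then have "\<bar>of_int n :: real\<bar> < 1" using S by (simp add: abs_mult)
  then have "n = 0" by linarith
  then show "y \<bullet> b = z \<bullet> b" using n by simp
qed

text \<open>Stone-Weierstrass on the embedded torus: h descends to a continuous function on the
  compact image and is approximated there by a polynomial, which the coordinates of the embedding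
  turn into a trigonometric one.\<close>

lemma trigp_dense:
  fixes h :: "'a::euclidean_space \<Rightarrow> real"
  assumes S: "S > 0" and h: "continuous_on (fbox S) h" and \<epsilon>: "\<epsilon> > 0"
    and inv: "\<And>y z. y \<in> fbox S \<Longrightarrow> z \<in> fbox S \<Longrightarrow> torus_map S y = torus_map S z \<Longrightarrow> h y = h z"
  obtains p where "trigp S p" "\<And>z. z \<in> fbox S \<Longrightarrow> \<bar>h z - p z\<bar> < \<epsilon>"
proof -
  define Q where "Q = (fbox S :: 'a set)"
  have Q: "compact Q" by (simp add: Q_def fbox_def)
  define K where "K = torus_map S ` Q"
  have K: "compact K" unfolding K_def by (intro compact_continuous_image continuous_torus_map Q)
  define h' where "h' y = h (inv_into Q (torus_map S) y)" for y
  have h': "h' (torus_map S z) = h z" if "z \<in> Q" for z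
  proof -
    have "torus_map S z \<in> torus_map S ` Q" using that by simp
    then have "inv_into Q (torus_map S) (torus_map S z) \<in> Q"
      "torus_map S (inv_into Q (torus_map S) (torus_map S z)) = torus_map S z"
      using inv_into_into f_inv_into_f by metis+
    then show ?thesis unfolding h'_def by (intro inv) (use that in \<open>simp_all add: Q_def\<close>)
  qed
  \<comment> \<open>A continuous map on a compact set is closed, hence a quotient map onto its
    image: preimages of closed sets under h' are images of preimages under h.\<close>
  have "continuous_on K h'"
    unfolding continuous_on_closed_invariant
  proof (intro allI impI)
    fix B :: "real set" assume B: "closed B"
    have "closed (Q \<inter> h -` B)"
      using h Q B unfolding Q_def by (intro continuous_closed_preimage) (auto intro: compact_imp_closed)
    then have "compact (Q \<inter> h -` B)" using compact_Int_closed[OF Q] by (metis Int_left_absorb)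
    then have "compact (torus_map S ` (Q \<inter> h -` B))" by (intro compact_continuous_image continuous_torus_map)
    then have "closed (torus_map S ` (Q \<inter> h -` B))" by (rule compact_imp_closed)
    moreover have "torus_map S ` (Q \<inter> h -` B) \<inter> K = h' -` B \<inter> K"
      unfolding K_def using h' by auto
    ultimately show "\<exists>A. closed A \<and> A \<inter> K = h' -` B \<inter> K" by blast
  qed
  then obtain g where g: "real_polynomial_function g" "\<And>y. y \<in> K \<Longrightarrow> \<bar>h' y - g y\<bar> < \<epsilon>"
    using Stone_Weierstrass_real_polynomial_function[OF K _ \<epsilon>] by blast
  have "trigp S (\<lambda>z. g (torus_map S z))"
    using g(1)
  proof (induction rule: real_polynomial_function.induct)
    case (linear f)
    then interpret f: bounded_linear f .
    have "f (torus_map S z) = (\<Sum>b\<in>Basis. f (b, 0) * fcos S b z) + (\<Sum>b\<in>Basis. f (0, b) * fsin S b z)" for z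
    proof -
      have tm: "torus_map S z = (\<Sum>b\<in>Basis. fcos S b z *\<^sub>R (b, 0)) + (\<Sum>b\<in>Basis. fsin S b z *\<^sub>R (0, b))"
        by (rule prod_eqI) (simp_all add: torus_map_def fst_sum snd_sum)
      show ?thesis unfolding tm f.add f.sum f.scaleR real_scaleR_def by (simp only: mult.commute)
    qed
    then show ?case
      by (simp only:) (intro trigp.add trigp_sum trigp.cos trigp.sin lattice_pts_Basis finite_Basis)
  next
    case (const c)
    then show ?case by (rule trigp_const)
  next
    case (add f g)
    then show ?case by (intro trigp.add)
  next
    case (mult f g)
    then show ?case by (intro trigp_mult)
  qed
  moreover have "\<bar>h z - g (torus_map S z)\<bar> < \<epsilon>" if "z \<in> fbox S" for z
    using g(2)[of "torus_map S z"] h'[of z] that by (auto simp: K_def Q_def)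
  ultimately show ?thesis using that by blast
qed

text \<open>h is orthogonal to all trigonometric polynomials p, so the integral of h^2 equals that
  of h (h - p), which is at most \<epsilon> times the integral of |h|. Thus it vanishes, and
  continuity gives h = 0 on the whole cell.\<close>

lemma trig_complete:
  fixes h :: "'a::euclidean_space \<Rightarrow> real"
  assumes S: "S > 0" and h: "continuous_on (fbox S) h"
    and inv: "\<And>y z. y \<in> fbox S \<Longrightarrow> z \<in> fbox S \<Longrightarrow> torus_map S y = torus_map S z \<Longrightarrow> h y = h z"
    and c0: "\<And>m. m \<in> lattice_pts \<Longrightarrow> integral (fbox S) (\<lambda>z. h z * fcos S m z) = 0"
    and s0: "\<And>m. m \<in> lattice_pts \<Longrightarrow> integral (fbox S) (\<lambda>z. h z * fsin S m z) = 0"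
    and z: "z \<in> fbox S"
  shows "h z = 0"
proof -
  have int: "f integrable_on fbox S" if "continuous_on (fbox S) f" for f :: "'a \<Rightarrow> real"
    using that unfolding fbox_def by (rule integrable_continuous)
  have 0: "integral (fbox S) (\<lambda>z. h z * p z) = 0" if "trigp S p" for p
    using that
  proof (induction rule: trigp.induct)
    case (cos m c)
    then show ?case using c0[OF cos] by (simp add: mult.left_commute[of _ c])
  next
    case (sin m c)
    then show ?case using s0[OF sin] by (simp add: mult.left_commute[of _ c])
  next
    case (add p q)
    have "(\<lambda>z. h z * p z) integrable_on fbox S" "(\<lambda>z. h z * q z) integrable_on fbox S"
      by (intro int continuous_on_mult h trigp_continuous[OF add.hyps(1)],
          intro int continuous_on_mult h trigp_continuous[OF add.hyps(2)])
    then show ?case using add by (simp add: distrib_left integral_add)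
  qed
  have ih: "(\<lambda>z. h z * h z) integrable_on fbox S" "(\<lambda>z. \<bar>h z\<bar>) integrable_on fbox S"
    by (intro int continuous_intros h)+
  define I where "I = integral (fbox S) (\<lambda>z. \<bar>h z\<bar>)"
  have I: "I \<ge> 0" unfolding I_def by (rule integral_nonneg[OF ih(2)]) simp
  have "integral (fbox S) (\<lambda>z. h z * h z) \<le> \<epsilon> * I" if \<epsilon>: "\<epsilon> > 0" for \<epsilon>
  proof -
    obtain p where p: "trigp S p" "\<And>z. z \<in> fbox S \<Longrightarrow> \<bar>h z - p z\<bar> < \<epsilon>"
      using trigp_dense[OF S h \<epsilon> inv] by blast
    have cp: "continuous_on (fbox S) p" by (rule trigp_continuous[OF p(1)])
    have "integral (fbox S) (\<lambda>z. h z * h z) = integral (fbox S) (\<lambda>z. h z * h z) - integral (fbox S) (\<lambda>z. h z * p z)"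
      using 0[OF p(1)] by simp
    also have "\<dots> = integral (fbox S) (\<lambda>z. h z * h z - h z * p z)"
      by (rule integral_diff[symmetric]) (intro int continuous_intros h cp)+
    also have "\<dots> \<le> integral (fbox S) (\<lambda>z. \<epsilon> * \<bar>h z\<bar>)"
    proof (rule integral_le)
      show "(\<lambda>z. h z * h z - h z * p z) integrable_on fbox S" "(\<lambda>z. \<epsilon> * \<bar>h z\<bar>) integrable_on fbox S"
        by (intro int continuous_intros h cp)+
      fix x :: 'a assume x: "x \<in> fbox S"
      have "h x * h x - h x * p x = h x * (h x - p x)" by (simp add: right_diff_distrib)
      also have "\<dots> \<le> \<bar>h x\<bar> * \<bar>h x - p x\<bar>" by (metis abs_ge_self abs_mult)
      also have "\<dots> \<le> \<bar>h x\<bar> * \<epsilon>" using p(2)[OF x] by (intro mult_left_mono) auto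
      finally show "h x * h x - h x * p x \<le> \<epsilon> * \<bar>h x\<bar>" by (simp add: mult.commute)
    qed
    also have "\<dots> = \<epsilon> * I" by (simp add: I_def)
    finally show ?thesis .
  qed
  then have le: "integral (fbox S) (\<lambda>z. h z * h z) \<le> \<epsilon> * (I + 1)" if "\<epsilon> > 0" for \<epsilon>
    using that I by (smt (verit) mult_left_mono)
  have "integral (fbox S) (\<lambda>z. h z * h z) \<le> 0"
  proof (rule field_le_epsilon)
    fix e :: real assume "e > 0"
    then show "integral (fbox S) (\<lambda>z. h z * h z) \<le> 0 + e"
      using le[of "e / (I + 1)"] I by simp
  qed
  moreover have "integral (fbox S) (\<lambda>z. h z * h z) \<ge> 0" by (rule integral_nonneg[OF ih(1)]) simp
  ultimately have "integral (fbox S) (\<lambda>z. h z * h z) = 0" by simp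
  moreover have "box (- (S *\<^sub>R One)) (S *\<^sub>R One) \<noteq> ({} :: 'a set)"
    using S by (auto simp: box_ne_empty)
  moreover have "continuous_on (cbox (- (S *\<^sub>R One)) (S *\<^sub>R One)) (\<lambda>z. h z * h z)"
    using h unfolding fbox_def by (intro continuous_intros)
  ultimately have "\<forall>x\<in>cbox (- (S *\<^sub>R One)) (S *\<^sub>R One). h x * h x = 0"
    unfolding fbox_def by (subst (asm) integral_cbox_eq_0_iff) auto
  then show ?thesis using z by (auto simp: fbox_def)
qed

text \<open>Absolute summability makes the Fourier series converge uniformly to a continuous G with
  the coefficients of F, and completeness identifies the two. The weight in the bound M is the cost
  of a wave in neurons, which is O((1 + |m|)^2).\<close>

theorem fourier_approximation:
  fixes F :: "'a::euclidean_space \<Rightarrow> real"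
  assumes C: "compact C" and F: "continuous_on UNIV F" "\<And>e. e \<in> Basis \<Longrightarrow> schain C e k F"
    and k: "2 * k \<ge> DIM('a) + 5" and R: "R > 0"
  obtains \<kappa> M :: real and a b :: "'a \<Rightarrow> real" where "\<kappa> > 0"
    "\<And>A. finite A \<Longrightarrow> A \<subseteq> lattice_pts \<Longrightarrow> (\<Sum>m\<in>A. (1 + norm m)\<^sup>2 * (\<bar>a m\<bar> + \<bar>b m\<bar>)) \<le> M"
    "\<And>\<epsilon>. \<epsilon> > 0 \<Longrightarrow> \<exists>A. finite A \<and> A \<subseteq> lattice_pts \<and> (\<forall>z\<in>cball 0 R. \<bar>F z - (\<Sum>m\<in>A. a m * cos (\<kappa> * (m \<bullet> z)) + b m * sin (\<kappa> * (m \<bullet> z)))\<bar> < \<epsilon>)"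
proof -
  obtain S0 where S0: "\<And>z. z \<in> C \<Longrightarrow> norm z \<le> S0"
    using compact_imp_bounded[OF C] by (auto simp: bounded_iff)
  \<comment> \<open>The cell contains the ball of radius R, and the support of F lies in its
    interior; thus F vanishes on the faces and is compatible with their identification.\<close>
  define S where "S = \<bar>S0\<bar> + R + 1"
  have S: "S > 0" using R by (simp add: S_def)
  have Cb: "C \<subseteq> box (- (S *\<^sub>R One)) (S *\<^sub>R One)"
  proof
    fix z assume "z \<in> C"
    then have "norm z < S" using S0[of z] R by (simp add: S_def)
    then have "\<bar>z \<bullet> b\<bar> < S" if "b \<in> Basis" for b using Basis_le_norm[OF that, of z] by linarith
    then show "z \<in> box (- (S *\<^sub>R One)) (S *\<^sub>R One)" by (auto simp: mem_box abs_less_iff minus_less_iff)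
  qed
  then have CQ: "C \<subseteq> fbox S" unfolding fbox_def using box_subset_cbox by blast
  have RQ: "(cball 0 R :: 'a set) \<subseteq> fbox S"
  proof
    fix z :: 'a assume "z \<in> cball 0 R"
    then have "norm z \<le> S" by (simp add: S_def)
    then have "\<bar>z \<bullet> b\<bar> \<le> S" if "b \<in> Basis" for b using Basis_le_norm[OF that, of z] by linarith
    then show "z \<in> fbox S" by (auto simp: mem_fbox abs_le_iff minus_le_iff)
  qed
  obtain e0 :: 'a where e0: "e0 \<in> Basis" using nonempty_Basis by blast
  have F0: "F z = 0" if "z \<notin> C" for z using schain_supp[OF F(2)[OF e0]] that by auto
  define V where "V = (2 * S) ^ DIM('a)"
  have V: "V > 0" using S by (simp add: V_def)
  obtain M where M: "\<And>A. finite A \<Longrightarrow> A \<subseteq> lattice_pts \<Longrightarrow>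
    (\<Sum>m\<in>A. (1 + norm m)\<^sup>2 * (\<bar>cos_coeff S F m\<bar> + \<bar>sin_coeff S F m\<bar>)) \<le> M"
    using weighted_coeff_bound[OF S C CQ F(2) k] by metis
  \<comment> \<open>Division by V and not by V/2: over the whole lattice the frequencies m and -m
    contribute equally, and m = 0 forms no exception.\<close>
  define a where "a m = cos_coeff S F m / V" for m
  define b where "b m = sin_coeff S F m / V" for m
  have Mab: "(\<Sum>m\<in>A. (1 + norm m)\<^sup>2 * (\<bar>a m\<bar> + \<bar>b m\<bar>)) \<le> M / V" if "finite A" "A \<subseteq> lattice_pts" for A
  proof -
    have "(\<Sum>m\<in>A. (1 + norm m)\<^sup>2 * (\<bar>a m\<bar> + \<bar>b m\<bar>)) = (\<Sum>m\<in>A. (1 + norm m)\<^sup>2 * (\<bar>cos_coeff S F m\<bar> + \<bar>sin_coeff S F m\<bar>)) / V"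
      unfolding sum_divide_distrib a_def b_def using V by (intro sum.cong refl) (simp add: abs_divide add_divide_distrib[symmetric])
    then show ?thesis using M[OF that] V by (simp add: divide_right_mono)
  qed
  let ?g = "\<lambda>m z. a m * fcos S m z + b m * fsin S m z"
  define G where "G z = (\<Sum>\<^sub>\<infinity>m\<in>lattice_pts. ?g m z)" for z
  have summ: "(\<lambda>m. \<bar>a m\<bar> + \<bar>b m\<bar>) summable_on lattice_pts"
  proof (rule nonneg_bdd_above_summable_on)
    show "bdd_above (sum (\<lambda>m. \<bar>a m\<bar> + \<bar>b m\<bar>) ` {A. A \<subseteq> lattice_pts \<and> finite A})"
    proof (rule bdd_aboveI2)
      fix A :: "'a set" assume A: "A \<in> {A. A \<subseteq> lattice_pts \<and> finite A}"
      have "(\<Sum>m\<in>A. \<bar>a m\<bar> + \<bar>b m\<bar>) \<le> (\<Sum>m\<in>A. (1 + norm m)\<^sup>2 * (\<bar>a m\<bar> + \<bar>b m\<bar>))"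
      proof (rule sum_mono)
        fix m :: 'a
        have "1 \<le> (1 + norm m)\<^sup>2" by (rule one_le_power) simp
        from mult_right_mono[OF this, of "\<bar>a m\<bar> + \<bar>b m\<bar>"]
        show "\<bar>a m\<bar> + \<bar>b m\<bar> \<le> (1 + norm m)\<^sup>2 * (\<bar>a m\<bar> + \<bar>b m\<bar>)" by simp
      qed
      also have "\<dots> \<le> M / V" using A by (intro Mab) auto
      finally show "(\<Sum>m\<in>A. \<bar>a m\<bar> + \<bar>b m\<bar>) \<le> M / V" .
    qed
  qed simp
  have gb: "norm (?g m z) \<le> \<bar>a m\<bar> + \<bar>b m\<bar>" for m z
  proof -
    have "\<bar>a m * fcos S m z\<bar> \<le> \<bar>a m\<bar>" "\<bar>b m * fsin S m z\<bar> \<le> \<bar>b m\<bar>"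
      by (simp_all add: abs_mult mult_left_le)
    then show ?thesis by simp
  qed
  have ul: "uniform_limit X (\<lambda>A z. \<Sum>m\<in>A. ?g m z) G (finite_subsets_at_top lattice_pts)" for X
    unfolding G_def[abs_def] by (rule Weierstrass_m_test_general[OF gb summ])
  have cG: "continuous_on X G" for X
  proof (rule uniform_limit_theorem[OF _ ul])
    show "\<forall>\<^sub>F A in finite_subsets_at_top lattice_pts. continuous_on X (\<lambda>z. \<Sum>m\<in>A. ?g m z)"
      by (intro always_eventually allI continuous_trig_sum[unfolded trig_sum_def[abs_def]])
  qed simp
  have Gint: "integral (fbox S) (\<lambda>z. G z * fcos S n z) = V * a n" "integral (fbox S) (\<lambda>z. G z * fsin S n z) = V * b n"
    if n: "n \<in> lattice_pts" for n
  proof -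
    have n': "- n \<in> lattice_pts" using n by (rule lattice_pts_uminus)
    have par: "a (- n) = a n" "b (- n) = - b n" by (simp_all add: a_def b_def coeff_uminus)
    have gen: "integral (fbox S) (\<lambda>z. G z * f z) = c"
      if f: "continuous_on UNIV f" "\<And>z. \<bar>f z\<bar> \<le> 1"
        and c: "\<And>A. finite A \<Longrightarrow> A \<subseteq> lattice_pts \<Longrightarrow> n \<in> A \<Longrightarrow> - n \<in> A \<Longrightarrow> integral (fbox S) (\<lambda>z. trig_sum S a b A z * f z) = c" for f c
    proof -
      have "uniform_limit (fbox S) (\<lambda>A z. trig_sum S a b A z * f z) (\<lambda>z. G z * f z) (finite_subsets_at_top lattice_pts)"
      proof (rule uniform_limitI)
        fix e :: real assume "e > 0"
        then have "\<forall>\<^sub>F A in finite_subsets_at_top lattice_pts. \<forall>z\<in>fbox S. dist (\<Sum>m\<in>A. ?g m z) (G z) < e"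
          by (rule uniform_limitD[OF ul])
        then show "\<forall>\<^sub>F A in finite_subsets_at_top lattice_pts. \<forall>z\<in>fbox S. dist (trig_sum S a b A z * f z) (G z * f z) < e"
        proof eventually_elim
          case (elim A)
          show ?case
          proof
            fix z :: 'a assume z: "z \<in> fbox S"
            have "dist (trig_sum S a b A z * f z) (G z * f z) = \<bar>trig_sum S a b A z - G z\<bar> * \<bar>f z\<bar>"
              by (simp add: dist_real_def abs_mult[symmetric] left_diff_distrib)
            also have "\<dots> \<le> \<bar>trig_sum S a b A z - G z\<bar> * 1" using f(2) by (intro mult_left_mono) auto
            also have "\<dots> < e" using elim z by (auto simp: trig_sum_def dist_real_def)
            finally show "dist (trig_sum S a b A z * f z) (G z * f z) < e" .
          qed
        qed
      qed
      then obtain I J where IJ: "\<And>A. ((\<lambda>z. trig_sum S a b A z * f z) has_integral I A) (fbox S)"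
        "((\<lambda>z. G z * f z) has_integral J) (fbox S)" "(I \<longlongrightarrow> J) (finite_subsets_at_top lattice_pts)"
        unfolding fbox_def
        by (rule uniform_limit_integral_cbox)
           (use continuous_on_subset[OF f(1)] in \<open>auto intro!: continuous_on_mult continuous_trig_sum\<close>)
      \<comment> \<open>Once A contains n and -n, orthogonality makes the integral equal to c
        exactly, so along finite sets it is eventually constant.\<close>
      have "\<forall>\<^sub>F A in finite_subsets_at_top lattice_pts. I A = c"
        unfolding eventually_finite_subsets_at_top
      proof (intro exI[of _ "{n, - n}"] conjI allI impI)
        fix A assume "finite A \<and> {n, - n} \<subseteq> A \<and> A \<subseteq> lattice_pts"
        then show "I A = c" using c[of A] IJ(1)[of A] by (simp add: integral_unique)
      qed (use n n' in auto)
      then have "(I \<longlongrightarrow> c) (finite_subsets_at_top lattice_pts)" by (rule tendsto_eventually)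
      then have "J = c" using IJ(3) by (rule tendsto_unique[OF finite_subsets_at_top_neq_bot, rotated])
      then show ?thesis using IJ(2) by (simp add: integral_unique)
    qed
    show "integral (fbox S) (\<lambda>z. G z * fcos S n z) = V * a n"
    proof (rule gen[OF continuous_fcos])
      fix A :: "'a set" assume A: "finite A" "A \<subseteq> lattice_pts" "n \<in> A" "- n \<in> A"
      show "integral (fbox S) (\<lambda>z. trig_sum S a b A z * fcos S n z) = V * a n"
        unfolding integral_trig_sum_mult(1)[OF S A(1,2) n] using A par by (simp add: V_def)
    qed simp
    show "integral (fbox S) (\<lambda>z. G z * fsin S n z) = V * b n"
    proof (rule gen[OF continuous_fsin])
      fix A :: "'a set" assume A: "finite A" "A \<subseteq> lattice_pts" "n \<in> A" "- n \<in> A"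
      show "integral (fbox S) (\<lambda>z. trig_sum S a b A z * fsin S n z) = V * b n"
        unfolding integral_trig_sum_mult(2)[OF S A(1,2) n] using A par by (simp add: V_def)
    qed simp
  qed
  have Fint: "integral (fbox S) (\<lambda>z. F z * f z) = (\<integral>z. F z * f z \<partial>lborel)" if "continuous_on UNIV f" for f
  proof -
    have "integral (fbox S) (\<lambda>z. F z * f z) = (\<integral>z. indicator (fbox S) z * (F z * f z) \<partial>lborel)"
      by (rule integral_fbox_eq) (intro continuous_on_mult F that)
    also have "(\<lambda>z. indicator (fbox S) z * (F z * f z)) = (\<lambda>z. F z * f z)"
      using F0 CQ by (auto simp: fun_eq_iff indicator_def)
    finally show ?thesis .
  qed
  have FG: "F z - G z = 0" if "z \<in> fbox S" for z
  proof (rule trig_complete[OF S _ _ _ _ that])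
    have cF: "continuous_on X F" for X using F(1) continuous_on_subset by blast
    show "continuous_on (fbox S) (\<lambda>z. F z - G z)" by (intro continuous_on_diff cF cG)
    have int: "(\<lambda>z. F z * f z) integrable_on fbox S" "(\<lambda>z. G z * f z) integrable_on fbox S" if "continuous_on UNIV f" for f
      by (intro integrable_fbox_HK continuous_on_mult cF cG that)+
    show "integral (fbox S) (\<lambda>z. (F z - G z) * fcos S m z) = 0" if "m \<in> lattice_pts" for m
      using Gint(1)[OF that] Fint[OF continuous_fcos] int[OF continuous_fcos] V
      by (simp add: left_diff_distrib integral_diff a_def cos_coeff_def)
    show "integral (fbox S) (\<lambda>z. (F z - G z) * fsin S m z) = 0" if "m \<in> lattice_pts" for m
      using Gint(2)[OF that] Fint[OF continuous_fsin] int[OF continuous_fsin] V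
      by (simp add: left_diff_distrib integral_diff b_def sin_coeff_def)
    fix y z :: 'a assume yz: "y \<in> fbox S" "z \<in> fbox S" "torus_map S y = torus_map S z"
    \<comment> \<open>If either point lies in C, which is inside the open cell, the two coincide;
      otherwise F vanishes at both.\<close>
    have "F y = F z"
    proof (cases "y \<in> C \<or> z \<in> C")
      case True
      then have "y = z" using torus_map_injective_interior[OF S] yz Cb by (metis subsetD)
      then show ?thesis by simp
    qed (simp add: F0)
    moreover have "G y = G z" unfolding G_def
      by (intro infsum_cong) (use trig_torus_invariant[OF S yz(3)] in simp)
    ultimately show "F y - G y = F z - G z" by simp
  qed
  have "\<exists>A. finite A \<and> A \<subseteq> lattice_pts \<and> (\<forall>z\<in>cball 0 R. \<bar>F z - (\<Sum>m\<in>A. a m * cos (pi / S * (m \<bullet> z)) + b m * sin (pi / S * (m \<bullet> z)))\<bar> < \<epsilon>)"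
    if "\<epsilon> > 0" for \<epsilon>
  proof -
    have "\<forall>\<^sub>F A in finite_subsets_at_top lattice_pts. \<forall>z\<in>cball 0 R. dist (\<Sum>m\<in>A. ?g m z) (G z) < \<epsilon>"
      by (rule uniform_limitD[OF ul that])
    from this[unfolded eventually_finite_subsets_at_top]
    obtain A where A: "finite A" "A \<subseteq> lattice_pts"
      "\<forall>Y. finite Y \<and> A \<subseteq> Y \<and> Y \<subseteq> lattice_pts \<longrightarrow> (\<forall>z\<in>cball 0 R. dist (\<Sum>m\<in>Y. ?g m z) (G z) < \<epsilon>)"
      by (elim exE conjE)
    have A3: "\<forall>z\<in>cball 0 R. dist (\<Sum>m\<in>A. ?g m z) (G z) < \<epsilon>"
      using A(3)[rule_format, of A] A(1,2) by simp
    have "\<bar>F z - (\<Sum>m\<in>A. ?g m z)\<bar> < \<epsilon>" if "z \<in> cball 0 R" for z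
    proof -
      have "F z = G z" using FG[of z] that RQ by auto
      moreover have "dist (\<Sum>m\<in>A. ?g m z) (G z) < \<epsilon>" using A3 that by blast
      ultimately show ?thesis by (simp only: dist_real_def abs_minus_commute)
    qed
    then show ?thesis using A(1,2) by (intro exI[of _ A]) simp
  qed
  moreover have "pi / S > 0" using S by simp
  ultimately show ?thesis using that[of "pi / S" a b "M / V"] Mab by meson
qed

section \<open>Greedy approximation by neurons\<close>

definition neuron :: "'a::euclidean_space \<Rightarrow> real \<Rightarrow> 'a \<Rightarrow> real" where
  "neuron a b z = max (a \<bullet> z + b) 0"

lemma continuous_neuron: "continuous_on X (neuron a b)"
  unfolding neuron_def[abs_def] by (intro continuous_intros)

lemma neuron_measurable [measurable]: "neuron a b \<in> borel_measurable borel"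
  by (rule borel_measurable_continuous_onI[OF continuous_neuron])

lemma neuron_bound: "norm a \<le> 1 \<Longrightarrow> \<bar>b\<bar> \<le> R \<Longrightarrow> norm z \<le> R \<Longrightarrow> \<bar>neuron a b z\<bar> \<le> 2 * R"
  using Cauchy_Schwarz_ineq2[of a z] mult_mono[of "norm a" 1 "norm z" R]
  by (auto simp: neuron_def)

lemma neuron_lipschitz: "\<bar>neuron a b y - neuron a b z\<bar> \<le> norm a * norm (y - z)"
proof -
  have "\<bar>neuron a b y - neuron a b z\<bar> \<le> \<bar>a \<bullet> (y - z)\<bar>"
    by (auto simp: neuron_def inner_diff_right)
  also have "\<dots> \<le> norm a * norm (y - z)" by (rule Cauchy_Schwarz_ineq2)
  finally show ?thesis .
qed

text \<open>The dual description of (M times) the closed convex hull of the signed neurons: no bounded h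
  supported in the ball separates g from it.\<close>

definition neuron_hull :: "'a::euclidean_space measure \<Rightarrow> real \<Rightarrow> real \<Rightarrow> ('a \<Rightarrow> real) \<Rightarrow> bool" where
  "neuron_hull \<mu> R M g \<longleftrightarrow> (\<forall>h s. h \<in> borel_measurable borel \<longrightarrow> (\<exists>c. \<forall>z. \<bar>h z\<bar> \<le> c) \<longrightarrow> (\<forall>z. R < norm z \<longrightarrow> h z = 0) \<longrightarrow>
     (\<forall>a b. norm a \<le> 1 \<longrightarrow> \<bar>b\<bar> \<le> R \<longrightarrow> \<bar>\<integral>z. neuron a b z * h z \<partial>\<mu>\<bar> \<le> s) \<longrightarrow> \<bar>\<integral>z. g z * h z \<partial>\<mu>\<bar> \<le> M * s)"

text \<open>Taylor's formula at -R with integral remainder; the linear term and the remainder kernel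
  max (s - b) 0 are ReLU functions of s.\<close>

lemma ridge_representation:
  fixes g g' g'' :: "real \<Rightarrow> real"
  assumes g: "\<And>s. (g has_real_derivative g' s) (at s)" "\<And>s. (g' has_real_derivative g'' s) (at s)"
    and c: "continuous_on UNIV g''" and s: "- R \<le> s" "s \<le> R"
  shows "g s = g (- R) + g' (- R) * max (s + R) 0 + (\<integral>b. indicator {-R..R} b * (max (s - b) 0 * g'' b) \<partial>lborel)"
proof -
  have "(\<integral>b. indicator {-R..R} b * (max (s - b) 0 * g'' b) \<partial>lborel) = (\<integral>b. indicator {-R..s} b *\<^sub>R ((s - b) * g'' b) \<partial>lborel)"
    using s by (intro Bochner_Integration.integral_cong) (auto simp: indicator_def)
  also have "\<dots> = ((s - s) * g' s + g s) - ((s - (- R)) * g' (- R) + g (- R))"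
  proof (rule integral_FTC_atLeastAtMost)
    show "continuous_on {- R..s} (\<lambda>b. (s - b) * g'' b)"
      using c by (intro continuous_intros) (auto intro: continuous_on_subset)
    show "((\<lambda>b. (s - b) * g' b + g b) has_vector_derivative (s - x) * g'' x) (at x within {- R..s})" for x
      unfolding has_real_derivative_iff_has_vector_derivative[symmetric]
      by (auto intro!: derivative_eq_intros DERIV_subset[OF g(1)] DERIV_subset[OF g(2)])
  qed (use s in auto)
  finally show ?thesis using s by (simp add: algebra_simps)
qed

text \<open>The representation writes the ridge function as a combination of the constant neuron,
  one affine neuron and an integral of neurons with biases in [-R, R]; the absolute masses are at
  most 1, \<tau> and 2 R \<tau>^2. Fubini transfers the bound s from single neurons to the
  integral.\<close>

lemma neuron_hull_ridge:
  fixes \<mu> :: "'a::euclidean_space measure" and g g' g'' :: "real \<Rightarrow> real"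
  assumes fm: "finite_measure \<mu>" and sets: "sets \<mu> = sets borel" and R: "R \<ge> 1" and w: "norm w \<le> 1"
    and g: "\<And>s. (g has_real_derivative g' s) (at s)" "\<And>s. (g' has_real_derivative g'' s) (at s)"
    and c: "continuous_on UNIV g''"
    and bd: "\<And>s. \<bar>g s\<bar> \<le> 1" "\<And>s. \<bar>g' s\<bar> \<le> \<tau>" "\<And>s. \<bar>g'' s\<bar> \<le> \<tau>\<^sup>2" and \<tau>: "\<tau> \<ge> 0"
  shows "neuron_hull \<mu> R (1 + \<tau> + 2 * R * \<tau>\<^sup>2) (\<lambda>z. g (w \<bullet> z))"
  unfolding neuron_hull_def
proof (intro allI impI)
  fix h :: "'a \<Rightarrow> real" and s
  assume hm[measurable]: "h \<in> borel_measurable borel" and "\<exists>c. \<forall>z. \<bar>h z\<bar> \<le> c" and h0: "\<forall>z. R < norm z \<longrightarrow> h z = 0"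
    and s: "\<forall>a b. norm a \<le> 1 \<longrightarrow> \<bar>b\<bar> \<le> R \<longrightarrow> \<bar>\<integral>z. neuron a b z * h z \<partial>\<mu>\<bar> \<le> s"
  then obtain c0 where c0: "\<And>z. \<bar>h z\<bar> \<le> c0" by blast
  have c0': "c0 \<ge> 0" using c0[of 0] by linarith
  interpret finite_measure \<mu> by (rule fm)
  note sets[measurable_cong]
  have gm[measurable]: "g'' \<in> borel_measurable borel" by (rule borel_measurable_continuous_onI[OF c])
  interpret P: pair_sigma_finite \<mu> lborel by standard
  define f where "f z b = indicator {-R..R} b * (g'' b * (neuron w (- b) z * h z))" for z b
  have hn: "\<bar>neuron a b z * h z\<bar> \<le> 2 * R * c0" if "norm a \<le> 1" "\<bar>b\<bar> \<le> R" for a b z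
  proof (cases "norm z \<le> R")
    case True
    then show ?thesis using mult_mono[OF neuron_bound[OF that True] c0[of z]] R by (simp add: abs_mult)
  qed (use h0 R c0' in auto)
  have int: "integrable \<mu> (\<lambda>z. neuron a b z * h z)" if "norm a \<le> 1" "\<bar>b\<bar> \<le> R" for a b
    by (rule integrable_const_bound[where B="2 * R * c0"]) (use hn[OF that] in auto)
  have fb: "\<bar>f z b\<bar> \<le> (\<tau>\<^sup>2 * (2 * R * c0)) * indicator {-R..R} b" for z b
  proof (cases "b \<in> {-R..R}")
    case True
    then have "\<bar>g'' b * (neuron w (- b) z * h z)\<bar> \<le> \<tau>\<^sup>2 * (2 * R * c0)"
      unfolding abs_mult[of "g'' b"] by (intro mult_mono bd hn w) auto
    then show ?thesis using True by (simp add: f_def)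
  qed (simp add: f_def)
  have fm: "case_prod f \<in> borel_measurable (\<mu> \<Otimes>\<^sub>M lborel)"
    unfolding f_def neuron_def split_def by measurable
  have fi: "integrable (\<mu> \<Otimes>\<^sub>M lborel) (case_prod f)"
  proof (rule Bochner_Integration.integrable_bound[OF _ fm])
    have "emeasure (\<mu> \<Otimes>\<^sub>M lborel) (space \<mu> \<times> {-R..R}) < \<infinity>"
      using R by (subst lborel.emeasure_pair_measure_Times) (auto simp: emeasure_eq_measure ennreal_mult[symmetric])
    then have "integrable (\<mu> \<Otimes>\<^sub>M lborel) (indicator (space \<mu> \<times> {-R..R}) :: _ \<Rightarrow> real)"
      by (intro integrable_real_indicator) auto
    then show "integrable (\<mu> \<Otimes>\<^sub>M lborel) (\<lambda>p. (\<tau>\<^sup>2 * (2 * R * c0)) * indicator (space \<mu> \<times> {-R..R}) p)"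
      by (rule integrable_mult_right)
    show "AE p in \<mu> \<Otimes>\<^sub>M (lborel :: real measure). norm (case_prod f p) \<le> norm ((\<tau>\<^sup>2 * (2 * R * c0)) * indicator (space \<mu> \<times> {-R..R}) p)"
    proof (rule AE_I2)
      fix p :: "'a \<times> real" assume "p \<in> space (\<mu> \<Otimes>\<^sub>M lborel)"
      then have "fst p \<in> space \<mu>" by (auto simp: space_pair_measure)
      then have "indicator (space \<mu> \<times> {-R..R}) p = (indicator {-R..R} (snd p) :: real)"
        by (cases p) (auto simp: indicator_def)
      then show "norm (case_prod f p) \<le> norm ((\<tau>\<^sup>2 * (2 * R * c0)) * indicator (space \<mu> \<times> {-R..R}) p)"
        using fb[of "fst p" "snd p"] R c0' by (simp add: split_def abs_mult)
    qed
  qed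
  have s0: "s \<ge> 0" using s[rule_format, of 0 0] R by (smt (verit) norm_zero abs_ge_zero)
  \<comment> \<open>Off the ball h vanishes, and on it |w . z| \<le> R as the representation
    demands. The constant 1 is the neuron with weight 0 and bias 1, admissible because R \<ge>
    1.\<close>
  have rep: "g (w \<bullet> z) * h z = g (- R) * (neuron 0 1 z * h z) + g' (- R) * (neuron w R z * h z) + (\<integral>b. f z b \<partial>lborel)" for z
  proof (cases "norm z \<le> R")
    case True
    have "\<bar>w \<bullet> z\<bar> \<le> norm w * norm z" by (rule Cauchy_Schwarz_ineq2)
    also have "\<dots> \<le> 1 * R" using w True by (intro mult_mono) auto
    finally have b: "- R \<le> w \<bullet> z" "w \<bullet> z \<le> R" by auto
    have "(\<integral>b. f z b \<partial>lborel) = (\<integral>b. (indicator {-R..R} b * (max (w \<bullet> z - b) 0 * g'' b)) * h z \<partial>lborel)"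
      by (simp add: f_def neuron_def ac_simps)
    also have "\<dots> = (\<integral>b. indicator {-R..R} b * (max (w \<bullet> z - b) 0 * g'' b) \<partial>lborel) * h z"
      by (rule integral_mult_left_zero)
    finally show ?thesis
      using ridge_representation[OF g c b] by (simp add: neuron_def algebra_simps)
  qed (use h0 in \<open>simp add: f_def\<close>)
  have i3: "integrable \<mu> (\<lambda>z. \<integral>b. f z b \<partial>lborel)"
    using P.integrable_fst'[OF fi] by simp
  have i1: "integrable \<mu> (\<lambda>z. neuron 0 1 z * h z)" using R by (intro int) auto
  have i2: "integrable \<mu> (\<lambda>z. neuron w R z * h z)" using R by (intro int w) auto
  have "(\<integral>z. g (w \<bullet> z) * h z \<partial>\<mu>) = g (- R) * (\<integral>z. neuron 0 1 z * h z \<partial>\<mu>) + g' (- R) * (\<integral>z. neuron w R z * h z \<partial>\<mu>)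
     + (\<integral>z. \<integral>b. f z b \<partial>lborel \<partial>\<mu>)"
    unfolding rep using i1 i2 i3 by simp
  also have "(\<integral>z. \<integral>b. f z b \<partial>lborel \<partial>\<mu>) = (\<integral>b. \<integral>z. f z b \<partial>\<mu> \<partial>lborel)"
    by (rule P.Fubini_integral[OF fi, symmetric])
  finally have eq: "(\<integral>z. g (w \<bullet> z) * h z \<partial>\<mu>) = g (- R) * (\<integral>z. neuron 0 1 z * h z \<partial>\<mu>) + g' (- R) * (\<integral>z. neuron w R z * h z \<partial>\<mu>)
     + (\<integral>b. \<integral>z. f z b \<partial>\<mu> \<partial>lborel)" .
  have b1: "\<bar>g (- R) * (\<integral>z. neuron 0 1 z * h z \<partial>\<mu>)\<bar> \<le> 1 * s"
    unfolding abs_mult using R s by (intro mult_mono bd) auto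
  have b2: "\<bar>g' (- R) * (\<integral>z. neuron w R z * h z \<partial>\<mu>)\<bar> \<le> \<tau> * s"
    unfolding abs_mult using R s w \<tau> by (intro mult_mono bd) auto
  have b3: "\<bar>\<integral>b. \<integral>z. f z b \<partial>\<mu> \<partial>lborel\<bar> \<le> 2 * R * \<tau>\<^sup>2 * s"
  proof -
    have inner: "\<bar>\<integral>z. f z b \<partial>\<mu>\<bar> \<le> (\<tau>\<^sup>2 * s) * indicator {-R..R} b" for b
    proof (cases "b \<in> {-R..R}")
      case True
      have "(\<integral>z. f z b \<partial>\<mu>) = g'' b * (\<integral>z. neuron w (- b) z * h z \<partial>\<mu>)"
        using True by (simp add: f_def)
      also have "\<bar>\<dots>\<bar> \<le> \<tau>\<^sup>2 * s" unfolding abs_mult using True s w by (intro mult_mono bd) auto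
      finally show ?thesis using True by simp
    qed (simp add: f_def)
    have fin: "emeasure lborel {-R..R} < \<infinity>" using R by simp
    have "\<bar>\<integral>b. \<integral>z. f z b \<partial>\<mu> \<partial>lborel\<bar> \<le> (\<integral>b. (\<tau>\<^sup>2 * s) * indicator {-R..R} b \<partial>lborel)"
    proof (rule order_trans[OF integral_abs_bound integral_mono])
      show "integrable lborel (\<lambda>b. \<bar>\<integral>z. f z b \<partial>\<mu>\<bar>)" using P.integrable_snd[OF fi] by simp
      show "integrable lborel (\<lambda>b. (\<tau>\<^sup>2 * s) * indicator {-R..R} b)"
        by (intro integrable_mult_right integrable_real_indicator fin) auto
    qed (rule inner)
    also have "\<dots> = 2 * R * \<tau>\<^sup>2 * s" using R by simp
    finally show ?thesis .
  qed
  show "\<bar>\<integral>z. g (w \<bullet> z) * h z \<partial>\<mu>\<bar> \<le> (1 + \<tau> + 2 * R * \<tau>\<^sup>2) * s"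
    unfolding eq using b1 b2 b3 by (simp add: distrib_right)
qed

text \<open>Neurons carry weights of norm at most 1, so the wave is written as a ridge function in
  the normalised direction \<open>sgn m\<close> whose profile has frequency \<tau> = \<kappa> |m|;
  its first two derivatives are bounded by \<tau> and \<tau>^2.\<close>

lemma neuron_hull_trig:
  fixes \<mu> :: "'a::euclidean_space measure" and m :: 'a
  assumes fm: "finite_measure \<mu>" and sets: "sets \<mu> = sets borel" and R: "R \<ge> 1" and \<kappa>: "\<kappa> > 0"
  defines "B \<equiv> 1 + \<kappa> * norm m + 2 * R * (\<kappa> * norm m)\<^sup>2"
  shows "neuron_hull \<mu> R B (\<lambda>z. cos (\<kappa> * (m \<bullet> z)))" "neuron_hull \<mu> R B (\<lambda>z. sin (\<kappa> * (m \<bullet> z)))"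
proof -
  define \<tau> where "\<tau> = \<kappa> * norm m"
  have \<tau>: "\<tau> \<ge> 0" using \<kappa> by (simp add: \<tau>_def)
  have arg: "\<kappa> * (m \<bullet> z) = \<tau> * (sgn m \<bullet> z)" for z
    by (cases "m = 0") (simp_all add: \<tau>_def sgn_div_norm)
  have w: "norm (sgn m) \<le> 1" by (simp add: norm_sgn)
  have b: "\<bar>\<tau> * x\<bar> \<le> \<tau>" "\<bar>\<tau>\<^sup>2 * x\<bar> \<le> \<tau>\<^sup>2" if "\<bar>x\<bar> \<le> 1" for x
    using that \<tau> by (simp_all add: abs_mult mult_left_le)
  have d: "((\<lambda>s. cos (\<tau> * s)) has_real_derivative - (\<tau> * sin (\<tau> * s))) (at s)"
    "((\<lambda>s. - (\<tau> * sin (\<tau> * s))) has_real_derivative - (\<tau>\<^sup>2 * cos (\<tau> * s))) (at s)"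
    "((\<lambda>s. sin (\<tau> * s)) has_real_derivative \<tau> * cos (\<tau> * s)) (at s)"
    "((\<lambda>s. \<tau> * cos (\<tau> * s)) has_real_derivative - (\<tau>\<^sup>2 * sin (\<tau> * s))) (at s)" for s
    by (auto intro!: derivative_eq_intros simp: power2_eq_square)
  show "neuron_hull \<mu> R B (\<lambda>z. cos (\<kappa> * (m \<bullet> z)))"
    unfolding arg B_def \<tau>_def[symmetric]
    by (rule neuron_hull_ridge[OF fm sets R w d(1,2) _ _ _ _ \<tau>]) (auto intro!: continuous_intros b)
  show "neuron_hull \<mu> R B (\<lambda>z. sin (\<kappa> * (m \<bullet> z)))"
    unfolding arg B_def \<tau>_def[symmetric]
    by (rule neuron_hull_ridge[OF fm sets R w d(3,4) _ _ _ _ \<tau>]) (auto intro!: continuous_intros b)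
qed

text \<open>Hull constants add up along linear combinations: a wave costs at most Q (1 + |m|)^2 with
  Q the first factor, so a finite sum costs at most Q M. Uniform approximation on the ball suffices
  for the limit, since h is bounded and supported there.\<close>

lemma neuron_hull_trig_limit:
  fixes \<mu> :: "'a::euclidean_space measure" and F :: "'a \<Rightarrow> real"
  assumes fm: "finite_measure \<mu>" and sets: "sets \<mu> = sets borel" and R: "R \<ge> 1" and \<kappa>: "\<kappa> > 0"
    and F[measurable]: "F \<in> borel_measurable borel" and FB: "\<And>z. norm z \<le> R \<Longrightarrow> \<bar>F z\<bar> \<le> BF"
    and M: "\<And>A. finite A \<Longrightarrow> A \<subseteq> L \<Longrightarrow> (\<Sum>m\<in>A. (1 + norm m)\<^sup>2 * (\<bar>a m\<bar> + \<bar>b m\<bar>)) \<le> M"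
    and lim: "\<And>\<epsilon>. \<epsilon> > 0 \<Longrightarrow> \<exists>A. finite A \<and> A \<subseteq> L \<and> (\<forall>z\<in>cball 0 R. \<bar>F z - (\<Sum>m\<in>A. a m * cos (\<kappa> * (m \<bullet> z)) + b m * sin (\<kappa> * (m \<bullet> z)))\<bar> < \<epsilon>)"
  shows "neuron_hull \<mu> R ((1 + \<kappa> + 2 * R * \<kappa>\<^sup>2) * M) F"
  unfolding neuron_hull_def
proof (intro allI impI)
  fix h :: "'a \<Rightarrow> real" and s
  assume hm[measurable]: "h \<in> borel_measurable borel" and hb: "\<exists>c. \<forall>z. \<bar>h z\<bar> \<le> c" and h0: "\<forall>z. R < norm z \<longrightarrow> h z = 0"
    and s: "\<forall>a b. norm a \<le> 1 \<longrightarrow> \<bar>b\<bar> \<le> R \<longrightarrow> \<bar>\<integral>z. neuron a b z * h z \<partial>\<mu>\<bar> \<le> s"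
  then obtain c0 where c0: "\<And>z. \<bar>h z\<bar> \<le> c0" by blast
  have c0': "c0 \<ge> 0" using c0[of 0] by linarith
  have s0: "s \<ge> 0" using s[rule_format, of 0 0] R by (smt (verit) norm_zero abs_ge_zero)
  interpret finite_measure \<mu> by (rule fm)
  note sets[measurable_cong]
  define Q where "Q = 1 + \<kappa> + 2 * R * \<kappa>\<^sup>2"
  define B where "B m = 1 + \<kappa> * norm m + 2 * R * (\<kappa> * norm m)\<^sup>2" for m :: 'a
  have BQ: "B m \<le> Q * (1 + norm m)\<^sup>2" for m
  proof -
    have n: "norm m \<le> (1 + norm m)\<^sup>2" "1 \<le> (1 + norm m)\<^sup>2" "(norm m)\<^sup>2 \<le> (1 + norm m)\<^sup>2"
      by (simp_all add: power2_sum)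
    have "B m = 1 * 1 + \<kappa> * norm m + 2 * R * \<kappa>\<^sup>2 * (norm m)\<^sup>2" by (simp add: B_def power_mult_distrib)
    also have "\<dots> \<le> 1 * (1 + norm m)\<^sup>2 + \<kappa> * (1 + norm m)\<^sup>2 + 2 * R * \<kappa>\<^sup>2 * (1 + norm m)\<^sup>2"
      using n \<kappa> R by (intro add_mono mult_left_mono) auto
    also have "\<dots> = Q * (1 + norm m)\<^sup>2" by (simp add: Q_def algebra_simps)
    finally show ?thesis .
  qed
  have bint: "integrable \<mu> (\<lambda>z. g z * h z)" if [measurable]: "g \<in> borel_measurable borel" and gb: "\<And>z. norm z \<le> R \<Longrightarrow> \<bar>g z\<bar> \<le> c" for g c
  proof (rule integrable_const_bound[where B="\<bar>c\<bar> * c0"])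
    have "\<bar>g z * h z\<bar> \<le> \<bar>c\<bar> * c0" for z
    proof (cases "norm z \<le> R")
      case True
      then have "\<bar>g z\<bar> \<le> \<bar>c\<bar>" using gb[OF True] by linarith
      then show ?thesis unfolding abs_mult[of "g z"] using c0 by (intro mult_mono) auto
    qed (use h0 c0' in auto)
    then show "AE z in \<mu>. norm (g z * h z) \<le> \<bar>c\<bar> * c0" by simp
  qed measurable
  have "\<bar>\<integral>z. F z * h z \<partial>\<mu>\<bar> \<le> Q * M * s + \<epsilon> * (c0 * measure \<mu> (space \<mu>))" if \<epsilon>: "\<epsilon> > 0" for \<epsilon>
  proof -
    obtain A where A: "finite A" "A \<subseteq> L" "\<forall>z\<in>cball 0 R. \<bar>F z - (\<Sum>m\<in>A. a m * cos (\<kappa> * (m \<bullet> z)) + b m * sin (\<kappa> * (m \<bullet> z)))\<bar> < \<epsilon>"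
      using lim[OF \<epsilon>] by blast
    define p where "p z = (\<Sum>m\<in>A. a m * cos (\<kappa> * (m \<bullet> z)) + b m * sin (\<kappa> * (m \<bullet> z)))" for z
    have icos: "integrable \<mu> (\<lambda>z. cos (\<kappa> * (m \<bullet> z)) * h z)" and isin: "integrable \<mu> (\<lambda>z. sin (\<kappa> * (m \<bullet> z)) * h z)" for m
      by (rule bint[where c=1]; simp)+
    have "(\<integral>z. p z * h z \<partial>\<mu>) = (\<integral>z. (\<Sum>m\<in>A. a m * (cos (\<kappa> * (m \<bullet> z)) * h z) + b m * (sin (\<kappa> * (m \<bullet> z)) * h z)) \<partial>\<mu>)"
      by (simp add: p_def sum_distrib_right distrib_right mult.assoc)
    also have "\<dots> = (\<Sum>m\<in>A. a m * (\<integral>z. cos (\<kappa> * (m \<bullet> z)) * h z \<partial>\<mu>) + b m * (\<integral>z. sin (\<kappa> * (m \<bullet> z)) * h z \<partial>\<mu>))"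
      using icos isin by (subst Bochner_Integration.integral_sum) auto
    also have "\<bar>\<dots>\<bar> \<le> (\<Sum>m\<in>A. Q * ((1 + norm m)\<^sup>2 * (\<bar>a m\<bar> + \<bar>b m\<bar>)) * s)"
    proof (rule order_trans[OF sum_abs sum_mono])
      fix m assume "m \<in> A"
      have c: "\<bar>\<integral>z. cos (\<kappa> * (m \<bullet> z)) * h z \<partial>\<mu>\<bar> \<le> B m * s" "\<bar>\<integral>z. sin (\<kappa> * (m \<bullet> z)) * h z \<partial>\<mu>\<bar> \<le> B m * s"
        using neuron_hull_trig[OF fm sets R \<kappa>, of m] hm hb h0 s unfolding neuron_hull_def B_def by blast+
      have le: "B m * s \<le> Q * (1 + norm m)\<^sup>2 * s" using BQ s0 by (intro mult_right_mono)
      have "\<bar>a m * (\<integral>z. cos (\<kappa> * (m \<bullet> z)) * h z \<partial>\<mu>) + b m * (\<integral>z. sin (\<kappa> * (m \<bullet> z)) * h z \<partial>\<mu>)\<bar>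
        \<le> \<bar>a m\<bar> * \<bar>\<integral>z. cos (\<kappa> * (m \<bullet> z)) * h z \<partial>\<mu>\<bar> + \<bar>b m\<bar> * \<bar>\<integral>z. sin (\<kappa> * (m \<bullet> z)) * h z \<partial>\<mu>\<bar>"
        unfolding abs_mult[symmetric] by (rule abs_triangle_ineq)
      also have "\<dots> \<le> \<bar>a m\<bar> * (Q * (1 + norm m)\<^sup>2 * s) + \<bar>b m\<bar> * (Q * (1 + norm m)\<^sup>2 * s)"
        using c le by (intro add_mono mult_left_mono) auto
      also have "\<dots> = Q * ((1 + norm m)\<^sup>2 * (\<bar>a m\<bar> + \<bar>b m\<bar>)) * s" by (simp add: algebra_simps)
      finally show "\<bar>a m * (\<integral>z. cos (\<kappa> * (m \<bullet> z)) * h z \<partial>\<mu>) + b m * (\<integral>z. sin (\<kappa> * (m \<bullet> z)) * h z \<partial>\<mu>)\<bar> \<le> Q * ((1 + norm m)\<^sup>2 * (\<bar>a m\<bar> + \<bar>b m\<bar>)) * s" .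
    qed
    also have "\<dots> = Q * (\<Sum>m\<in>A. (1 + norm m)\<^sup>2 * (\<bar>a m\<bar> + \<bar>b m\<bar>)) * s"
      by (simp only: sum_distrib_left sum_distrib_right)
    also have "\<dots> \<le> Q * M * s"
    proof -
      have "Q \<ge> 0" using \<kappa> R by (simp add: Q_def)
      then show ?thesis using M[OF A(1,2)] s0 by (intro mult_right_mono mult_left_mono)
    qed
    finally have ph: "\<bar>\<integral>z. p z * h z \<partial>\<mu>\<bar> \<le> Q * M * s" .
    have pm [measurable]: "p \<in> borel_measurable borel" unfolding p_def[abs_def] by measurable
    have pF: "\<bar>F z - p z\<bar> \<le> \<epsilon>" if "norm z \<le> R" for z using A(3) that by (force simp: p_def)
    have iF: "integrable \<mu> (\<lambda>z. F z * h z)" by (rule bint[OF F FB])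
    have iFp: "integrable \<mu> (\<lambda>z. (F z - p z) * h z)" by (rule bint[where c=\<epsilon>]) (use pF in auto)
    have ip: "integrable \<mu> (\<lambda>z. p z * h z)"
      using Bochner_Integration.integrable_diff[OF iF iFp] by (simp add: algebra_simps)
    have "\<bar>\<integral>z. (F z - p z) * h z \<partial>\<mu>\<bar> \<le> (\<integral>z. \<epsilon> * c0 \<partial>\<mu>)"
    proof (rule order_trans[OF integral_abs_bound integral_mono])
      show "\<bar>(F z - p z) * h z\<bar> \<le> \<epsilon> * c0" for z
      proof (cases "norm z \<le> R")
        case True
        then show ?thesis unfolding abs_mult using pF c0 \<epsilon> by (intro mult_mono) auto
      qed (use h0 c0' \<epsilon> in auto)
    qed (use iFp in auto)
    also have "\<dots> = \<epsilon> * (c0 * measure \<mu> (space \<mu>))" by simp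
    finally have "\<bar>\<integral>z. (F z - p z) * h z \<partial>\<mu>\<bar> \<le> \<epsilon> * (c0 * measure \<mu> (space \<mu>))" .
    moreover have "(\<integral>z. F z * h z \<partial>\<mu>) = (\<integral>z. (F z - p z) * h z \<partial>\<mu>) + (\<integral>z. p z * h z \<partial>\<mu>)"
      using iFp ip by (subst Bochner_Integration.integral_add[symmetric]) (auto simp: algebra_simps)
    ultimately show ?thesis using ph by linarith
  qed
  note lim2 = this
  have "\<bar>\<integral>z. F z * h z \<partial>\<mu>\<bar> \<le> Q * M * s"
  proof (rule field_le_epsilon)
    fix e :: real assume e: "e > 0"
    define c1 where "c1 = c0 * measure \<mu> (space \<mu>)"
    have c1: "c1 \<ge> 0" using c0' by (simp add: c1_def)
    have "e / (c1 + 1) * c1 \<le> e" using e c1 by (simp add: field_simps)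
    moreover have "e / (c1 + 1) > 0" using e c1 by simp
    ultimately show "\<bar>\<integral>z. F z * h z \<partial>\<mu>\<bar> \<le> Q * M * s + e"
      using lim2[of "e / (c1 + 1)"] unfolding c1_def by linarith
  qed
  then show "\<bar>\<integral>z. F z * h z \<partial>\<mu>\<bar> \<le> (1 + \<kappa> + 2 * R * \<kappa>\<^sup>2) * M * s" by (simp add: Q_def)
qed

text \<open>Greedy selection: the next neuron is chosen to correlate with the current residual
  as well as F itself does, so that the squared residual of the unnormalised sum grows
  linearly.\<close>

lemma greedy_neurons:
  fixes \<mu> :: "'a::euclidean_space measure" and F :: "'a \<Rightarrow> real"
  assumes fm: "finite_measure \<mu>" and sets: "sets \<mu> = sets borel" and R: "R \<ge> 1"
    and conc: "AE z in \<mu>. norm z \<le> R"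
    and F[measurable]: "F \<in> borel_measurable borel" and FB: "\<And>z. norm z \<le> R \<Longrightarrow> \<bar>F z\<bar> \<le> BF"
    and hull: "neuron_hull \<mu> R M F" and M: "M > 0"
  obtains B where "\<And>n. \<exists>\<sigma> a b. (\<forall>i. \<bar>\<sigma> i\<bar> \<le> 1 \<and> norm (a i) \<le> 1) \<and>
    (\<integral>z. (real n * F z - (\<Sum>i\<in>{1..n}. \<sigma> i * M * neuron (a i) (b i) z))\<^sup>2 \<partial>\<mu>) \<le> real n * B"
proof -
  interpret finite_measure \<mu> by (rule fm)
  note sets[measurable_cong]
  \<comment> \<open>Bound for the integral of (F - g)^2, where g is any admissible signed neuron
    scaled by M.\<close>
  define B0 where "B0 = (BF + M * (2 * R))\<^sup>2 * measure \<mu> (space \<mu>)"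
  have BF: "BF \<ge> 0" using FB[of 0] R by force
  have ibd: "integrable \<mu> f" if "f \<in> borel_measurable borel" "\<And>z. norm z \<le> R \<Longrightarrow> \<bar>f z\<bar> \<le> c" for f :: "'a \<Rightarrow> real" and c
    by (rule integrable_const_bound[where B=c]) (use conc that in \<open>auto elim!: eventually_mono simp: measurable_cong_sets[OF sets refl]\<close>)
  define D where "D n \<sigma> a b z = real n * F z - (\<Sum>i\<in>{1..n}. \<sigma> i * M * neuron (a i) (b i) z)" for n \<sigma> a b z
  have "\<exists>\<sigma> a b. (\<forall>i. \<bar>\<sigma> i\<bar> \<le> 1 \<and> norm (a i) \<le> 1 \<and> \<bar>b i\<bar> \<le> R) \<and> (\<integral>z. (D n \<sigma> a b z)\<^sup>2 \<partial>\<mu>) \<le> real n * (B0 + 1)" for n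
  proof (induction n)
    case 0
    show ?case by (rule exI[of _ "\<lambda>_. 0"], rule exI[of _ "\<lambda>_. 0"], rule exI[of _ "\<lambda>_. 0"]) (use R in \<open>simp add: D_def\<close>)
  next
    case (Suc n)
    then obtain \<sigma> a b where IH: "\<And>i. \<bar>\<sigma> i\<bar> \<le> 1 \<and> norm (a i) \<le> 1 \<and> \<bar>b i\<bar> \<le> R" "(\<integral>z. (D n \<sigma> a b z)\<^sup>2 \<partial>\<mu>) \<le> real n * (B0 + 1)"
      by blast
    let ?D = "D n \<sigma> a b"
    have Dm[measurable]: "?D \<in> borel_measurable borel" unfolding D_def[abs_def] by measurable
    define cD where "cD = real n * BF + real n * (M * (2 * R))"
    have nb: "\<bar>\<sigma>' * M * neuron a' b' z\<bar> \<le> M * (2 * R)" if "\<bar>\<sigma>'\<bar> \<le> 1" "norm a' \<le> 1" "\<bar>b'\<bar> \<le> R" "norm z \<le> R" for \<sigma>' a' b' z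
    proof -
      have "\<bar>\<sigma>'\<bar> * M * \<bar>neuron a' b' z\<bar> \<le> 1 * M * (2 * R)"
        using that M by (intro mult_mono neuron_bound) auto
      then show ?thesis using M by (simp add: abs_mult)
    qed
    have Db: "\<bar>?D z\<bar> \<le> cD" if z: "norm z \<le> R" for z
    proof -
      have "\<bar>\<Sum>i\<in>{1..n}. \<sigma> i * M * neuron (a i) (b i) z\<bar> \<le> (\<Sum>i\<in>{1..n}. M * (2 * R))"
        using IH(1) z by (intro order_trans[OF sum_abs sum_mono] nb) auto
      moreover have "\<bar>real n * F z\<bar> \<le> real n * BF" using FB[OF z] by (simp add: abs_mult mult_left_mono)
      ultimately show ?thesis by (simp add: D_def cD_def)
    qed
    have cD: "cD \<ge> 0" using BF M R by (simp add: cD_def)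
    \<comment> \<open>The residual cut off to the ball, to fit the dual definition of the hull;
      almost everywhere it is the residual itself.\<close>
    define h where "h z = indicator (cball 0 R) z * ?D z" for z
    have hm[measurable]: "h \<in> borel_measurable borel" unfolding h_def[abs_def] by (intro borel_measurable_times borel_measurable_indicator Dm borel_closed closed_cball)
    have hb: "\<bar>h z\<bar> \<le> cD" for z using Db[of z] cD by (auto simp: h_def indicator_def)
    have h0: "\<forall>z. R < norm z \<longrightarrow> h z = 0" by (auto simp: h_def)
    have hD: "(\<integral>z. g z * h z \<partial>\<mu>) = (\<integral>z. g z * ?D z \<partial>\<mu>)" if [measurable]: "g \<in> borel_measurable borel" for g
    proof (rule integral_cong_AE)
      show "AE z in \<mu>. g z * h z = g z * ?D z"
        using conc by eventually_elim (simp add: h_def)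
    qed measurable
    \<comment> \<open>A maximiser need not exist, so a slack of 1/2 is allowed; it doubles in the
      cross term of the square and accounts for the 1 in B0 + 1. If every signed neuron fell short
      by more, the hull property with s = t/M would bound the integral of F h by itself minus
      1/2.\<close>
    have "\<exists>\<sigma>' a' b'. \<bar>\<sigma>'\<bar> \<le> 1 \<and> norm a' \<le> 1 \<and> \<bar>b'\<bar> \<le> R \<and> (\<integral>z. F z * h z \<partial>\<mu>) - 1 / 2 \<le> (\<integral>z. (\<sigma>' * M * neuron a' b' z) * h z \<partial>\<mu>)"
    proof (rule ccontr)
      assume neg: "\<not> ?thesis"
      define t where "t = (\<integral>z. F z * h z \<partial>\<mu>) - 1 / 2"
      have lt: "\<sigma>' * M * (\<integral>z. neuron a' b' z * h z \<partial>\<mu>) < t" if "\<bar>\<sigma>'\<bar> \<le> 1" "norm a' \<le> 1" "\<bar>b'\<bar> \<le> R" for \<sigma>' a' b'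
      proof -
        have "(\<integral>z. (\<sigma>' * M * neuron a' b' z) * h z \<partial>\<mu>) < t" using neg that unfolding t_def by (meson not_le)
        then show ?thesis by (simp add: mult.assoc)
      qed
      have "\<bar>\<integral>z. neuron a' b' z * h z \<partial>\<mu>\<bar> \<le> t / M" if "norm a' \<le> 1" "\<bar>b'\<bar> \<le> R" for a' b'
        using lt[of 1 a' b'] lt[of "-1" a' b'] that M by (auto simp: field_simps abs_le_iff)
      then have "\<bar>\<integral>z. F z * h z \<partial>\<mu>\<bar> \<le> M * (t / M)"
        using hull hm hb h0 unfolding neuron_hull_def by blast
      then show False using M by (simp add: t_def)
    qed
    then obtain \<sigma>' a' b' where new: "\<bar>\<sigma>'\<bar> \<le> 1" "norm a' \<le> 1" "\<bar>b'\<bar> \<le> R"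
      "(\<integral>z. F z * h z \<partial>\<mu>) - 1 / 2 \<le> (\<integral>z. (\<sigma>' * M * neuron a' b' z) * h z \<partial>\<mu>)" by blast
    define g where "g z = \<sigma>' * M * neuron a' b' z" for z
    have gm[measurable]: "g \<in> borel_measurable borel" unfolding g_def[abs_def] by measurable
    have gb: "\<bar>g z\<bar> \<le> M * (2 * R)" if "norm z \<le> R" for z unfolding g_def using nb[OF new(1-3) that] .
    have Fg: "\<bar>F z - g z\<bar> \<le> BF + M * (2 * R)" if "norm z \<le> R" for z
      using FB[OF that] gb[OF that] by linarith
    have iFD: "integrable \<mu> (\<lambda>z. F z * ?D z)"
      by (rule ibd[where c="BF * cD"]) (use FB Db BF in \<open>auto simp: abs_mult intro!: mult_mono\<close>)
    have igD: "integrable \<mu> (\<lambda>z. g z * ?D z)"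
      by (rule ibd[where c="M * (2 * R) * cD"]) (use gb Db M R in \<open>auto simp: abs_mult intro!: mult_mono\<close>)
    have iD2: "integrable \<mu> (\<lambda>z. (?D z)\<^sup>2)"
    proof (rule ibd[where c="cD\<^sup>2"])
      show "\<bar>(?D z)\<^sup>2\<bar> \<le> cD\<^sup>2" if "norm z \<le> R" for z
        using power_mono[OF Db[OF that], of 2] by simp
    qed measurable
    have sq: "(F z - g z)\<^sup>2 \<le> (BF + M * (2 * R))\<^sup>2" if "norm z \<le> R" for z
      using power_mono[OF Fg[OF that], of 2] by simp
    have iFg: "integrable \<mu> (\<lambda>z. (F z - g z)\<^sup>2)"
      by (rule ibd[where c="(BF + M * (2 * R))\<^sup>2"]) (use sq in auto)
    define \<sigma>1 a1 b1 where "\<sigma>1 = \<sigma>(Suc n := \<sigma>')" "a1 = a(Suc n := a')" "b1 = b(Suc n := b')"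
    have D1: "D (Suc n) \<sigma>1 a1 b1 z = ?D z + (F z - g z)" for z
    proof -
      have "(\<Sum>i\<in>{1..n}. \<sigma>1 i * M * neuron (a1 i) (b1 i) z) = (\<Sum>i\<in>{1..n}. \<sigma> i * M * neuron (a i) (b i) z)"
        by (intro sum.cong) (auto simp: \<sigma>1_a1_b1_def)
      then show ?thesis by (simp add: D_def g_def \<sigma>1_a1_b1_def algebra_simps)
    qed
    have "(\<integral>z. (D (Suc n) \<sigma>1 a1 b1 z)\<^sup>2 \<partial>\<mu>) = (\<integral>z. (?D z)\<^sup>2 + 2 * (F z * ?D z) - 2 * (g z * ?D z) + (F z - g z)\<^sup>2 \<partial>\<mu>)"
      unfolding D1 by (intro Bochner_Integration.integral_cong refl) (simp add: power2_eq_square algebra_simps)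
    also have "\<dots> = (\<integral>z. (?D z)\<^sup>2 \<partial>\<mu>) + 2 * (\<integral>z. F z * ?D z \<partial>\<mu>) - 2 * (\<integral>z. g z * ?D z \<partial>\<mu>) + (\<integral>z. (F z - g z)\<^sup>2 \<partial>\<mu>)"
      using iFD igD iD2 iFg by simp
    also have "\<dots> \<le> real n * (B0 + 1) + 1 + B0"
    proof -
      have "(\<integral>z. (F z - g z)\<^sup>2 \<partial>\<mu>) \<le> (\<integral>z. (BF + M * (2 * R))\<^sup>2 \<partial>\<mu>)"
        by (rule integral_mono_AE) (use iFg conc sq in \<open>auto elim!: eventually_mono\<close>)
      then have "(\<integral>z. (F z - g z)\<^sup>2 \<partial>\<mu>) \<le> B0" by (simp add: B0_def mult.commute)
      moreover have "(\<integral>z. F z * ?D z \<partial>\<mu>) - 1 / 2 \<le> (\<integral>z. g z * ?D z \<partial>\<mu>)"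
        using new(4) hD[OF F] hD[OF gm] by (simp add: g_def)
      ultimately show ?thesis using IH(2) by linarith
    qed
    finally have "(\<integral>z. (D (Suc n) \<sigma>1 a1 b1 z)\<^sup>2 \<partial>\<mu>) \<le> real (Suc n) * (B0 + 1)" by (simp add: algebra_simps)
    moreover have "\<forall>i. \<bar>\<sigma>1 i\<bar> \<le> 1 \<and> norm (a1 i) \<le> 1 \<and> \<bar>b1 i\<bar> \<le> R"
      using IH(1) new by (auto simp: \<sigma>1_a1_b1_def)
    ultimately show ?case by blast
  qed
  then show ?thesis using that[of "B0 + 1"] unfolding D_def by meson
qed

section \<open>Stability of the flow and the main estimate\<close>

text \<open>exp(-c t) q(t) minus the integral of \<rho> up to t is nonincreasing: in its derivative
  the exponential only shrinks a positive excess q' - c q, which is at most \<rho>.\<close>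

lemma gronwall_integral:
  fixes q q' \<rho> :: "real \<Rightarrow> real"
  assumes q: "\<And>t. t \<in> {0..T} \<Longrightarrow> (q has_real_derivative q' t) (at t within {0..T})"
    and le: "\<And>t. t \<in> {0..T} \<Longrightarrow> q' t \<le> c * q t + \<rho> t"
    and \<rho>: "continuous_on {0..T} \<rho>" "\<And>t. t \<in> {0..T} \<Longrightarrow> \<rho> t \<ge> 0" and c: "c \<ge> 0"
    and q0: "q 0 \<ge> 0" and t: "t \<in> {0..T}"
  shows "q t \<le> exp (c * T) * (q 0 + integral {0..T} \<rho>)"
proof -
  define \<phi> where "\<phi> t = exp (- c * t) * q t - integral {0..t} \<rho>" for t
  have d: "(\<phi> has_real_derivative exp (- c * s) * (q' s - c * q s) - \<rho> s) (at s within {0..T})" if "s \<in> {0..T}" for s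
    unfolding \<phi>_def[abs_def]
    by (auto intro!: derivative_eq_intros q[OF that] integral_has_real_derivative[OF \<rho>(1) that] simp: algebra_simps)
  have "\<phi> t \<le> \<phi> 0"
  proof (rule DERIV_nonpos_imp_decreasing_open[where f=\<phi> and a=0 and b=t])
    show "0 \<le> t" using t by simp
    have "continuous_on {0..T} \<phi>"
      using d by (meson DERIV_continuous continuous_on_eq_continuous_within)
    then show "continuous_on {0..t} \<phi>" by (rule continuous_on_subset) (use t in auto)
    fix s assume s: "0 < s" "s < t"
    have "s \<in> {0..T}" using s t by auto
    have "(\<phi> has_real_derivative exp (- c * s) * (q' s - c * q s) - \<rho> s) (at s)"
      using d[OF \<open>s \<in> {0..T}\<close>] s t by (subst (asm) at_within_Icc_at) auto
    moreover have "exp (- c * s) * (q' s - c * q s) \<le> 1 * \<rho> s"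
    proof (cases "q' s - c * q s \<ge> 0")
      case True
      then show ?thesis using le[OF \<open>s \<in> {0..T}\<close>] c s by (intro mult_mono) auto
    next
      case False
      then have "exp (- c * s) * (q' s - c * q s) \<le> 0" by (intro mult_nonneg_nonpos) auto
      then show ?thesis using \<rho>(2)[OF \<open>s \<in> {0..T}\<close>] by linarith
    qed
    ultimately show "\<exists>y. (\<phi> has_real_derivative y) (at s) \<and> y \<le> 0" by auto
  qed
  then have "exp (- c * t) * q t \<le> q 0 + integral {0..t} \<rho>" by (simp add: \<phi>_def)
  also have "integral {0..t} \<rho> \<le> integral {0..T} \<rho>"
  proof (rule integral_subset_le)
    show "\<rho> integrable_on {0..t}" "\<rho> integrable_on {0..T}"
      using t by (auto intro!: integrable_continuous_real intro: continuous_on_subset[OF \<rho>(1)])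
  qed (use t \<rho> in auto)
  finally have 1: "exp (- c * t) * q t \<le> q 0 + integral {0..T} \<rho>" by simp
  have I: "integral {0..T} \<rho> \<ge> 0"
    by (rule integral_nonneg) (use \<rho> integrable_continuous_real in auto)
  have "q t = exp (c * t) * (exp (- c * t) * q t)" by (simp add: mult.assoc[symmetric] exp_add[symmetric])
  also have "\<dots> \<le> exp (c * t) * (q 0 + integral {0..T} \<rho>)" using 1 by (intro mult_left_mono) auto
  also have "\<dots> \<le> exp (c * T) * (q 0 + integral {0..T} \<rho>)"
    using t c I q0 by (intro mult_right_mono) (auto intro!: mult_left_mono)
  finally show ?thesis .
qed

text \<open>The difference of the two velocities is split at g along z: the defect f - g is then
  evaluated on z alone, so no a priori bound on x enters, and the rest is controlled by the
  Lipschitz constant. The estimate 2 |w| |r| \<le> |w|^2 + |r|^2 gives the 1 in the rate 2 V +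
  1.\<close>

lemma ode_comparison:
  fixes f g :: "real^'d \<Rightarrow> real \<Rightarrow> real^'d"
  assumes z: "solves_ode_on T f z0 z" and x: "solves_ode_on T g x0 x"
    and g: "\<And>y w s. s \<in> {0..T} \<Longrightarrow> norm (g y s - g w s) \<le> V * norm (y - w)" and V: "V \<ge> 0"
    and \<rho>: "continuous_on {0..T} (\<lambda>s. (norm (f (z s) s - g (z s) s))\<^sup>2)" and t: "t \<in> {0..T}"
  shows "(norm (z t - x t))\<^sup>2 \<le> exp ((2 * V + 1) * T) * ((norm (z0 - x0))\<^sup>2 + integral {0..T} (\<lambda>s. (norm (f (z s) s - g (z s) s))\<^sup>2))"
proof -
  define q where "q s = (norm (z s - x s))\<^sup>2" for s
  define q' where "q' s = 2 * ((z s - x s) \<bullet> (f (z s) s - g (x s) s))" for s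
  have "q t \<le> exp ((2 * V + 1) * T) * (q 0 + integral {0..T} (\<lambda>s. (norm (f (z s) s - g (z s) s))\<^sup>2))"
  proof (rule gronwall_integral[OF _ _ \<rho>])
    fix s assume s: "s \<in> {0..T}"
    have "((\<lambda>s. z s - x s) has_vector_derivative (f (z s) s - g (x s) s)) (at s within {0..T})"
      using z x s unfolding solves_ode_on_def by (auto intro!: has_vector_derivative_diff)
    note d = this[unfolded has_vector_derivative_def]
    from has_derivative_inner[OF d d] show "(q has_real_derivative q' s) (at s within {0..T})"
      unfolding q_def[abs_def] q'_def has_field_derivative_def power2_norm_eq_inner
      by (rule has_derivative_eq_rhs) (auto simp: fun_eq_iff inner_commute)
    let ?w = "z s - x s" and ?r = "f (z s) s - g (z s) s"
    have "q' s = 2 * (?w \<bullet> ?r) + 2 * (?w \<bullet> (g (z s) s - g (x s) s))"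
      by (simp add: q'_def inner_diff_right)
    also have "?w \<bullet> ?r \<le> norm ?w * norm ?r" by (rule norm_cauchy_schwarz)
    also have "?w \<bullet> (g (z s) s - g (x s) s) \<le> norm ?w * (V * norm ?w)"
      by (rule order_trans[OF norm_cauchy_schwarz mult_left_mono[OF g[OF s]]]) simp
    also have "2 * (norm ?w * norm ?r) \<le> (norm ?w)\<^sup>2 + (norm ?r)\<^sup>2"
      using sum_squares_bound[of "norm ?w" "norm ?r"] by simp
    finally show "q' s \<le> (2 * V + 1) * q s + (norm ?r)\<^sup>2"
      by (simp add: q_def algebra_simps power2_eq_square)
  qed (use V t in \<open>auto simp: q_def\<close>)
  then show ?thesis using z x by (simp add: q_def solves_ode_on_def)
qed

text \<open>Uniformity of L in t combines the separate continuities: the increment in x is estimated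
  at the moving time, the increment in t at the fixed point.\<close>

lemma lipschitz_continuous_jointly:
  fixes g :: "'a::metric_space \<Rightarrow> 'c::metric_space \<Rightarrow> 'b::metric_space"
  assumes lip: "\<And>x y t. t \<in> I \<Longrightarrow> dist (g x t) (g y t) \<le> L * dist x y"
    and c: "\<And>x. continuous_on I (g x)" and L: "L \<ge> 0"
  shows "continuous_on (UNIV \<times> I) (\<lambda>(x, t). g x t)"
  unfolding continuous_on_iff
proof (intro ballI allI impI)
  fix p :: "'a \<times> 'c" and e :: real assume p: "p \<in> UNIV \<times> I" and e: "e > 0"
  obtain x t where xt: "p = (x, t)" "t \<in> I" using p by auto
  obtain d where d: "d > 0" "\<And>s. s \<in> I \<Longrightarrow> dist s t < d \<Longrightarrow> dist (g x s) (g x t) < e / 2"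
    using c[of x] xt(2) e unfolding continuous_on_iff by (metis half_gt_zero)
  define d' where "d' = min d (e / (2 * (L + 1)))"
  have "d' > 0" using d e L by (simp add: d'_def)
  moreover have "dist (case p' of (x, t) \<Rightarrow> g x t) (case p of (x, t) \<Rightarrow> g x t) < e" if p': "p' \<in> UNIV \<times> I" "dist p' p < d'" for p'
  proof -
    obtain y s where ys: "p' = (y, s)" "s \<in> I" using p' by auto
    have "dist y x < d'" "dist s t < d'"
      using p'(2) dist_fst_le[of p' p] dist_snd_le[of p' p] by (auto simp: xt ys)
    then have 1: "dist y x \<le> e / (2 * (L + 1))" and 2: "dist s t < d" by (auto simp: d'_def)
    have "dist (g y s) (g x s) \<le> L * (e / (2 * (L + 1)))"
      using lip[OF ys(2), of y x] mult_left_mono[OF 1 L] by linarith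
    also have "\<dots> \<le> e / 2" using L e by (simp add: field_simps)
    finally have "dist (g y s) (g x s) \<le> e / 2" .
    moreover have "dist (g x s) (g x t) < e / 2" by (rule d(2)[OF ys(2) 2])
    ultimately show ?thesis using dist_triangle[of "g y s" "g x t" "g x s"] by (simp add: xt ys)
  qed
  ultimately show "\<exists>d>0. \<forall>x'\<in>UNIV \<times> I. dist x' p < d \<longrightarrow> dist (case x' of (x, t) \<Rightarrow> g x t) (case p of (x, t) \<Rightarrow> g x t) < e"
    by blast
qed

text \<open>Comparing the equation with itself leaves no defect and yields Lipschitz dependence on
  the initial value. Joint continuity makes the set swept out by trajectories from K
  compact.\<close>

lemma ode_flow_continuous:
  fixes f :: "real^'d \<Rightarrow> real \<Rightarrow> real^'d"
  assumes Z: "\<And>z0. solves_ode_on T f z0 (Z z0)"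
    and f: "\<And>y w s. s \<in> {0..T} \<Longrightarrow> norm (f y s - f w s) \<le> L * norm (y - w)" and L: "L \<ge> 0"
  shows "continuous_on (UNIV \<times> {0..T}) (\<lambda>(z0, t). Z z0 t)"
proof (rule lipschitz_continuous_jointly)
  define E where "E = sqrt (exp ((2 * L + 1) * T))"
  show "E \<ge> 0" by (simp add: E_def)
  show "dist (Z x t) (Z y t) \<le> E * dist x y" if t: "t \<in> {0..T}" for x y t
  proof -
    have "(norm (Z x t - Z y t))\<^sup>2 \<le> exp ((2 * L + 1) * T) * ((norm (x - y))\<^sup>2 + integral {0..T} (\<lambda>s. (norm (f (Z x s) s - f (Z x s) s))\<^sup>2))"
      by (rule ode_comparison[OF Z Z f L _ t]) auto
    also have "\<dots> = (E * norm (x - y))\<^sup>2" by (simp add: E_def power_mult_distrib)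
    finally show ?thesis unfolding dist_norm by (rule power2_le_imp_le) (simp add: E_def)
  qed
  show "continuous_on {0..T} (Z x)" for x
    using Z[of x] unfolding solves_ode_on_def
    by (meson has_vector_derivative_continuous continuous_on_eq_continuous_within)
qed

text \<open>The conclusion names F rather than u because F is continuous on the whole space, hence
  measurable for \<mu>, while u is controlled on the slab only. The unnormalised greedy bound n B
  becomes n B / n^2 after division by n, and the coefficients, at most M/n each, have total mass at
  most M, which will bound the Lipschitz constant.\<close>

lemma neuron_approximation:
  fixes u :: "(real^'d::finite) \<times> real \<Rightarrow> real" and \<mu> :: "((real^'d) \<times> real) measure"
  assumes u: "Hk_loc_scalar k T u" and k: "real k > (real CARD('d) + 1) / 2 + 2" and T: "T > 0"
    and cont: "continuous_on (UNIV \<times> {0..T}) u" and X: "compact X" "X \<subseteq> UNIV \<times> {0..T}"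
    and \<mu>: "finite_measure \<mu>" "sets \<mu> = sets borel" "AE z in \<mu>. z \<in> X"
  obtains F M B where "continuous_on UNIV F" "\<And>z. z \<in> X \<Longrightarrow> F z = u z" "M > 0"
    "\<And>n. n \<ge> 1 \<Longrightarrow> \<exists>\<sigma> a b. (\<forall>i. \<bar>\<sigma> i\<bar> \<le> 1 \<and> norm (a i) \<le> 1) \<and>
      (\<integral>z. (F z - (\<Sum>i\<in>{1..n}. (\<sigma> i * M / real n) * neuron (a i) (b i) z))\<^sup>2 \<partial>\<mu>) \<le> B / real n"
proof -
  obtain R0 where R0: "\<And>z. z \<in> X \<Longrightarrow> norm z \<le> R0"
    using compact_imp_bounded[OF X(1)] by (auto simp: bounded_iff)
  define R where "R = max 1 R0"
  have R: "R \<ge> 1" "\<And>z. z \<in> X \<Longrightarrow> norm z \<le> R" using R0 by (auto simp: R_def le_max_iff_disj)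
  have R1: "R > 0" using R(1) by linarith
  have "0 \<le> (real CARD('d) + 1) / 2" by simp
  then have "real k > 1" using k by linarith
  then have k1: "k \<ge> 1" by simp
  have D: "DIM((real^'d) \<times> real) = CARD('d) + 1" by simp
  \<comment> \<open>Between integers the strict inequality 2 k > d + 5 improves to 2 k \<ge> d + 6,
    that is, the dimension d + 1 plus 5.\<close>
  have "2 * real k > real (CARD('d) + 1) + 4" using k by (simp add: field_simps)
  then have k2: "2 * k \<ge> DIM((real^'d) \<times> real) + 5" unfolding D by linarith
  obtain F :: "(real^'d) \<times> real \<Rightarrow> real" and C where F: "compact C" "continuous_on UNIV F" "\<And>e. e \<in> Basis \<Longrightarrow> schain C e k F"
    "\<And>z. z \<in> cball 0 R \<times> {0..T} \<Longrightarrow> F z = u z"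
    by (rule compactly_supported_extension[OF u k1 T R1 cont]) (rule that, assumption, assumption, blast, blast)
  have FX: "F z = u z" if "z \<in> X" for z
  proof (rule F(4))
    have "norm (fst z) \<le> norm z" by (metis norm_fst_le prod.collapse)
    then show "z \<in> cball 0 R \<times> {0..T}" using R(2)[OF that] X(2) that by (auto simp: mem_Times_iff)
  qed
  obtain \<kappa> M0 :: real and a b :: "(real^'d) \<times> real \<Rightarrow> real" where ab: "\<kappa> > 0"
    "\<And>A. finite A \<Longrightarrow> A \<subseteq> lattice_pts \<Longrightarrow> (\<Sum>m\<in>A. (1 + norm m)\<^sup>2 * (\<bar>a m\<bar> + \<bar>b m\<bar>)) \<le> M0"
    "\<And>\<epsilon>. \<epsilon> > 0 \<Longrightarrow> \<exists>A. finite A \<and> A \<subseteq> lattice_pts \<and> (\<forall>z\<in>cball 0 R. \<bar>F z - (\<Sum>m\<in>A. a m * cos (\<kappa> * (m \<bullet> z)) + b m * sin (\<kappa> * (m \<bullet> z)))\<bar> < \<epsilon>)"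
  proof (rule fourier_approximation[OF F(1-3) k2 R1])
    fix \<kappa> M0 :: real and a b :: "(real^'d) \<times> real \<Rightarrow> real"
    assume h: "\<kappa> > 0"
      "\<And>A. finite A \<Longrightarrow> A \<subseteq> lattice_pts \<Longrightarrow> (\<Sum>m\<in>A. (1 + norm m)\<^sup>2 * (\<bar>a m\<bar> + \<bar>b m\<bar>)) \<le> M0"
      "\<And>\<epsilon>. \<epsilon> > 0 \<Longrightarrow> \<exists>A. finite A \<and> A \<subseteq> lattice_pts \<and> (\<forall>z\<in>cball 0 R. \<bar>F z - (\<Sum>m\<in>A. a m * cos (\<kappa> * (m \<bullet> z)) + b m * sin (\<kappa> * (m \<bullet> z)))\<bar> < \<epsilon>)"
    show thesis by (rule that[OF h])
  qed
  have Fm: "F \<in> borel_measurable borel" by (rule borel_measurable_continuous_onI[OF F(2)])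
  have "compact (F ` cball 0 R)" by (intro compact_continuous_image continuous_on_subset[OF F(2)]) auto
  then obtain BF where BF: "\<And>z. norm z \<le> R \<Longrightarrow> \<bar>F z\<bar> \<le> BF"
    using compact_imp_bounded by (fastforce simp: bounded_iff)
  have hull0: "neuron_hull \<mu> R ((1 + \<kappa> + 2 * R * \<kappa>\<^sup>2) * M0) F"
    by (rule neuron_hull_trig_limit[OF \<mu>(1,2) R(1) ab(1) Fm BF ab(2,3)])
  \<comment> \<open>Enlarged to a positive number, since the greedy step divides by it; hull
    membership is monotone in the constant because s \<ge> 0.\<close>
  define M where "M = \<bar>(1 + \<kappa> + 2 * R * \<kappa>\<^sup>2) * M0\<bar> + 1"
  have M: "M > 0" by (simp add: M_def)
  have hull: "neuron_hull \<mu> R M F"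
    unfolding neuron_hull_def
  proof (intro allI impI)
    fix h s
    assume h: "h \<in> borel_measurable borel" "\<exists>c. \<forall>z. \<bar>h z\<bar> \<le> c" "\<forall>z. R < norm z \<longrightarrow> h z = 0"
      and s: "\<forall>a b. norm a \<le> 1 \<longrightarrow> \<bar>b\<bar> \<le> R \<longrightarrow> \<bar>\<integral>z. neuron a b z * h z \<partial>\<mu>\<bar> \<le> s"
    have s0: "s \<ge> 0" using s[rule_format, of 0 0] R by (smt (verit) norm_zero abs_ge_zero)
    have "\<bar>\<integral>z. F z * h z \<partial>\<mu>\<bar> \<le> (1 + \<kappa> + 2 * R * \<kappa>\<^sup>2) * M0 * s"
      using hull0 h s unfolding neuron_hull_def by blast
    also have "\<dots> \<le> M * s" using s0 by (intro mult_right_mono) (auto simp: M_def)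
    finally show "\<bar>\<integral>z. F z * h z \<partial>\<mu>\<bar> \<le> M * s" .
  qed
  have conc: "AE z in \<mu>. norm z \<le> R" using \<mu>(3) by eventually_elim (rule R(2))
  obtain B where B: "\<And>n. \<exists>\<sigma> a b. (\<forall>i. \<bar>\<sigma> i\<bar> \<le> 1 \<and> norm (a i) \<le> 1) \<and>
    (\<integral>z. (real n * F z - (\<Sum>i\<in>{1..n}. \<sigma> i * M * neuron (a i) (b i) z))\<^sup>2 \<partial>\<mu>) \<le> real n * B"
    by (rule greedy_neurons[OF \<mu>(1,2) R(1) conc Fm BF hull M]) (assumption, rule that, blast)
  have "\<exists>\<sigma> a b. (\<forall>i. \<bar>\<sigma> i\<bar> \<le> 1 \<and> norm (a i) \<le> 1) \<and>
      (\<integral>z. (F z - (\<Sum>i\<in>{1..n}. (\<sigma> i * M / real n) * neuron (a i) (b i) z))\<^sup>2 \<partial>\<mu>) \<le> B / real n" if n: "n \<ge> 1" for n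
  proof -
    obtain \<sigma> a b where sab: "\<And>i. \<bar>\<sigma> i\<bar> \<le> 1 \<and> norm (a i) \<le> 1"
      "(\<integral>z. (real n * F z - (\<Sum>i\<in>{1..n}. \<sigma> i * M * neuron (a i) (b i) z))\<^sup>2 \<partial>\<mu>) \<le> real n * B"
      using B[of n] by blast
    have "(F z - (\<Sum>i\<in>{1..n}. (\<sigma> i * M / real n) * neuron (a i) (b i) z)) = (real n * F z - (\<Sum>i\<in>{1..n}. \<sigma> i * M * neuron (a i) (b i) z)) / real n" for z
      using n by (simp add: diff_divide_distrib sum_divide_distrib)
    then have "(\<integral>z. (F z - (\<Sum>i\<in>{1..n}. (\<sigma> i * M / real n) * neuron (a i) (b i) z))\<^sup>2 \<partial>\<mu>) = (\<integral>z. (real n * F z - (\<Sum>i\<in>{1..n}. \<sigma> i * M * neuron (a i) (b i) z))\<^sup>2 \<partial>\<mu>) / (real n)\<^sup>2"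
      by (simp add: power_divide)
    also have "\<dots> \<le> real n * B / (real n)\<^sup>2" using sab(2) by (intro divide_right_mono) auto
    also have "\<dots> = B / real n" using n by (simp add: power2_eq_square)
    finally show ?thesis using sab(1) by blast
  qed
  then show ?thesis using that[OF F(2) FX M, of B] by blast
qed

text \<open>ReLU and the Hadamard product act componentwise, so the j-th rows and entries of the
  parameters form a scalar network for component j, independent of the other components. Hence one
  scalar network of width P per component fits into P vector neurons.\<close>

lemma relu_field_nth:
  fixes a :: "'d::finite \<Rightarrow> nat \<Rightarrow> (real^'d) \<times> real" and b c :: "'d \<Rightarrow> nat \<Rightarrow> real"
  shows "relu_field P (\<lambda>i. \<chi> j. c j i) (\<lambda>i. \<chi> j. fst (a j i)) (\<lambda>i. \<chi> j. snd (a j i)) (\<lambda>i. \<chi> j. b j i) x t $ j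
    = (\<Sum>i\<in>{1..P}. c j i * neuron (a j i) (b j i) (x, t))"
  by (simp add: relu_field_def hadamard_def relu_vec_def neuron_def matrix_vector_mult_def inner_prod_def
      inner_vec_def mult.commute)

theorem theorem2p2:
  fixes f :: "real^'d \<Rightarrow> real \<Rightarrow> real^'d" and T :: real and K :: "(real^'d) set"
  assumes T_pos: "T > 0"
    and cont_t: "\<forall>x. continuous_on {0..T} (\<lambda>t. f x t)"
    and lipschitz: "\<exists>L>0. \<forall>x y. \<forall>t\<in>{0..T}. norm (f x t - f y t) \<le> L * norm (x - y)"
    and sobolev: "\<exists>k::nat. real k > (real CARD('d) + 1) / 2 + 2 \<and> Hk_loc k T f"
    and K_compact: "compact K"
  shows "\<exists>C::real. \<forall>P::nat. P \<ge> 1 \<longrightarrow>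
           (\<exists>(W :: nat \<Rightarrow> real^'d) (A1 :: nat \<Rightarrow> real^'d^'d) (A2 :: nat \<Rightarrow> real^'d) (B :: nat \<Rightarrow> real^'d).
              \<forall>Z X :: real^'d \<Rightarrow> real \<Rightarrow> real^'d.
                 (\<forall>z0. solves_ode_on T f z0 (Z z0)) \<and>
                 (\<forall>z0. solves_ode_on T (relu_field P W A1 A2 B) z0 (X z0)) \<longrightarrow>
                 (\<forall>t\<in>{0..T}.
                    set_nn_integral lborel K (\<lambda>z0. ennreal ((norm (Z z0 t - X z0 t))\<^sup>2))
                      \<le> ennreal (C / real P)))"
proof (cases "\<exists>Z :: real^'d \<Rightarrow> real \<Rightarrow> real^'d. \<forall>z0. solves_ode_on T f z0 (Z z0)")
  case True
  \<comment> \<open>A flow is fixed at the outset: the measure \<mu> is defined from it, and the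
    flow quantified in the goal agrees with it by uniqueness.\<close>
  then obtain Z where Z: "\<And>z0. solves_ode_on T f z0 (Z z0)" by blast
  obtain L where L: "L > 0" "\<And>t x y. t \<in> {0..T} \<Longrightarrow> norm (f x t - f y t) \<le> L * norm (x - y)"
    using lipschitz by blast
  obtain k where k: "real k > (real CARD('d) + 1) / 2 + 2" "Hk_loc k T f" using sobolev by blast
  have cf: "continuous_on (UNIV \<times> {0..T}) (\<lambda>(x, t). f x t)"
    by (rule lipschitz_continuous_jointly[where L=L]) (use L cont_t in \<open>auto simp: dist_norm\<close>)
  have cZ: "continuous_on (UNIV \<times> {0..T}) (\<lambda>(z0, t). Z z0 t)"
    by (rule ode_flow_continuous[OF Z L(2)]) (use L in auto)
  define Y where "Y = K \<times> {0..T}"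
  define p where "p y = (Z (fst y) (snd y), snd y)" for y
  have Y: "compact Y" unfolding Y_def by (intro compact_Times K_compact compact_Icc)
  have cp: "continuous_on (UNIV \<times> {0..T}) p"
    unfolding p_def[abs_def] using cZ by (intro continuous_intros) (simp add: split_def)
  have YU: "Y \<subseteq> UNIV \<times> {0..T}" by (auto simp: Y_def)
  define X0 where "X0 = p ` Y"
  have X0: "compact X0" "X0 \<subseteq> UNIV \<times> {0..T}"
    unfolding X0_def using continuous_on_subset[OF cp YU] Y
    by (auto intro: compact_continuous_image simp: p_def Y_def)
  have [measurable]: "Y \<in> sets borel" "X0 \<in> sets borel" "K \<in> sets borel"
    using Y X0 K_compact borel_compact by blast+
  \<comment> \<open>The flow is controlled on the closed time interval only, so p is cut off by zero
    outside Y to be Borel on the whole space.\<close>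
  define p' where "p' y = indicator Y y *\<^sub>R p y" for y
  have p'm [measurable]: "p' \<in> borel_measurable borel"
    unfolding p'_def[abs_def] by (intro borel_measurable_continuous_on_indicator continuous_on_subset[OF cp YU]) measurable
  text \<open>The law of the point \<open>(Z z0 s, s)\<close> when \<open>(z0, s)\<close> is uniform on \<open>K \<times> {0..T}\<close>: approximating f in
    mean square under it is all that the Gronwall estimate below requires.\<close>
  define \<mu> where "\<mu> = distr (density lborel (indicator Y)) borel p'"
  have \<mu>s: "sets \<mu> = sets borel" by (simp add: \<mu>_def)
  have \<mu>int: "(\<integral>\<^sup>+z. g z \<partial>\<mu>) = (\<integral>\<^sup>+y. indicator Y y * g (p y) \<partial>lborel)" if [measurable]: "g \<in> borel_measurable borel" for g
  proof -
    have "(\<integral>\<^sup>+z. g z \<partial>\<mu>) = (\<integral>\<^sup>+y. indicator Y y * g (p' y) \<partial>lborel)"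
      unfolding \<mu>_def by (simp add: nn_integral_distr nn_integral_density)
    also have "\<dots> = (\<integral>\<^sup>+y. indicator Y y * g (p y) \<partial>lborel)"
      by (intro nn_integral_cong) (auto simp: p'_def indicator_def)
    finally show ?thesis .
  qed
  have \<mu>f: "finite_measure \<mu>"
  proof (rule finite_measureI)
    have "emeasure \<mu> (space \<mu>) = (\<integral>\<^sup>+z. 1 \<partial>\<mu>)" by simp
    also have "\<dots> = emeasure lborel Y" by (subst \<mu>int) auto
    finally show "emeasure \<mu> (space \<mu>) \<noteq> \<infinity>" using emeasure_compact_finite[OF Y] by (simp add: less_top)
  qed
  have \<mu>X: "AE z in \<mu>. z \<in> X0"
    unfolding \<mu>_def
  proof (subst AE_distr_iff)
    show "AE y in density lborel (indicator Y). p' y \<in> X0"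
    proof (subst AE_density)
      have "0 < (indicator Y y :: ennreal) \<longrightarrow> p' y \<in> X0" for y
        by (cases "y \<in> Y") (simp_all add: p'_def X0_def)
      then show "AE y in lborel. 0 < (indicator Y y :: ennreal) \<longrightarrow> p' y \<in> X0" by (intro AE_I2)
    qed simp
  qed auto
  define good where "good j F M B \<longleftrightarrow> continuous_on UNIV F \<and> (\<forall>z\<in>X0. F z = f (fst z) (snd z) $ j) \<and> M > 0 \<and>
    (\<forall>n\<ge>1. \<exists>\<sigma> a b. (\<forall>i. \<bar>\<sigma> i\<bar> \<le> 1 \<and> norm (a i) \<le> 1) \<and>
      (\<integral>z. (F z - (\<Sum>i\<in>{1..n}. (\<sigma> i * M / real n) * neuron (a i) (b i) z))\<^sup>2 \<partial>\<mu>) \<le> B / real n)"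
    for j F and M B :: real
  have "\<exists>F M B. good j F M B" for j
  proof -
    have u: "Hk_loc_scalar k T (\<lambda>z. f (fst z) (snd z) $ j)" using k(2) by (simp add: Hk_loc_def split_def)
    have c: "continuous_on (UNIV \<times> {0..T}) (\<lambda>z. f (fst z) (snd z) $ j)"
      using cf by (intro continuous_intros) (simp add: split_def)
    show ?thesis
      by (rule neuron_approximation[OF u k(1) T_pos c X0 \<mu>f \<mu>s \<mu>X]) (unfold good_def, blast)
  qed
  then obtain F M B where good: "\<And>j. good j (F j) (M j) (B j)" by metis
  have F: "\<And>j. continuous_on UNIV (F j)" "\<And>j z. z \<in> X0 \<Longrightarrow> F j z = f (fst z) (snd z) $ j"
    and M: "\<And>j. M j > 0"
    using good unfolding good_def by blast+
  \<comment> \<open>Sum of the componentwise coefficient masses; it bounds the Lipschitz constant of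
    the network for every P.\<close>
  define V where "V = (\<Sum>j\<in>UNIV. M j)"
  have V: "V \<ge> 0" unfolding V_def by (intro sum_nonneg) (use M in \<open>auto intro: less_imp_le\<close>)
  define e where "e = exp ((2 * V + 1) * T)"
  show ?thesis
  proof (rule exI[of _ "e * (\<Sum>j\<in>UNIV. B j)"], intro allI impI)
    fix P :: nat assume P: "P \<ge> 1"
    define netP where "netP j \<sigma> a b \<longleftrightarrow> (\<forall>i. \<bar>\<sigma> i\<bar> \<le> 1 \<and> norm (a i) \<le> 1) \<and>
      (\<integral>z. (F j z - (\<Sum>i\<in>{1..P}. (\<sigma> i * M j / real P) * neuron (a i) (b i) z))\<^sup>2 \<partial>\<mu>) \<le> B j / real P" for j \<sigma> a b
    have "\<exists>\<sigma> a b. netP j \<sigma> a b" for j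
      using good[of j] P unfolding good_def netP_def by blast
    then obtain \<sigma> a b where "\<And>j. netP j (\<sigma> j) (a j) (b j)" by metis
    then have sab: "\<And>j i. \<bar>\<sigma> j i\<bar> \<le> 1 \<and> norm (a j i) \<le> 1"
      "\<And>j. (\<integral>z. (F j z - (\<Sum>i\<in>{1..P}. (\<sigma> j i * M j / real P) * neuron (a j i) (b j i) z))\<^sup>2 \<partial>\<mu>) \<le> B j / real P"
      unfolding netP_def by blast+
    define net where "net j z = (\<Sum>i\<in>{1..P}. (\<sigma> j i * M j / real P) * neuron (a j i) (b j i) z)" for j z
    define g where "g = relu_field P (\<lambda>i. \<chi> j. \<sigma> j i * M j / real P) (\<lambda>i. \<chi> j. fst (a j i)) (\<lambda>i. \<chi> j. snd (a j i)) (\<lambda>i. \<chi> j. b j i)"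
    have gn: "g x t $ j = net j (x, t)" for x t j
      unfolding g_def net_def by (rule relu_field_nth)
    have cnet: "continuous_on UNIV (net j)" for j
      unfolding net_def[abs_def] by (intro continuous_on_sum continuous_on_mult continuous_on_const continuous_neuron)
    \<comment> \<open>Weights of norm at most 1 make each neuron 1-Lipschitz, and P coefficients of
      size at most M_j/P add up to at most M_j.\<close>
    have glip: "norm (g y s - g w s) \<le> V * norm (y - w)" for y w s
    proof -
      have "\<bar>g y s $ j - g w s $ j\<bar> \<le> M j * norm (y - w)" for j
      proof -
        have "\<bar>g y s $ j - g w s $ j\<bar> = \<bar>\<Sum>i\<in>{1..P}. (\<sigma> j i * M j / real P) * (neuron (a j i) (b j i) (y, s) - neuron (a j i) (b j i) (w, s))\<bar>"
          unfolding gn net_def by (simp add: sum_subtractf[symmetric] right_diff_distrib)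
        also have "\<dots> \<le> (\<Sum>i\<in>{1..P}. M j / real P * norm (y - w))"
        proof (rule order_trans[OF sum_abs sum_mono])
          fix i
          have "\<bar>neuron (a j i) (b j i) (y, s) - neuron (a j i) (b j i) (w, s)\<bar> \<le> norm (a j i) * norm ((y, s) - (w, s))"
            by (rule neuron_lipschitz)
          also have "\<dots> \<le> 1 * norm (y - w)" using sab(1)[of j i] by (intro mult_mono) (auto simp: norm_Pair)
          finally have 1: "\<bar>neuron (a j i) (b j i) (y, s) - neuron (a j i) (b j i) (w, s)\<bar> \<le> norm (y - w)" by simp
          have 2: "\<bar>\<sigma> j i * M j / real P\<bar> \<le> M j / real P"
            using sab(1)[of j i] M[of j] P by (simp add: abs_mult divide_right_mono)
          show "\<bar>\<sigma> j i * M j / real P * (neuron (a j i) (b j i) (y, s) - neuron (a j i) (b j i) (w, s))\<bar> \<le> M j / real P * norm (y - w)"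
            unfolding abs_mult[of "\<sigma> j i * M j / real P"] using 1 2 M[of j] by (intro mult_mono) auto
        qed
        also have "\<dots> = M j * norm (y - w)" using P by simp
        finally show ?thesis .
      qed
      then have "(\<Sum>j\<in>UNIV. \<bar>(g y s - g w s) $ j\<bar>) \<le> (\<Sum>j\<in>UNIV. M j * norm (y - w))"
        by (intro sum_mono) simp
      then show ?thesis using norm_le_l1_cart[of "g y s - g w s"] by (simp add: V_def sum_distrib_right)
    qed
    define H where "H y = (norm (f (Z (fst y) (snd y)) (snd y) - g (Z (fst y) (snd y)) (snd y)))\<^sup>2" for y
    have HY: "H y = (\<Sum>j\<in>UNIV. (F j (p y) - net j (p y))\<^sup>2)" if "y \<in> Y" for y
    proof -
      have "p y \<in> X0" using that by (simp add: X0_def)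
      then have "F j (p y) = f (Z (fst y) (snd y)) (snd y) $ j" for j using F(2) by (simp add: p_def)
      moreover have "H y = (\<Sum>j\<in>UNIV. (f (Z (fst y) (snd y)) (snd y) $ j - g (Z (fst y) (snd y)) (snd y) $ j)\<^sup>2)"
        unfolding H_def power2_norm_eq_inner inner_vec_def by (simp add: power2_eq_square)
      ultimately show ?thesis by (simp add: gn p_def)
    qed
    have cH: "continuous_on Y H"
    proof (rule continuous_on_eq)
      have "continuous_on Y p" by (rule continuous_on_subset[OF cp YU])
      then show "continuous_on Y (\<lambda>y. \<Sum>j\<in>UNIV. (F j (p y) - net j (p y))\<^sup>2)"
        by (intro continuous_intros continuous_on_compose2[OF F(1)] continuous_on_compose2[OF cnet]) auto
    qed (simp add: HY)
    have cH1: "continuous_on {0..T} (\<lambda>s. H (z0, s))" if "z0 \<in> K" for z0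
      by (rule continuous_on_compose2[OF cH]) (use that in \<open>auto simp: Y_def intro!: continuous_intros\<close>)
    have Hm: "(\<lambda>y. indicator Y y * H y) \<in> borel_measurable borel"
      using borel_measurable_continuous_on_indicator[OF _ cH] by simp
    have H0: "H y \<ge> 0" for y by (simp add: H_def)
    \<comment> \<open>The change of variables to \<mu> turns the total defect into the sum of the
      componentwise mean square errors, each of order 1/P.\<close>
    have total: "(\<integral>\<^sup>+y. ennreal (indicator Y y * H y) \<partial>lborel) \<le> ennreal ((\<Sum>j\<in>UNIV. B j) / real P)"
    proof -
      have int: "(\<integral>\<^sup>+z. ennreal ((F j z - net j z)\<^sup>2) \<partial>\<mu>) \<le> ennreal (B j / real P)" for j
      proof -
        interpret finite_measure \<mu> by (rule \<mu>f)
        have c: "continuous_on UNIV (\<lambda>z. (F j z - net j z)\<^sup>2)" by (intro continuous_intros F cnet)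
        have m: "(\<lambda>z. (F j z - net j z)\<^sup>2) \<in> borel_measurable \<mu>"
          using borel_measurable_continuous_onI[OF c] by (simp add: measurable_cong_sets[OF \<mu>s refl])
        have "bounded ((\<lambda>z. (F j z - net j z)\<^sup>2) ` X0)"
          using c X0 by (intro compact_imp_bounded compact_continuous_image) (auto intro: continuous_on_subset)
        then obtain c0 where "\<And>z. z \<in> X0 \<Longrightarrow> norm ((F j z - net j z)\<^sup>2) \<le> c0" by (auto simp: bounded_iff)
        then have "AE z in \<mu>. norm ((F j z - net j z)\<^sup>2) \<le> c0" using \<mu>X by (auto elim: eventually_mono)
        from integrable_const_bound[OF this m]
        have "(\<integral>\<^sup>+z. ennreal ((F j z - net j z)\<^sup>2) \<partial>\<mu>) = ennreal (\<integral>z. (F j z - net j z)\<^sup>2 \<partial>\<mu>)"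
          by (rule nn_integral_eq_integral) simp
        also have "\<dots> \<le> ennreal (B j / real P)" using sab(2)[of j] by (intro ennreal_leI) (simp add: net_def)
        finally show ?thesis .
      qed
      have Bp: "B j / real P \<ge> 0" for j
        using sab(2)[of j] by (rule order_trans[rotated]) (rule Bochner_Integration.integral_nonneg, simp)
      have gm: "(\<lambda>z. \<Sum>j\<in>UNIV. ennreal ((F j z - net j z)\<^sup>2)) \<in> borel_measurable borel"
        by (intro borel_measurable_sum measurable_compose[OF _ measurable_ennreal] borel_measurable_continuous_onI continuous_intros F cnet)
      have gm1: "(\<lambda>z. ennreal ((F j z - net j z)\<^sup>2)) \<in> borel_measurable \<mu>" for j
        unfolding measurable_cong_sets[OF \<mu>s refl]
        by (intro measurable_compose[OF _ measurable_ennreal] borel_measurable_continuous_onI continuous_intros F cnet)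
      have "(\<integral>\<^sup>+y. ennreal (indicator Y y * H y) \<partial>lborel) = (\<integral>\<^sup>+y. indicator Y y * (\<Sum>j\<in>UNIV. ennreal ((F j (p y) - net j (p y))\<^sup>2)) \<partial>lborel)"
        by (intro nn_integral_cong) (auto simp: indicator_def HY sum_ennreal)
      also have "\<dots> = (\<integral>\<^sup>+z. (\<Sum>j\<in>UNIV. ennreal ((F j z - net j z)\<^sup>2)) \<partial>\<mu>)"
        by (rule \<mu>int[OF gm, symmetric])
      also have "\<dots> = (\<Sum>j\<in>UNIV. \<integral>\<^sup>+z. ennreal ((F j z - net j z)\<^sup>2) \<partial>\<mu>)"
        by (rule nn_integral_sum[OF gm1])
      also have "\<dots> \<le> (\<Sum>j\<in>UNIV. ennreal (B j / real P))" by (intro sum_mono int)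
      also have "\<dots> = ennreal ((\<Sum>j\<in>UNIV. B j) / real P)"
        using Bp by (simp add: sum_ennreal sum_divide_distrib)
      finally show ?thesis .
    qed
    have main: "set_nn_integral lborel K (\<lambda>z0. ennreal ((norm (Z' z0 t - X z0 t))\<^sup>2)) \<le> ennreal (e * (\<Sum>j\<in>UNIV. B j) / real P)"
      if Z': "\<And>z0. solves_ode_on T f z0 (Z' z0)" and Xs: "\<And>z0. solves_ode_on T g z0 (X z0)" and t: "t \<in> {0..T}" for Z' X t
    proof -
      \<comment> \<open>Uniqueness: both flows solve the same Lipschitz equation from the same
        initial value, so the comparison has zero defect.\<close>
      have ZZ: "Z' z0 t = Z z0 t" for z0
      proof -
        have "(norm (Z' z0 t - Z z0 t))\<^sup>2 \<le> exp ((2 * L + 1) * T) * ((norm (z0 - z0))\<^sup>2 + integral {0..T} (\<lambda>s. (norm (f (Z' z0 s) s - f (Z' z0 s) s))\<^sup>2))"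
          by (rule ode_comparison[OF Z' Z L(2) _ _ t]) (use L in auto)
        then show ?thesis by simp
      qed
      \<comment> \<open>Gronwall for each initial value separately; its bound integrates the defect
        over the whole time interval, so it does not involve t. Integration over K and Tonelli then
        produce the total defect.\<close>
      have pt: "ennreal ((norm (Z' z0 t - X z0 t))\<^sup>2) * indicator K z0 \<le> ennreal e * (\<integral>\<^sup>+s. ennreal (indicator Y (z0, s) * H (z0, s)) \<partial>lborel)" for z0
      proof (cases "z0 \<in> K")
        case True
        have "(norm (Z z0 t - X z0 t))\<^sup>2 \<le> e * ((norm (z0 - z0))\<^sup>2 + integral {0..T} (\<lambda>s. (norm (f (Z z0 s) s - g (Z z0 s) s))\<^sup>2))"
          unfolding e_def by (rule ode_comparison[OF Z Xs glip V _ t]) (use cH1[OF True] in \<open>simp add: H_def\<close>)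
        then have 1: "(norm (Z' z0 t - X z0 t))\<^sup>2 \<le> e * integral {0..T} (\<lambda>s. H (z0, s))"
          by (simp add: ZZ H_def)
        have si: "set_integrable lborel {0..T} (\<lambda>s. H (z0, s))"
          by (rule borel_integrable_atLeastAtMost'[OF cH1[OF True]])
        have "ennreal (integral {0..T} (\<lambda>s. H (z0, s))) = ennreal (\<integral>s. indicator {0..T} s *\<^sub>R H (z0, s) \<partial>lborel)"
          using set_borel_integral_eq_integral(2)[OF si] by (simp add: set_lebesgue_integral_def)
        also have "\<dots> = (\<integral>\<^sup>+s. ennreal (indicator {0..T} s *\<^sub>R H (z0, s)) \<partial>lborel)"
          using si H0 by (intro nn_integral_eq_integral[symmetric]) (auto simp: set_integrable_def)
        also have "\<dots> = (\<integral>\<^sup>+s. ennreal (indicator Y (z0, s) * H (z0, s)) \<partial>lborel)"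
          using True by (intro nn_integral_cong) (auto simp: Y_def indicator_def)
        finally have 2: "ennreal (integral {0..T} (\<lambda>s. H (z0, s))) = (\<integral>\<^sup>+s. ennreal (indicator Y (z0, s) * H (z0, s)) \<partial>lborel)" .
        have "ennreal ((norm (Z' z0 t - X z0 t))\<^sup>2) \<le> ennreal (e * integral {0..T} (\<lambda>s. H (z0, s)))"
          using 1 by (rule ennreal_leI)
        also have "\<dots> = ennreal e * ennreal (integral {0..T} (\<lambda>s. H (z0, s)))"
          by (rule ennreal_mult') (simp add: e_def)
        finally show ?thesis using True 2 by simp
      qed simp
      have Hm2: "(\<lambda>y. ennreal (indicator Y y * H y)) \<in> borel_measurable (lborel \<Otimes>\<^sub>M lborel)"
        unfolding lborel_prod using Hm by simp
      have Hm3: "(\<lambda>z0. \<integral>\<^sup>+s. ennreal (indicator Y (z0, s) * H (z0, s)) \<partial>lborel) \<in> borel_measurable lborel"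
        using lborel.borel_measurable_nn_integral_fst[OF Hm2] by simp
      have "set_nn_integral lborel K (\<lambda>z0. ennreal ((norm (Z' z0 t - X z0 t))\<^sup>2))
         \<le> (\<integral>\<^sup>+z0. ennreal e * (\<integral>\<^sup>+s. ennreal (indicator Y (z0, s) * H (z0, s)) \<partial>lborel) \<partial>lborel)"
        by (intro nn_integral_mono pt)
      also have "\<dots> = ennreal e * (\<integral>\<^sup>+z0. (\<integral>\<^sup>+s. ennreal (indicator Y (z0, s) * H (z0, s)) \<partial>lborel) \<partial>lborel)"
        by (rule nn_integral_cmult[OF Hm3])
      also have "(\<integral>\<^sup>+z0. (\<integral>\<^sup>+s. ennreal (indicator Y (z0, s) * H (z0, s)) \<partial>lborel) \<partial>lborel) = (\<integral>\<^sup>+y. ennreal (indicator Y y * H y) \<partial>lborel)"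
        using lborel.nn_integral_fst[OF Hm2] unfolding lborel_prod by simp
      also have "ennreal e * \<dots> \<le> ennreal e * ennreal ((\<Sum>j\<in>UNIV. B j) / real P)"
        by (intro mult_left_mono total) simp
      also have "\<dots> = ennreal (e * ((\<Sum>j\<in>UNIV. B j) / real P))"
        by (rule ennreal_mult'[symmetric]) (simp add: e_def)
      finally show ?thesis by simp
    qed
    show "\<exists>W A1 A2 B'. \<forall>Z X.
                 (\<forall>z0. solves_ode_on T f z0 (Z z0)) \<and>
                 (\<forall>z0. solves_ode_on T (relu_field P W A1 A2 B') z0 (X z0)) \<longrightarrow>
                 (\<forall>t\<in>{0..T}.
                    set_nn_integral lborel K (\<lambda>z0. ennreal ((norm (Z z0 t - X z0 t))\<^sup>2))
                      \<le> ennreal (e * (\<Sum>j\<in>UNIV. B j) / real P))"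
      by (rule exI[of _ "\<lambda>i. \<chi> j. \<sigma> j i * M j / real P"], rule exI[of _ "\<lambda>i. \<chi> j. fst (a j i)"],
          rule exI[of _ "\<lambda>i. \<chi> j. snd (a j i)"], rule exI[of _ "\<lambda>i. \<chi> j. b j i"])
         (use main in \<open>auto simp: g_def\<close>)
  qed
next
  case False
  \<comment> \<open>Without a family of solutions the premise of the implication fails, so any
    constant serves.\<close>
  then show ?thesis by blast
qed

end
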